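(* There is an absolute constant $C>0$ such that the following holds. For every instance of the collaborative bandit model (described in the context) there is $T_0\in\mathbb{N}$ such that for all horizons $T\ge T_0$ the collaborative regret of the algorithm CExp$^2$ (described in the context), run with horizon $T$ and with $\pi'$ equal to W-CPE-Reg, satisfies $$\mathcal{R}(T)\le C\left(c^*\log(T)+\frac{(\Delta'_{\max})^2}{\Delta'_{\min}}\,(\log\log(T))^4\right).$$
   Context: **Notation.** $[N]=\{1,\dots,N\}$. $\mathbb{R}^+$ denotes the nonnegative reals; in expressions $w^2/q$ use $0/0=0$ and $a/0=+\infty$ for $a>0$. If an argmin or argmax is not unique, any element may be chosen. **Model.** There are $K\ge 2$ arms and $M\ge 1$ agents, and a horizon $T$. At each time $t\in[T]$ each agent $m\in[M]$ may select an arm $\pi_m(t)=k\in[K]$ and then observes a local reward $X_{k,m}(t)$. Rewards are independent across $k,m$ and i.i.d. across $t$, with law $\nu_{k,m}$ that is $\sigma$-sub-Gaussian ($\mathbb{E}[e^{\eta(X-\mathbb{E}X)}]\le e^{\eta^2\sigma^2/2}$ for all $\eta\in\mathbb{R}$) and mean $\mu_{k,m}$. A known weight matrix $W=(w_{n,m})\in[0,1]^{M\times M}$ satisfies $\sum_{n}w_{n,m}=1$ for all $m$. Expected mixed rewards: $\mu'_{k,m}=\sum_{n=1}^M w_{n,m}\mu_{k,n}$. The arm $k^*_m=\arg\max_k\mu'_{k,m}$ is assumed unique. Gaps: $\Delta'_{k,m}=\mu'_{k^*_m,m}-\mu'_{k,m}$; $\tilde\Delta'_{k,m}=\Delta'_{k,m}$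 for $k\ne k^*_m$ and $\tilde\Delta'_{k^*_m,m}=\min_{k\neq k^*_m}\Delta'_{k,m}$; $\Delta'_{\min}=\min_{k,m}\tilde\Delta'_{k,m}$, $\Delta'_{\max}=\max_{k,m}\tilde\Delta'_{k,m}$. An instance consists of $K,M,W$ and $(\nu_{k,m})$. Agents may communicate: in a communication round, all agents send the sample means of their local observations to a server, which broadcasts them to all agents. The collaborative regret is $\mathcal{R}(T)=\mathbb{E}\big[\sum_{m=1}^M\sum_{t=1}^T(\mu'_{k^*_m,m}-\mu'_{\pi_m(t),m})\big]$; an agent that has completed its prescribed plays of a phase before the other agents stays idle until the phase ends, idle rounds contributing $0$ to the regret. **Complexity.** $$c^*=\min_{q\in(\mathbb{R}^+)^{K\times M}}\sum_{m\in[M]}\sum_{k\ne k^*_m}q_{k,m}\tilde\Delta'_{k,m}\quad\text{subject to}\quad\forall m\in[M],\ \forall k\in[K]:\ \sum_{n\in[M]:\,k^*_n\ne k}\frac{w_{n,m}^2}{q_{k,n}}\le\frac{(\tilde\Delta'_{k,m})^2}{2}.$$ **Oracle.** For $\Delta$ with positive entries, $\mathcal{P}(\Delta)$ is the argmin over $q\in(\mathbb{R}^+)^{K\times M}$ of $\sum_{k,m}q_{k,m}\Delta_{k,m}$ subject to $\sum_{n\in[M]}w_{n,m}^2/q_{k,n}\le\Delta_{k,m}^2/2$ for all $k,m$. **Sample means and confidence widths.** $\tau_{k,m}(t)$ is the number of plays of arm $k$ by agent $m$ up to time $t$; $\hat\mu_{k,m}(t)$ is the sample mean of these observations; $\hat\mu'_{k,m}(t)=\sum_{n=1}^M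 w_{n,m}\hat\mu_{k,n}(t)$. The estimated gaps $\hat\Delta'_{k,m}(t)$ are defined from $\hat\mu'(t)$ as $\tilde\Delta'$ is from $\mu'$: $\max_j\hat\mu'_{j,m}(t)-\hat\mu'_{k,m}(t)$ if $k$ is not the empirically best arm of agent $m$, and the difference between the largest and second largest empirical mixed means if it is. For $\delta\in(0,1)$, $$\Omega^\delta_{k,m}(t)=\sqrt{\beta_\delta(\tau_{k,\cdot}(t))\sum_{n=1}^M\frac{w_{n,m}^2}{\tau_{k,n}(t)}},\qquad \beta_\delta(N)=2\Big(g_M\big(\tfrac{\delta}{KM}\big)+2\sum_{m=1}^M\log(4+\log N_m)\Big)$$ (width $+\infty$ if some $\tau_{k,n}(t)=0$). Here $g_M$ is a fixed nonincreasing function (due to Kaufmann and Koolen) with $g_M(\delta)\simeq\log(1/\delta)+M\log\log(1/\delta)$ (ratio tending to $1$ as $\delta\to0$), for which, in this model, for every $\delta\in(0,1)$, with probability at least $1-\delta$: $|\hat\mu'_{k,m}(t)-\mu'_{k,m}|\le\Omega^\delta_{k,m}(t)$ for all $t\in\mathbb{N}$, $k$, $m$. **Algorithm CExp$^2$** (horizon $T$). Let $\delta'=1/T$ and $B(T)=\beta_{\delta'}(T,\dots,T)=2\big(g_M(\tfrac{1}{KMT})+2M\log(4+\log T)\big)$. 1. *Initial exploration.* Each agent plays each arm $\tau_1=\lceil\sqrt{\log T}\rceil$ times. Let $T_{\rm ie}$ be the end of this phase. Agents communicate (one round) and compute $\hat\Delta'_{k,m}(T_{\rm ie})$. 2. *Guided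 exploration.* Set $\hat\Delta^{\rm ge}_{k,m}=\min\{\max\{\hat\Delta'_{k,m}(T_{\rm ie}),\tfrac1{\log\log T}\},\log\log T\}$ and $q^{\rm ge}=\mathcal{P}(\hat\Delta^{\rm ge})$. Each agent $m$ plays each arm $k$ until its total number of plays is $\tau^{\rm ge}_{k,m}=\max\{\tau_1,\lceil18q^{\rm ge}_{k,m}B(T)\rceil\}$. Let $T_{\rm ge}$ be the end of this phase. Agents communicate (one round) and compute $\hat\mu'_{k,m}(T_{\rm ge})$, $\hat\Delta'_{k,m}(T_{\rm ge})$. 3. *Exploitation/switch.* If condition $\mathcal{C}$ holds, namely $\Omega^{\delta'}_{k,m}(T_{\rm ge})<\hat\Delta'_{k,m}(T_{\rm ge})/2$ for all $k,m$, each agent $m$ plays $\arg\max_k\hat\mu'_{k,m}(T_{\rm ge})$ until time $T$, without further communication. Otherwise all data are reset and the policy $\pi'$ is played until time $T$. **W-CPE-Reg.** Run W-CPE-BAI (Réda et al., 2022) with $\delta=1/T$ until it stops (or time $T$ is reached); then each agent $m$ plays its returned arm $\hat k_m$ for the remaining time. W-CPE-BAI: each agent first plays each arm once; set $r=0$, $\mathcal{B}_m(0)=[K]$ and $D_{k,m}(0)=1$. Repeat until $|\mathcal{B}_m(r)|=1$ for all $m$, then output these single arms. In phase $r$: let $t(r)$ be the argmin of $\sum_{k,m}q_{k,m}$ over $q\in(\mathbb{R}^+)^{K\times M}$ subject to $\sum_n w_{n,m}^2/q_{k,n}\le(\sqrt2 D_{k,m}(r))^2/2$ for all $k,m$. With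 $n_{k,m}$ the current play counts, for each $k$ let $(d_{k,m})_m\in\mathbb{N}^M$ minimize $\sum_m d_m$ subject to $(n_{k,m}+d_m)/\beta_\delta(n_{k,\cdot}+d)\ge t_{k,m}(r)$ for all $m$. Agent $m$ plays each $k\in\bigcup_n\mathcal{B}_n(r)$ exactly $d_{k,m}$ times; agents communicate (one round). With the updated $\hat\mu'$ and $\Omega^\delta$, set $\mathcal{B}_m(r+1)=\{k\in\mathcal{B}_m(r):\hat\mu'_{k,m}+\Omega^\delta_{k,m}\ge\max_{j\in\mathcal{B}_m(r)}(\hat\mu'_{j,m}-\Omega^\delta_{j,m})\}$; set $D_{k,m}(r+1)=D_{k,m}(r)/2$ if $k\in\mathcal{B}_m(r+1)$ and $|\mathcal{B}_m(r+1)|>1$, and $D_{k,m}(r+1)=D_{k,m}(r)$ otherwise; increase $r$ by $1$. *)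

theory Defs
  imports "HOL-Probability.Probability" "HOL-Library.Landau_Symbols"
begin

section \<open>Instances\<close>

text \<open>Arms and agents are numbered from 1. In \<open>law I k m\<close> and in every other matrix with
  an arm and an agent index the arm comes first; \<open>weight I n m\<close> is the entry $w_{n,m}$.\<close>

record bandit =
  narms :: nat
  nagents :: nat
  weight :: "nat \<Rightarrow> nat \<Rightarrow> real"
  law :: "nat \<Rightarrow> nat \<Rightarrow> real measure"

abbreviation arms :: "bandit \<Rightarrow> nat set" where
  "arms I \<equiv> {1..narms I}"

abbreviation agents :: "bandit \<Rightarrow> nat set" where
  "agents I \<equiv> {1..nagents I}"

definition subgaussian :: "real \<Rightarrow> real measure \<Rightarrow> bool" where
  "subgaussian \<sigma> N \<longleftrightarrow>
     prob_space N \<and> sets N = sets borel \<and> integrable N (\<lambda>x. x) \<and>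
     (\<forall>\<eta>. integrable N (\<lambda>x. exp (\<eta> * (x - (\<integral>y. y \<partial>N)))) \<and>
          (\<integral>x. exp (\<eta> * (x - (\<integral>y. y \<partial>N))) \<partial>N) \<le> exp (\<eta>\<^sup>2 * \<sigma>\<^sup>2 / 2))"

definition mixed_mean :: "bandit \<Rightarrow> nat \<Rightarrow> nat \<Rightarrow> real" where
  "mixed_mean I k m = (\<Sum>n\<in>agents I. weight I n m * (\<integral>x. x \<partial>law I k n))"

definition bandit_instance :: "real \<Rightarrow> bandit \<Rightarrow> bool" where
  "bandit_instance \<sigma> I \<longleftrightarrow>
     \<sigma> > 0 \<and> narms I \<ge> 2 \<and> nagents I \<ge> 1 \<and>
     (\<forall>n\<in>agents I. \<forall>m\<in>agents I. weight I n m \<in> {0..1}) \<and>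
     (\<forall>m\<in>agents I. (\<Sum>n\<in>agents I. weight I n m) = 1) \<and>
     (\<forall>k\<in>arms I. \<forall>m\<in>agents I. subgaussian \<sigma> (law I k m)) \<and>
     (\<forall>m\<in>agents I. \<exists>!k. is_arg_max (\<lambda>j. mixed_mean I j m) (\<lambda>j. j \<in> arms I) k)"


section \<open>Gaps\<close>

text \<open>The next three definitions act on the vector \<open>v\<close> of (true or empirical) mixed means of
  one agent. If \<open>v\<close> has several maximizers, \<open>adj_gap\<close> is 0 at each of them, so the
  choice made by \<open>arg_max\<close> does not influence its values.\<close>

definition best :: "bandit \<Rightarrow> (nat \<Rightarrow> real) \<Rightarrow> nat" where
  "best I v = arg_max v (\<lambda>k. k \<in> arms I)"

definition gap :: "bandit \<Rightarrow> (nat \<Rightarrow> real) \<Rightarrow> nat \<Rightarrow> real" where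
  "gap I v k = v (best I v) - v k"

definition adj_gap :: "bandit \<Rightarrow> (nat \<Rightarrow> real) \<Rightarrow> nat \<Rightarrow> real" where
  "adj_gap I v k =
     (if k = best I v then Min (gap I v ` (arms I - {k})) else gap I v k)"

definition best_arm :: "bandit \<Rightarrow> nat \<Rightarrow> nat" where
  "best_arm I m = best I (\<lambda>j. mixed_mean I j m)"

definition true_gap :: "bandit \<Rightarrow> nat \<Rightarrow> nat \<Rightarrow> real" where
  "true_gap I k m = gap I (\<lambda>j. mixed_mean I j m) k"

definition true_adj_gap :: "bandit \<Rightarrow> nat \<Rightarrow> nat \<Rightarrow> real" where
  "true_adj_gap I k m = adj_gap I (\<lambda>j. mixed_mean I j m) k"

definition gap_min :: "bandit \<Rightarrow> real" where
  "gap_min I = Min ((\<lambda>(k, m). true_adj_gap I k m) ` (arms I \<times> agents I))"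

definition gap_max :: "bandit \<Rightarrow> real" where
  "gap_max I = Max ((\<lambda>(k, m). true_adj_gap I k m) ` (arms I \<times> agents I))"


section \<open>Complexity and oracle\<close>

text \<open>Division on \<open>ereal\<close> satisfies $0/0 = 0$ and $a/0 = \infty$ for $a > 0$.\<close>

definition c_star_feasible :: "bandit \<Rightarrow> (nat \<Rightarrow> nat \<Rightarrow> real) \<Rightarrow> bool" where
  "c_star_feasible I q \<longleftrightarrow>
     (\<forall>k\<in>arms I. \<forall>m\<in>agents I. q k m \<ge> 0) \<and>
     (\<forall>m\<in>agents I. \<forall>k\<in>arms I.
        (\<Sum>n\<in>{n\<in>agents I. best_arm I n \<noteq> k}. ereal ((weight I n m)\<^sup>2) / ereal (q k n))
          \<le> ereal ((true_adj_gap I k m)\<^sup>2 / 2))"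

text \<open>On an instance the infimum is attained: the objective is continuous and coercive in the
  coordinates on which it and the constraints depend, and the feasible set is closed.\<close>

definition c_star :: "bandit \<Rightarrow> real" where
  "c_star I = (INF q\<in>Collect (c_star_feasible I).
     \<Sum>m\<in>agents I. \<Sum>k\<in>arms I - {best_arm I m}. q k m * true_adj_gap I k m)"

definition feasible :: "bandit \<Rightarrow> (nat \<Rightarrow> nat \<Rightarrow> real) \<Rightarrow> (nat \<Rightarrow> nat \<Rightarrow> real) \<Rightarrow> bool" where
  "feasible I \<Delta> q \<longleftrightarrow>
     (\<forall>k\<in>arms I. \<forall>m\<in>agents I. q k m \<ge> 0) \<and>
     (\<forall>k\<in>arms I. \<forall>m\<in>agents I.
        (\<Sum>n\<in>agents I. ereal ((weight I n m)\<^sup>2) / ereal (q k n)) \<le> ereal ((\<Delta> k m)\<^sup>2 / 2))"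

definition oracle_sol :: "bandit \<Rightarrow> (nat \<Rightarrow> nat \<Rightarrow> real) \<Rightarrow> (nat \<Rightarrow> nat \<Rightarrow> real) \<Rightarrow> bool" where
  "oracle_sol I \<Delta> q \<longleftrightarrow>
     is_arg_min (\<lambda>q. \<Sum>k\<in>arms I. \<Sum>m\<in>agents I. q k m * \<Delta> k m) (feasible I \<Delta>) q"


section \<open>Rewards, plays and policies\<close>

text \<open>A point \<open>\<omega>\<close> of the reward space is a complete table of rewards, \<open>\<omega> (k, m, t)\<close> being
  $X_{k,m}(t)$. A play table \<open>p\<close> gives in \<open>p m t\<close> the arm played by agent \<open>m\<close> at time \<open>t\<close>;
  \<open>None\<close> means that the agent is idle.\<close>

type_synonym rewards = "nat \<times> nat \<times> nat \<Rightarrow> real"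
type_synonym plays = "nat \<Rightarrow> nat \<Rightarrow> nat option"

definition reward_space :: "bandit \<Rightarrow> rewards measure" where
  "reward_space I = PiM (arms I \<times> agents I \<times> {1..}) (\<lambda>(k, m, t). law I k m)"

text \<open>A policy decides at time \<open>t\<close> from the plays and the observed rewards of the times
  before \<open>t\<close>.\<close>

definition policy :: "bandit \<Rightarrow> (rewards \<Rightarrow> plays) \<Rightarrow> bool" where
  "policy I \<pi> \<longleftrightarrow>
     (\<forall>m\<in>agents I. \<forall>t\<ge>1.
        (\<lambda>\<omega>. \<pi> \<omega> m t) \<in> reward_space I \<rightarrow>\<^sub>M count_space (insert None (Some ` arms I))) \<and>
     (\<forall>\<omega>\<in>space (reward_space I). \<forall>\<omega>'\<in>space (reward_space I). \<forall>t\<ge>1.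
        (\<forall>s\<in>{1..<t}. \<forall>m\<in>agents I. \<pi> \<omega> m s = \<pi> \<omega>' m s \<and>
           (\<forall>k. \<pi> \<omega> m s = Some k \<longrightarrow> \<omega> (k, m, s) = \<omega>' (k, m, s)))
        \<longrightarrow> (\<forall>m\<in>agents I. \<pi> \<omega> m t = \<pi> \<omega>' m t))"

definition regret :: "bandit \<Rightarrow> (rewards \<Rightarrow> plays) \<Rightarrow> nat \<Rightarrow> real" where
  "regret I \<pi> T =
     (\<integral>\<omega>. (\<Sum>m\<in>agents I. \<Sum>t\<in>{1..T}.
        case \<pi> \<omega> m t of None \<Rightarrow> 0 | Some k \<Rightarrow> true_gap I k m) \<partial>reward_space I)"


section \<open>Sample means and confidence widths\<close>

text \<open>All statistics are computed from the data of the times in \<open>{s<..t}\<close>, where \<open>s\<close> is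
  the time of the last reset of the data (0 if there was none).\<close>

definition play_times :: "plays \<Rightarrow> nat \<Rightarrow> nat \<Rightarrow> nat \<Rightarrow> nat \<Rightarrow> nat set" where
  "play_times p s t k m = {u \<in> {s<..t}. p m u = Some k}"

definition num_plays :: "plays \<Rightarrow> nat \<Rightarrow> nat \<Rightarrow> nat \<Rightarrow> nat \<Rightarrow> nat" where
  "num_plays p s t k m = card (play_times p s t k m)"

definition emp_mean :: "rewards \<Rightarrow> plays \<Rightarrow> nat \<Rightarrow> nat \<Rightarrow> nat \<Rightarrow> nat \<Rightarrow> real" where
  "emp_mean \<omega> p s t k m =
     (\<Sum>u\<in>play_times p s t k m. \<omega> (k, m, u)) / real (num_plays p s t k m)"

definition emp_mixed :: "bandit \<Rightarrow> rewards \<Rightarrow> plays \<Rightarrow> nat \<Rightarrow> nat \<Rightarrow> nat \<Rightarrow> nat \<Rightarrow> real" where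
  "emp_mixed I \<omega> p s t k m = (\<Sum>n\<in>agents I. weight I n m * emp_mean \<omega> p s t k n)"

definition emp_gap :: "bandit \<Rightarrow> rewards \<Rightarrow> plays \<Rightarrow> nat \<Rightarrow> nat \<Rightarrow> nat \<Rightarrow> nat \<Rightarrow> real" where
  "emp_gap I \<omega> p s t k m = adj_gap I (\<lambda>j. emp_mixed I \<omega> p s t j m) k"

definition beta :: "(nat \<Rightarrow> real \<Rightarrow> real) \<Rightarrow> bandit \<Rightarrow> real \<Rightarrow> (nat \<Rightarrow> nat) \<Rightarrow> real" where
  "beta g I \<delta> N =
     2 * (g (nagents I) (\<delta> / (real (narms I) * real (nagents I)))
          + 2 * (\<Sum>m\<in>agents I. ln (4 + ln (real (N m)))))"

definition width ::
  "(nat \<Rightarrow> real \<Rightarrow> real) \<Rightarrow> bandit \<Rightarrow> real \<Rightarrow> plays \<Rightarrow> nat \<Rightarrow> nat \<Rightarrow> nat \<Rightarrow> nat \<Rightarrow> ereal" where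
  "width g I \<delta> p s t k m =
     (if \<exists>n\<in>agents I. num_plays p s t k n = 0 then \<infinity>
      else ereal (sqrt (beta g I \<delta> (num_plays p s t k) *
                  (\<Sum>n\<in>agents I. (weight I n m)\<^sup>2 / real (num_plays p s t k n)))))"

definition threshold_family :: "(nat \<Rightarrow> real \<Rightarrow> real) \<Rightarrow> bool" where
  "threshold_family g \<longleftrightarrow>
     (\<forall>M\<ge>1. antimono_on {0<..<1} (g M) \<and>
        g M \<sim>[at_right 0] (\<lambda>\<delta>. ln (1 / \<delta>) + real M * ln (ln (1 / \<delta>))))"

definition concentration :: "(nat \<Rightarrow> real \<Rightarrow> real) \<Rightarrow> bandit \<Rightarrow> bool" where
  "concentration g I \<longleftrightarrow>
     (\<forall>\<pi> \<delta>. policy I \<pi> \<and> 0 < \<delta> \<and> \<delta> < 1 \<longrightarrow>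
        measure (reward_space I)
          {\<omega> \<in> space (reward_space I). \<forall>t. \<forall>k\<in>arms I. \<forall>m\<in>agents I.
             ereal \<bar>emp_mixed I \<omega> (\<pi> \<omega>) 0 t k m - mixed_mean I k m\<bar> \<le> width g I \<delta> (\<pi> \<omega>) 0 t k m}
        \<ge> 1 - \<delta>)"


section \<open>Phases\<close>

text \<open>During the times \<open>{s<..e}\<close> every agent \<open>m\<close> plays every arm \<open>k\<close> exactly \<open>c k m\<close> times,
  in any order, and is idle after its last play. The number of available rounds then forces it
  to play without interruption before, and the phase ends when the last agent is done.\<close>

definition phase :: "bandit \<Rightarrow> plays \<Rightarrow> nat \<Rightarrow> nat \<Rightarrow> (nat \<Rightarrow> nat \<Rightarrow> nat) \<Rightarrow> bool" where
  "phase I p s e c \<longleftrightarrow>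
     e = s + Max ((\<lambda>m. \<Sum>k\<in>arms I. c k m) ` agents I) \<and>
     (\<forall>m\<in>agents I.
        (\<forall>k\<in>arms I. num_plays p s e k m = c k m) \<and>
        (\<forall>t\<in>{s + (\<Sum>k\<in>arms I. c k m)<..e}. p m t = None))"


section \<open>W-CPE-Reg\<close>

text \<open>\<open>wcpe_loop g I \<delta> T \<omega> p s e B D\<close>: the plays \<open>p\<close> at the times in \<open>{e<..T}\<close> are those of the
  algorithm, started at time \<open>s\<close>, when at time \<open>e\<close> a phase begins with candidate sets \<open>B m\<close>
  and parameters \<open>D k m\<close>. A phase still running at time \<open>T\<close> is described in full by
  \<open>p\<close>; its part after \<open>T\<close> does not enter the regret.\<close>

inductive wcpe_loop ::
  "(nat \<Rightarrow> real \<Rightarrow> real) \<Rightarrow> bandit \<Rightarrow> real \<Rightarrow> nat \<Rightarrow> rewards \<Rightarrow> plays \<Rightarrow> nat \<Rightarrow>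
   nat \<Rightarrow> (nat \<Rightarrow> nat set) \<Rightarrow> (nat \<Rightarrow> nat \<Rightarrow> real) \<Rightarrow> bool"
  for g I \<delta> T \<omega> p s
where
  stop:
    "\<lbrakk>\<forall>m\<in>agents I. card (B m) = 1;
      \<forall>m\<in>agents I. \<forall>t\<in>{e<..T}. p m t = Some (the_elem (B m))\<rbrakk>
     \<Longrightarrow> wcpe_loop g I \<delta> T \<omega> p s e B D"
| horizon:
    "e \<ge> T \<Longrightarrow> wcpe_loop g I \<delta> T \<omega> p s e B D"
| step:
    "\<lbrakk>\<not> (\<forall>m\<in>agents I. card (B m) = 1);
      is_arg_min (\<lambda>q. \<Sum>k\<in>arms I. \<Sum>m\<in>agents I. q k m)
        (feasible I (\<lambda>k m. sqrt 2 * D k m)) q;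
      \<forall>k\<in>arms I. is_arg_min (\<lambda>x. \<Sum>m\<in>agents I. x m)
        (\<lambda>x. \<forall>m\<in>agents I.
           real (num_plays p s e k m + x m) / beta g I \<delta> (\<lambda>n. num_plays p s e k n + x n) \<ge> q k m)
        (d k);
      phase I p e e' (\<lambda>k m. if k \<in> (\<Union>n\<in>agents I. B n) then d k m else 0);
      \<forall>m\<in>agents I. B' m = {k \<in> B m.
        ereal (emp_mixed I \<omega> p s e' k m) + width g I \<delta> p s e' k m
          \<ge> Max ((\<lambda>j. ereal (emp_mixed I \<omega> p s e' j m) - width g I \<delta> p s e' j m) ` B m)};
      \<forall>k\<in>arms I. \<forall>m\<in>agents I.
        D' k m = (if k \<in> B' m \<and> card (B' m) > 1 then D k m / 2 else D k m);
      wcpe_loop g I \<delta> T \<omega> p s e' B' D'\<rbrakk>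
     \<Longrightarrow> wcpe_loop g I \<delta> T \<omega> p s e B D"

definition wcpe_reg ::
  "(nat \<Rightarrow> real \<Rightarrow> real) \<Rightarrow> bandit \<Rightarrow> nat \<Rightarrow> rewards \<Rightarrow> plays \<Rightarrow> nat \<Rightarrow> bool" where
  "wcpe_reg g I T \<omega> p s \<longleftrightarrow>
     (\<exists>e. phase I p s e (\<lambda>k m. 1) \<and>
          wcpe_loop g I (1 / real T) T \<omega> p s e (\<lambda>m. arms I) (\<lambda>k m. 1))"


section \<open>CExp2\<close>

text \<open>\<open>cexp2 g I T alt \<omega> p\<close>: on the rewards \<open>\<omega>\<close> the plays \<open>p\<close> up to time \<open>T\<close> are a possible
  outcome of the algorithm, where \<open>alt \<omega> p s\<close> says that from the reset at time \<open>s\<close> on they are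
  a possible outcome of the policy used after the switch.\<close>

definition init_plays :: "nat \<Rightarrow> nat" where
  "init_plays T = nat \<lceil>sqrt (ln (real T))\<rceil>"

definition cexp2 ::
  "(nat \<Rightarrow> real \<Rightarrow> real) \<Rightarrow> bandit \<Rightarrow> nat \<Rightarrow> (rewards \<Rightarrow> plays \<Rightarrow> nat \<Rightarrow> bool) \<Rightarrow>
   rewards \<Rightarrow> plays \<Rightarrow> bool" where
  "cexp2 g I T alt \<omega> p \<longleftrightarrow>
     (\<exists>Tie Tge q.
        phase I p 0 Tie (\<lambda>k m. init_plays T) \<and>
        oracle_sol I
          (\<lambda>k m. min (max (emp_gap I \<omega> p 0 Tie k m) (1 / ln (ln (real T)))) (ln (ln (real T)))) q \<and>
        phase I p Tie Tge
          (\<lambda>k m. max (init_plays T) (nat \<lceil>18 * q k m * beta g I (1 / real T) (\<lambda>n. T)\<rceil>)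
                 - init_plays T) \<and>
        (if \<forall>k\<in>arms I. \<forall>m\<in>agents I.
              width g I (1 / real T) p 0 Tge k m < ereal (emp_gap I \<omega> p 0 Tge k m / 2)
         then \<forall>m\<in>agents I. \<exists>k.
              is_arg_max (\<lambda>j. emp_mixed I \<omega> p 0 Tge j m) (\<lambda>j. j \<in> arms I) k \<and>
              (\<forall>t\<in>{Tge<..T}. p m t = Some k)
         else alt \<omega> p Tge))"

text \<open>Ties between minimizers or maximizers, and the order of the plays within a phase, may be
  resolved by any rule that makes the result a policy.\<close>

definition cexp2_run ::
  "(nat \<Rightarrow> real \<Rightarrow> real) \<Rightarrow> bandit \<Rightarrow> nat \<Rightarrow> (rewards \<Rightarrow> plays \<Rightarrow> nat \<Rightarrow> bool) \<Rightarrow>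
   (rewards \<Rightarrow> plays) \<Rightarrow> bool" where
  "cexp2_run g I T alt \<pi> \<longleftrightarrow>
     policy I \<pi> \<and> (\<forall>\<omega>\<in>space (reward_space I). cexp2 g I T alt \<omega> (\<pi> \<omega>))"

end

theory Submission
  imports Defs "HOL-Real_Asymp.Real_Asymp"
begin

text \<open>The regret splits according to whether the gaps estimated after the initial exploration are
  accurate. If they are, the oracle allocation costs at most a constant times \<open>c_star\<close>, the
  switching condition holds and the right arms are exploited. If they are not, which by the
  concentration inequality with $\delta = \exp(-c\sqrt{\log T})$ instead of $1/T$ has at most this
  probability $\delta$, every later phase, W-CPE-Reg included, costs only polylogarithmically many
  plays unless a confidence bound at level $1/T$ fails; so this case contributes $o(\log T)$. Since
  \<open>c_star\<close> is positive, $T_0$ can be chosen such that all lower-order terms, in particular the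
  $(\log\log T)^4$ term, are dominated by $c^* \log T$.\<close>

section \<open>Gaps and complexity\<close>

text \<open>\<open>concentration\<close> covers data collected from time 0 on, whereas the policy
  after the switch uses data collected since a reset whose time depends on the rewards. That time
  lies in a fixed window, but the bound on its length is of order log T (log log T)^4: with failure
  probability 1/T for each reset time and linear regret on failure, a plain union bound would exceed
  the order of \<open>c_star I\<close> log T. Hence failures after a reset are counted only jointly
  with inaccurate initial estimates. Inaccuracy is decided before the reset, and resampling all
  later rewards bounds the joint probability by \<epsilon>/T, where \<epsilon> bounds the
  probability of inaccuracy. The choice of \<epsilon> is tied to the number of initial plays, about
  sqrt (log T): accuracy \<open>gap_min I / 8\<close> at level \<epsilon> takes of order log
  (1/\<epsilon>) plays, so \<epsilon> = exp (-c sqrt (log T)) is affordable for small c, and it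
  beats every power of log T. The constant is 2000 = 18 * 20 * 5 + 200: the factor 18 of the guided
  plays, the loss 20 of the oracle against \<open>c_star\<close>, the bound 5 log T on
  \<open>beta\<close>, and slack for lower-order terms.\<close>

lemma ereal_weight_sum_le_iff:
  fixes w x :: "nat \<Rightarrow> real"
  assumes "finite S" and "\<And>n. n \<in> S \<Longrightarrow> x n \<ge> 0"
  shows "(\<Sum>n\<in>S. ereal ((w n)\<^sup>2) / ereal (x n)) \<le> ereal c \<longleftrightarrow>
    (\<forall>n\<in>S. w n \<noteq> 0 \<longrightarrow> x n > 0) \<and> (\<Sum>n\<in>S. (w n)\<^sup>2 / x n) \<le> c"
proof (cases "\<forall>n\<in>S. w n \<noteq> 0 \<longrightarrow> x n > 0")
  case True
  have "ereal ((w n)\<^sup>2) / ereal (x n) = ereal ((w n)\<^sup>2 / x n)" if "n \<in> S" for n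
    using True that assms(2)[OF that] by (cases "w n = 0") (auto simp: ereal_divide)
  then have "(\<Sum>n\<in>S. ereal ((w n)\<^sup>2) / ereal (x n)) = ereal (\<Sum>n\<in>S. (w n)\<^sup>2 / x n)"
    by simp
  with True show ?thesis
    by simp
next
  case False
  then obtain n where n: "n \<in> S" "w n \<noteq> 0" "x n \<le> 0"
    by force
  then have "x n = 0"
    using assms(2)[of n] by simp
  with n have "ereal ((w n)\<^sup>2) / ereal (x n) = \<infinity>"
    by simp
  moreover have "ereal ((w n)\<^sup>2) / ereal (x n) \<ge> 0" if "n \<in> S" for n
    using assms(2)[OF that] by simp
  ultimately have "(\<Sum>n\<in>S. ereal ((w n)\<^sup>2) / ereal (x n)) = \<infinity>"
    using n(1) assms(1) sum_Pinfty by metis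
  with False show ?thesis
    by auto
qed

section \<open>Best arms and adjusted gaps of an arbitrary score vector\<close>

lemma is_arg_max_best:
  assumes "narms I \<ge> 2"
  shows "is_arg_max v (\<lambda>k. k \<in> arms I) (best I v)"
proof -
  have "\<exists>k. is_arg_max v (\<lambda>k. k \<in> arms I) k"
  proof -
    have "Max (v ` arms I) \<in> v ` arms I"
      using assms by (intro Max_in) auto
    then obtain k where "k \<in> arms I" "v k = Max (v ` arms I)"
      by force
    then have "is_arg_max v (\<lambda>k. k \<in> arms I) k"
      by (simp add: is_arg_max_linorder)
    then show ?thesis ..
  qed
  then show ?thesis
    unfolding best_def arg_max_def by (rule someI_ex)
qed

lemma best_in_arms: "narms I \<ge> 2 \<Longrightarrow> best I v \<in> arms I"
  using is_arg_max_best[of I v] by (simp add: is_arg_max_linorder)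

lemma best_ge: "narms I \<ge> 2 \<Longrightarrow> k \<in> arms I \<Longrightarrow> v k \<le> v (best I v)"
  using is_arg_max_best[of I v] by (simp add: is_arg_max_linorder)

lemma best_eqI:
  assumes "narms I \<ge> 2" "k \<in> arms I" "\<And>j. j \<in> arms I - {k} \<Longrightarrow> v j < v k"
  shows "best I v = k"
  using best_in_arms[OF assms(1), of v] best_ge[OF assms(1,2), of v] assms(3)[of "best I v"] by force

lemma other_arms_nonempty:
  assumes "narms I \<ge> 2"
  shows "arms I - {k} \<noteq> {}"
proof -
  have "1 \<in> arms I" "2 \<in> arms I"
    using assms by auto
  then have "(if k = 1 then 2 else 1) \<in> arms I - {k}"
    by auto
  then show ?thesis
    by blast
qed

lemma gap_nonneg: "narms I \<ge> 2 \<Longrightarrow> k \<in> arms I \<Longrightarrow> gap I v k \<ge> 0"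
  by (simp add: gap_def best_ge del: atLeastAtMost_iff)

lemma adj_gap_best_le:
  assumes "narms I \<ge> 2" "k \<in> arms I"
  shows "adj_gap I v (best I v) \<le> adj_gap I v k"
  using assms by (auto simp: adj_gap_def intro!: Min_le)

lemma adj_gap_best_attained:
  assumes "narms I \<ge> 2"
  obtains j where "j \<in> arms I - {best I v}" "adj_gap I v (best I v) = adj_gap I v j"
proof -
  have "Min (gap I v ` (arms I - {best I v})) \<in> gap I v ` (arms I - {best I v})"
    by (intro Min_in) (use other_arms_nonempty[OF assms] in auto)
  then obtain j where "j \<in> arms I - {best I v}" "Min (gap I v ` (arms I - {best I v})) = gap I v j"
    by (metis imageE)
  then show ?thesis
    by (intro that[of j]) (auto simp: adj_gap_def)
qed

text \<open>A comparison of gaps at suboptimal arms passes to the minimum at the best arm: evaluate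
  both sides at the arm \<open>j\<close> that attains the minimum for \<open>v\<close>. A negative
  \<open>a\<close> is settled by the signs of the gaps.\<close>

lemma adj_gap_ge_scaled:
  assumes "narms I \<ge> 2"
    and le: "\<And>j. j \<in> arms I - {best I u} \<Longrightarrow> a * gap I u j \<le> gap I v j"
    and "best I v = best I u" "k \<in> arms I"
  shows "a * adj_gap I u k \<le> adj_gap I v k"
proof (cases "k = best I u")
  case False
  then show ?thesis
    using assms by (simp add: adj_gap_def)
next
  case True
  obtain j where j: "j \<in> arms I - {best I v}" "adj_gap I v (best I v) = adj_gap I v j"
    using adj_gap_best_attained[OF assms(1)] by blast
  have jv: "adj_gap I v j = gap I v j" and ju: "adj_gap I u j = gap I u j"
    using j(1) assms(3) by (auto simp: adj_gap_def)
  show ?thesis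
  proof (cases "a \<ge> 0")
    case a: True
    have "adj_gap I u k \<le> gap I u j"
      using adj_gap_best_le[OF assms(1), of j u] j(1) True ju by auto
    then have "a * adj_gap I u k \<le> a * gap I u j"
      using a by (rule mult_left_mono)
    also have "\<dots> \<le> gap I v j"
      using le[of j] j(1) assms(3) by simp
    finally show ?thesis
      using True assms(3) j(2) jv by simp
  next
    case False
    have "adj_gap I u k \<ge> 0"
      using adj_gap_best_attained[OF assms(1), of u] gap_nonneg[OF assms(1)] True
      by (metis DiffD1 DiffD2 adj_gap_def insertI1)
    then have "a * adj_gap I u k \<le> 0"
      using False by (simp add: mult_nonpos_nonneg)
    also have "\<dots> \<le> gap I v j"
      using gap_nonneg[OF assms(1)] j(1) by blast
    finally show ?thesis
      using True assms(3) j(2) jv by simp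
  qed
qed

text \<open>This is the lower bound with \<open>u\<close> and \<open>v\<close> exchanged and the
  factor \<open>1 / b\<close>.\<close>

lemma adj_gap_le_scaled:
  assumes "narms I \<ge> 2"
    and "\<And>j. j \<in> arms I - {best I u} \<Longrightarrow> gap I v j \<le> b * gap I u j"
    and "best I v = best I u" "k \<in> arms I" "b > 0"
  shows "adj_gap I v k \<le> b * adj_gap I u k"
proof -
  have "(1 / b) * adj_gap I v k \<le> adj_gap I u k"
    by (rule adj_gap_ge_scaled) (use assms in \<open>auto simp: field_simps\<close>)
  with assms(5) show ?thesis
    by (simp add: field_simps)
qed

section \<open>Gaps of a fixed instance\<close>

locale bandit_model =
  fixes \<sigma> :: real and I :: bandit
  assumes bandit: "bandit_instance \<sigma> I"
begin

abbreviation "K \<equiv> narms I"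
abbreviation "M \<equiv> nagents I"
abbreviation "w \<equiv> weight I"

lemma K_ge: "K \<ge> 2" and M_ge: "M \<ge> 1"
  using bandit by (auto simp: bandit_instance_def)

lemma weight_range: "n \<in> agents I \<Longrightarrow> m \<in> agents I \<Longrightarrow> 0 \<le> w n m \<and> w n m \<le> 1"
  using bandit by (auto simp: bandit_instance_def)

lemma weight_sum: "m \<in> agents I \<Longrightarrow> (\<Sum>n\<in>agents I. w n m) = 1"
  using bandit by (auto simp: bandit_instance_def)

lemma weight_square_le: "n \<in> agents I \<Longrightarrow> m \<in> agents I \<Longrightarrow> (w n m)\<^sup>2 \<le> 1"
  using weight_range[of n m] by (simp add: power_le_one)

lemma best_arm_in_arms: "best_arm I m \<in> arms I"
  unfolding best_arm_def by (rule best_in_arms[OF K_ge])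

lemma true_gap_nonneg: "k \<in> arms I \<Longrightarrow> true_gap I k m \<ge> 0"
  unfolding true_gap_def by (rule gap_nonneg[OF K_ge])

lemma true_gap_best_arm [simp]: "true_gap I (best_arm I m) m = 0"
  by (simp add: true_gap_def gap_def best_arm_def)

text \<open>Uniqueness of the best arm enters here: another arm with gap 0 would be a second
  maximizer.\<close>

lemma true_gap_pos:
  assumes "m \<in> agents I" "k \<in> arms I" "k \<noteq> best_arm I m"
  shows "true_gap I k m > 0"
proof (rule ccontr)
  let ?v = "\<lambda>j. mixed_mean I j m"
  assume "\<not> true_gap I k m > 0"
  then have "?v k \<ge> ?v (best_arm I m)"
    by (simp add: true_gap_def gap_def best_arm_def)
  then have "is_arg_max ?v (\<lambda>j. j \<in> arms I) k" "is_arg_max ?v (\<lambda>j. j \<in> arms I) (best_arm I m)"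
    using is_arg_max_best[OF K_ge, of ?v] assms(2)
    by (auto simp: is_arg_max_linorder best_arm_def intro: order_trans)
  then show False
    using bandit assms(1,3) unfolding bandit_instance_def by blast
qed

lemma true_adj_gap_eq: "k \<noteq> best_arm I m \<Longrightarrow> true_adj_gap I k m = true_gap I k m"
  by (simp add: true_adj_gap_def true_gap_def adj_gap_def best_arm_def)

lemma true_adj_gap_best_arm_le: "k \<in> arms I \<Longrightarrow> true_adj_gap I (best_arm I m) m \<le> true_adj_gap I k m"
  unfolding true_adj_gap_def best_arm_def by (rule adj_gap_best_le[OF K_ge])

text \<open>The runner-up is the arm most easily confused with the best one. Its constraint in the
  complexity has the same right-hand side as that of the best arm, and the two are later used as a
  pair.\<close>

lemma second_best_arm:
  obtains j where "j \<in> arms I - {best_arm I m}"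
    "true_adj_gap I j m = true_adj_gap I (best_arm I m) m"
  using adj_gap_best_attained[OF K_ge, of "\<lambda>j. mixed_mean I j m"]
  unfolding true_adj_gap_def best_arm_def by metis

lemma true_adj_gap_pos:
  assumes "m \<in> agents I" "k \<in> arms I"
  shows "true_adj_gap I k m > 0"
proof (cases "k = best_arm I m")
  case True
  obtain j where "j \<in> arms I - {best_arm I m}"
    "true_adj_gap I j m = true_adj_gap I (best_arm I m) m"
    by (rule second_best_arm)
  with True assms show ?thesis
    using true_adj_gap_eq[of j m] true_gap_pos[of m j] by auto
qed (use assms true_adj_gap_eq true_gap_pos in auto)

lemma true_gap_le_adj: "m \<in> agents I \<Longrightarrow> k \<in> arms I \<Longrightarrow> true_gap I k m \<le> true_adj_gap I k m"
  using true_adj_gap_eq[of k m] true_adj_gap_pos[of m k]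
  by (cases "k = best_arm I m") auto

lemma index_set_nonempty: "arms I \<times> agents I \<noteq> {}"
  using K_ge M_ge by auto

lemma gap_min_le: "k \<in> arms I \<Longrightarrow> m \<in> agents I \<Longrightarrow> gap_min I \<le> true_adj_gap I k m"
  unfolding gap_min_def by (intro Min_le) force+

lemma gap_max_ge: "k \<in> arms I \<Longrightarrow> m \<in> agents I \<Longrightarrow> true_adj_gap I k m \<le> gap_max I"
  unfolding gap_max_def by (intro Max_ge) force+

lemma gap_min_pos: "gap_min I > 0"
  unfolding gap_min_def using index_set_nonempty true_adj_gap_pos
  by (subst Min_gr_iff) auto

lemma true_gap_le_max: "m \<in> agents I \<Longrightarrow> k \<in> arms I \<Longrightarrow> true_gap I k m \<le> gap_max I"
  using true_gap_le_adj[of m k] gap_max_ge[of k m] by simp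

lemma gap_min_le_true_gap:
  "m \<in> agents I \<Longrightarrow> k \<in> arms I \<Longrightarrow> k \<noteq> best_arm I m \<Longrightarrow> gap_min I \<le> true_gap I k m"
  using gap_min_le[of k m] true_adj_gap_eq[of k m] by simp

lemma gap_max_pos: "gap_max I > 0"
proof -
  have "1 \<in> arms I" "1 \<in> agents I"
    using K_ge M_ge by auto
  then show ?thesis
    using gap_max_ge true_adj_gap_pos by (meson less_le_trans)
qed

section \<open>Allocations and the complexity \<open>c_star\<close>\<close>

lemma feasible_iff:
  "feasible I \<Delta> q \<longleftrightarrow> (\<forall>k\<in>arms I. \<forall>m\<in>agents I. q k m \<ge> 0) \<and>
    (\<forall>k\<in>arms I. \<forall>m\<in>agents I. (\<forall>n\<in>agents I. w n m \<noteq> 0 \<longrightarrow> q k n > 0) \<and>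
       (\<Sum>n\<in>agents I. (w n m)\<^sup>2 / q k n) \<le> (\<Delta> k m)\<^sup>2 / 2)"
  unfolding feasible_def
  by (rule conj_cong[OF refl], rule ball_cong[OF refl], rule ball_cong[OF refl],
      rule ereal_weight_sum_le_iff) auto

lemma c_star_feasible_iff:
  "c_star_feasible I q \<longleftrightarrow> (\<forall>k\<in>arms I. \<forall>m\<in>agents I. q k m \<ge> 0) \<and>
    (\<forall>m\<in>agents I. \<forall>k\<in>arms I.
       (\<forall>n\<in>agents I. best_arm I n \<noteq> k \<longrightarrow> w n m \<noteq> 0 \<longrightarrow> q k n > 0) \<and>
       (\<Sum>n\<in>{n\<in>agents I. best_arm I n \<noteq> k}. (w n m)\<^sup>2 / q k n) \<le> (true_adj_gap I k m)\<^sup>2 / 2)"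
proof (cases "\<forall>k\<in>arms I. \<forall>m\<in>agents I. q k m \<ge> 0")
  case True
  then have "((\<Sum>n\<in>{n\<in>agents I. best_arm I n \<noteq> k}. ereal ((w n m)\<^sup>2) / ereal (q k n))
          \<le> ereal ((true_adj_gap I k m)\<^sup>2 / 2)) \<longleftrightarrow>
      (\<forall>n\<in>{n\<in>agents I. best_arm I n \<noteq> k}. w n m \<noteq> 0 \<longrightarrow> q k n > 0) \<and>
       (\<Sum>n\<in>{n\<in>agents I. best_arm I n \<noteq> k}. (w n m)\<^sup>2 / q k n) \<le> (true_adj_gap I k m)\<^sup>2 / 2"
    if "k \<in> arms I" for k m
    using that by (intro ereal_weight_sum_le_iff) auto
  then show ?thesis
    unfolding c_star_feasible_def by auto
qed (auto simp: c_star_feasible_def)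

lemma feasible_sum:
  "feasible I \<Delta> q \<Longrightarrow> k \<in> arms I \<Longrightarrow> m \<in> agents I \<Longrightarrow>
    (\<Sum>n\<in>agents I. (w n m)\<^sup>2 / q k n) \<le> (\<Delta> k m)\<^sup>2 / 2"
  unfolding feasible_iff by blast

lemma feasible_pos:
  "feasible I \<Delta> q \<Longrightarrow> k \<in> arms I \<Longrightarrow> m \<in> agents I \<Longrightarrow> n \<in> agents I \<Longrightarrow> w n m \<noteq> 0 \<Longrightarrow> q k n > 0"
  unfolding feasible_iff by blast

lemma feasible_nonneg: "feasible I \<Delta> q \<Longrightarrow> k \<in> arms I \<Longrightarrow> m \<in> agents I \<Longrightarrow> q k m \<ge> 0"
  unfolding feasible_iff by blast

lemma c_star_feasible_sum:
  "c_star_feasible I q \<Longrightarrow> k \<in> arms I \<Longrightarrow> m \<in> agents I \<Longrightarrow>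
    (\<Sum>n\<in>{n\<in>agents I. best_arm I n \<noteq> k}. (w n m)\<^sup>2 / q k n) \<le> (true_adj_gap I k m)\<^sup>2 / 2"
  unfolding c_star_feasible_iff by blast

lemma c_star_feasible_pos:
  "c_star_feasible I q \<Longrightarrow> k \<in> arms I \<Longrightarrow> m \<in> agents I \<Longrightarrow> n \<in> agents I \<Longrightarrow>
    best_arm I n \<noteq> k \<Longrightarrow> w n m \<noteq> 0 \<Longrightarrow> q k n > 0"
  unfolding c_star_feasible_iff by blast

lemma c_star_feasible_nonneg:
  "c_star_feasible I q \<Longrightarrow> k \<in> arms I \<Longrightarrow> m \<in> agents I \<Longrightarrow> q k m \<ge> 0"
  unfolding c_star_feasible_iff by blast

text \<open>Squared weights are at most 1, so the constraint sum is at most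
  \<open>real M / x\<close>, and \<open>x\<close> makes this equal to half the square of
  \<open>D\<close>. The constant allocation serves as competitor in the a priori bounds on
  minimizers.\<close>

lemma feasible_const:
  assumes "\<And>k m. k \<in> arms I \<Longrightarrow> m \<in> agents I \<Longrightarrow> \<Delta> k m \<ge> D" and "D > 0" and "x = 2 * real M / D\<^sup>2"
  shows "feasible I \<Delta> (\<lambda>k m. x)"
proof -
  have x: "x > 0"
    using assms M_ge by simp
  have "(\<Sum>n\<in>agents I. (w n m)\<^sup>2 / x) \<le> (\<Delta> k m)\<^sup>2 / 2" if "k \<in> arms I" "m \<in> agents I" for k m
  proof -
    have "(\<Sum>n\<in>agents I. (w n m)\<^sup>2 / x) \<le> (\<Sum>n\<in>agents I. 1 / x)"
      using x weight_square_le that(2) by (intro sum_mono divide_right_mono) auto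
    also have "\<dots> = D\<^sup>2 / 2"
      using assms M_ge by simp
    also have "\<dots> \<le> (\<Delta> k m)\<^sup>2 / 2"
      using assms(1)[OF that] assms(2) by (simp add: power_mono)
    finally show ?thesis .
  qed
  with x show ?thesis
    by (auto simp: feasible_iff)
qed

lemma c_star_feasible_exists: "\<exists>q. c_star_feasible I q"
proof
  let ?x = "2 * real M / (gap_min I)\<^sup>2"
  have f: "feasible I (true_adj_gap I) (\<lambda>k m. ?x)"
    by (rule feasible_const[OF gap_min_le gap_min_pos refl])
  have x: "?x > 0"
    using M_ge gap_min_pos by simp
  have "(\<Sum>n\<in>{n\<in>agents I. best_arm I n \<noteq> k}. (w n m)\<^sup>2 / ?x) \<le> (true_adj_gap I k m)\<^sup>2 / 2"
    if "k \<in> arms I" "m \<in> agents I" for k m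
  proof -
    have "(\<Sum>n\<in>{n\<in>agents I. best_arm I n \<noteq> k}. (w n m)\<^sup>2 / ?x) \<le> (\<Sum>n\<in>agents I. (w n m)\<^sup>2 / ?x)"
      using x by (intro sum_mono2) auto
    also have "\<dots> \<le> (true_adj_gap I k m)\<^sup>2 / 2"
      using f that by (rule feasible_sum)
    finally show ?thesis .
  qed
  with x show "c_star_feasible I (\<lambda>k m. ?x)"
    by (simp add: c_star_feasible_iff)
qed

abbreviation c_star_cost :: "(nat \<Rightarrow> nat \<Rightarrow> real) \<Rightarrow> real" where
  "c_star_cost q \<equiv> \<Sum>m\<in>agents I. \<Sum>k\<in>arms I - {best_arm I m}. q k m * true_adj_gap I k m"

text \<open>\<open>c_star\<close> is an infimum of reals; the existence of a feasible allocation is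
  what lets a common lower bound of the costs carry over to it.\<close>

lemma c_star_ge:
  assumes "\<And>q. c_star_feasible I q \<Longrightarrow> c \<le> c_star_cost q"
  shows "c \<le> c_star I"
  unfolding c_star_def using c_star_feasible_exists assms by (intro cINF_greatest) auto

lemma c_star_cost_ge:
  assumes "c_star_feasible I q" "m \<in> agents I" "k \<in> arms I - {best_arm I m}"
  shows "q k m * true_adj_gap I k m \<le> c_star_cost q"
proof -
  have nn: "q k m * true_adj_gap I k m \<ge> 0" if "k \<in> arms I" "m \<in> agents I" for k m
    using c_star_feasible_nonneg[OF assms(1) that] true_adj_gap_pos[of m k] that by simp
  have "q k m * true_adj_gap I k m \<le> (\<Sum>k\<in>arms I - {best_arm I m}. q k m * true_adj_gap I k m)"
    using assms nn by (intro member_le_sum) auto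
  also have "\<dots> \<le> c_star_cost q"
    using assms nn
    by (intro member_le_sum[where f = "\<lambda>m. \<Sum>k\<in>arms I - {best_arm I m}. q k m * true_adj_gap I k m"])
       (auto intro!: sum_nonneg)
  finally show ?thesis .
qed

text \<open>Some agent \<open>n\<close> has positive weight for agent 1, and some arm
  \<open>k\<close> is suboptimal for \<open>n\<close>. The single summand of \<open>n\<close> in the
  constraint of \<open>k\<close> and agent 1 keeps \<open>q k n\<close>, and hence the cost, away
  from 0.\<close>

lemma c_star_pos: "c_star I > 0"
proof -
  have m: "1 \<in> agents I"
    using M_ge by simp
  obtain n where n: "n \<in> agents I" "w n 1 > 0"
  proof -
    have False if "\<forall>n\<in>agents I. w n 1 \<le> 0"
    proof -
      have "(\<Sum>n\<in>agents I. w n 1) \<le> 0"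
        using that by (intro sum_nonpos) blast
      with weight_sum[OF m] show False
        by simp
    qed
    then show ?thesis
      using that by force
  qed
  obtain k where k: "k \<in> arms I - {best_arm I n}"
    using other_arms_nonempty[OF K_ge] by blast
  define D where "D = true_adj_gap I k 1"
  have D: "D > 0"
    using k m true_adj_gap_pos by (simp add: D_def)
  have En: "true_adj_gap I k n > 0"
    using k n true_adj_gap_pos by simp
  define c where "c = 2 * (w n 1)\<^sup>2 / D\<^sup>2 * true_adj_gap I k n"
  have "c > 0"
    using D En n by (simp add: c_def)
  moreover have "c \<le> c_star I"
  proof (rule c_star_ge)
    fix q assume q: "c_star_feasible I q"
    have qpos: "q k n > 0"
      using c_star_feasible_pos[OF q _ m n(1), of k] k n(2) by auto
    have "(w n 1)\<^sup>2 / q k n \<le> (\<Sum>n\<in>{n\<in>agents I. best_arm I n \<noteq> k}. (w n 1)\<^sup>2 / q k n)"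
      using n k c_star_feasible_nonneg[OF q, of k]
      by (intro member_le_sum[where f = "\<lambda>n. (w n 1)\<^sup>2 / q k n"]) auto
    also have "\<dots> \<le> D\<^sup>2 / 2"
      using c_star_feasible_sum[OF q _ m, of k] k unfolding D_def by blast
    finally have "2 * (w n 1)\<^sup>2 / D\<^sup>2 \<le> q k n"
      using qpos D by (simp add: field_simps)
    then have "c \<le> q k n * true_adj_gap I k n"
      unfolding c_def using En by (intro mult_right_mono) auto
    also have "\<dots> \<le> c_star_cost q"
      using q n k by (intro c_star_cost_ge) auto
    finally show "c \<le> c_star_cost q" .
  qed
  ultimately show ?thesis
    by simp
qed

text \<open>\<open>Q n\<close> counts the plays of all suboptimal arms by agent \<open>n\<close>.
  For every \<open>n\<close> at least one of two arms is suboptimal: the best arm of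
  \<open>m\<close>, or, if \<open>n\<close> shares that best arm, the runner-up \<open>j\<close> of
  \<open>m\<close>. So \<open>1 / Q n\<close> is controlled by the constraint at one of the two
  arms. Both right-hand sides equal half the square of the smallest gap of \<open>m\<close>, and
  they add up.\<close>

lemma sum_weight_over_total:
  assumes q: "c_star_feasible I q" and m: "m \<in> agents I"
  defines "Q \<equiv> \<lambda>n. \<Sum>k\<in>arms I - {best_arm I n}. q k n"
  shows "(\<Sum>n\<in>agents I. (w n m)\<^sup>2 / Q n) \<le> (true_adj_gap I (best_arm I m) m)\<^sup>2"
    and "\<And>n. n \<in> agents I \<Longrightarrow> w n m \<noteq> 0 \<Longrightarrow> Q n > 0"
proof -
  obtain j where j: "j \<in> arms I - {best_arm I m}"
    "true_adj_gap I j m = true_adj_gap I (best_arm I m) m"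
    by (rule second_best_arm)
  let ?b = "best_arm I m"
  define N where "N = {n\<in>agents I. best_arm I n \<noteq> ?b}"
  define N' where "N' = {n\<in>agents I. best_arm I n \<noteq> j}"
  have Qge: "q k n \<le> Q n" if "n \<in> agents I" "k \<in> arms I" "k \<noteq> best_arm I n" for k n
    unfolding Q_def using c_star_feasible_nonneg[OF q] that by (intro member_le_sum) auto
  have Q0: "Q n \<ge> 0" if "n \<in> agents I" for n
    unfolding Q_def using c_star_feasible_nonneg[OF q] that by (intro sum_nonneg) auto
  have pos: "q k n > 0" if "n \<in> agents I" "k \<in> arms I" "best_arm I n \<noteq> k" "w n m \<noteq> 0" for k n
    using c_star_feasible_pos[OF q _ m] that by blast
  show Qpos: "Q n > 0" if n: "n \<in> agents I" "w n m \<noteq> 0" for n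
  proof -
    obtain k where "k \<in> arms I - {best_arm I n}"
      using other_arms_nonempty[OF K_ge] by blast
    then show ?thesis
      using pos[of n k] Qge[of n k] n by force
  qed
  have le: "(w n m)\<^sup>2 / Q n \<le> (w n m)\<^sup>2 / q k n"
    if "n \<in> agents I" "k \<in> arms I" "best_arm I n \<noteq> k" for n k
    using pos[of n k] Qge[of n k] that by (cases "w n m = 0") (auto intro!: divide_left_mono)
  have "(\<Sum>n\<in>agents I. (w n m)\<^sup>2 / Q n) =
      (\<Sum>n\<in>N. (w n m)\<^sup>2 / Q n) + (\<Sum>n\<in>agents I - N. (w n m)\<^sup>2 / Q n)"
    by (rule sum.subset_diff[THEN trans, OF _ _ add.commute]) (auto simp: N_def)
  also have "(\<Sum>n\<in>N. (w n m)\<^sup>2 / Q n) \<le> (\<Sum>n\<in>N. (w n m)\<^sup>2 / q ?b n)"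
    using best_arm_in_arms le by (intro sum_mono) (auto simp: N_def)
  also have "\<dots> \<le> (true_adj_gap I ?b m)\<^sup>2 / 2"
    using c_star_feasible_sum[OF q best_arm_in_arms m] by (simp add: N_def)
  also have "(\<Sum>n\<in>agents I - N. (w n m)\<^sup>2 / Q n) \<le> (\<Sum>n\<in>N'. (w n m)\<^sup>2 / Q n)"
    using j Q0 by (intro sum_mono2) (auto simp: N_def N'_def)
  also have "\<dots> \<le> (\<Sum>n\<in>N'. (w n m)\<^sup>2 / q j n)"
    using j le by (intro sum_mono) (auto simp: N'_def)
  also have "\<dots> \<le> (true_adj_gap I ?b m)\<^sup>2 / 2"
    using c_star_feasible_sum[OF q _ m, of j] j by (simp add: N'_def)
  finally show "(\<Sum>n\<in>agents I. (w n m)\<^sup>2 / Q n) \<le> (true_adj_gap I ?b m)\<^sup>2"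
    by simp
qed

text \<open>The oracle, unlike \<open>c_star\<close>, also pays for the plays of an agent's own best arm. Giving
  that arm as many plays as all other arms of the agent together costs only a constant factor:
  the confusable pair formed by the two best arms of agent \<open>m\<close> already forces every relevant
  agent to make that many plays at the smallest gap of \<open>m\<close>.\<close>

lemma feasible_extension:
  assumes q: "c_star_feasible I q"
  obtains q' where "feasible I (true_adj_gap I) q'"
    "(\<Sum>k\<in>arms I. \<Sum>m\<in>agents I. q' k m * true_adj_gap I k m) \<le> 6 * c_star_cost q"
proof -
  define Q where "Q = (\<lambda>n. \<Sum>k\<in>arms I - {best_arm I n}. q k n)"
  \<comment> \<open>The factor 2 brings the agents for which \<open>k\<close> is suboptimal down to
    a quarter of the squared gap; the factor 4 does the same for the agents with best arm
    \<open>k\<close>, whose bound through \<open>Q\<close> is twice as large. Together they give the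
    half that is allowed, at cost 2 + 4 = 6.\<close>
  define q' where "q' = (\<lambda>k n. if k = best_arm I n then 4 * Q n else 2 * q k n)"
  have q0: "q k n \<ge> 0" if "k \<in> arms I" "n \<in> agents I" for k n
    using c_star_feasible_nonneg[OF q] that by blast
  have Q0: "Q n \<ge> 0" if "n \<in> agents I" for n
    unfolding Q_def using q0 that by (intro sum_nonneg) auto
  have "feasible I (true_adj_gap I) q'"
    unfolding feasible_iff
  proof (intro conjI ballI impI)
    fix k m assume "k \<in> arms I" "m \<in> agents I"
    then show "q' k m \<ge> 0"
      using q0 Q0 by (simp add: q'_def)
  next
    fix k m n assume "k \<in> arms I" "m \<in> agents I" "n \<in> agents I" "w n m \<noteq> 0"
    then show "q' k n > 0"
      using sum_weight_over_total(2)[OF q, of m n] c_star_feasible_pos[OF q, of k m n]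
      by (simp add: q'_def Q_def)
  next
    fix k m assume k: "k \<in> arms I" and m: "m \<in> agents I"
    let ?N = "{n\<in>agents I. best_arm I n \<noteq> k}"
    have "(\<Sum>n\<in>agents I. (w n m)\<^sup>2 / q' k n) =
        (\<Sum>n\<in>?N. (w n m)\<^sup>2 / q' k n) + (\<Sum>n\<in>agents I - ?N. (w n m)\<^sup>2 / q' k n)"
      by (rule sum.subset_diff[THEN trans, OF _ _ add.commute]) auto
    also have "(\<Sum>n\<in>?N. (w n m)\<^sup>2 / q' k n) = (\<Sum>n\<in>?N. (w n m)\<^sup>2 / q k n) / 2"
      unfolding sum_divide_distrib by (rule sum.cong) (auto simp: q'_def)
    also have "\<dots> \<le> (true_adj_gap I k m)\<^sup>2 / 2 / 2"
      using c_star_feasible_sum[OF q k m] by (intro divide_right_mono) auto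
    also have "(\<Sum>n\<in>agents I - ?N. (w n m)\<^sup>2 / q' k n) = (\<Sum>n\<in>agents I - ?N. (w n m)\<^sup>2 / (4 * Q n))"
      by (rule sum.cong) (auto simp: q'_def)
    also have "\<dots> \<le> (\<Sum>n\<in>agents I. (w n m)\<^sup>2 / (4 * Q n))"
      using Q0 by (intro sum_mono2) auto
    also have "\<dots> = (\<Sum>n\<in>agents I. (w n m)\<^sup>2 / Q n) / 4"
      unfolding sum_divide_distrib by (rule sum.cong) auto
    also have "\<dots> \<le> (true_adj_gap I (best_arm I m) m)\<^sup>2 / 4"
      using sum_weight_over_total(1)[OF q m] by (simp add: Q_def)
    also have "\<dots> \<le> (true_adj_gap I k m)\<^sup>2 / 4"
      using true_adj_gap_best_arm_le[OF k, of m] true_adj_gap_pos[OF m best_arm_in_arms, of m]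
      by (intro divide_right_mono power_mono) auto
    finally show "(\<Sum>n\<in>agents I. (w n m)\<^sup>2 / q' k n) \<le> (true_adj_gap I k m)\<^sup>2 / 2"
      by simp
  qed
  moreover have "(\<Sum>k\<in>arms I. \<Sum>m\<in>agents I. q' k m * true_adj_gap I k m) \<le> 6 * c_star_cost q"
  proof -
    have "(\<Sum>k\<in>arms I. q' k m * true_adj_gap I k m)
        \<le> 6 * (\<Sum>k\<in>arms I - {best_arm I m}. q k m * true_adj_gap I k m)" if m: "m \<in> agents I" for m
    proof -
      let ?b = "best_arm I m"
      have "(\<Sum>k\<in>arms I. q' k m * true_adj_gap I k m) =
          q' ?b m * true_adj_gap I ?b m + (\<Sum>k\<in>arms I - {?b}. q' k m * true_adj_gap I k m)"
        by (rule sum.remove) (use best_arm_in_arms in auto)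
      also have "(\<Sum>k\<in>arms I - {?b}. q' k m * true_adj_gap I k m) =
          2 * (\<Sum>k\<in>arms I - {?b}. q k m * true_adj_gap I k m)"
        unfolding sum_distrib_left by (rule sum.cong) (auto simp: q'_def)
      also have "q' ?b m * true_adj_gap I ?b m =
          4 * (\<Sum>k\<in>arms I - {?b}. q k m * true_adj_gap I ?b m)"
        by (simp add: q'_def Q_def sum_distrib_right)
      also have "\<dots> \<le> 4 * (\<Sum>k\<in>arms I - {?b}. q k m * true_adj_gap I k m)"
        using m q0 true_adj_gap_best_arm_le by (intro mult_left_mono sum_mono) auto
      finally show ?thesis
        by simp
    qed
    then show ?thesis
      by (subst sum.swap) (auto simp: sum_distrib_left intro!: sum_mono)
  qed
  ultimately show ?thesis
    by (rule that)
qed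

lemma feasible_scale:
  assumes "feasible I \<Delta> q" and "\<And>k m. k \<in> arms I \<Longrightarrow> m \<in> agents I \<Longrightarrow> (\<Delta> k m)\<^sup>2 \<le> c * (\<Delta>' k m)\<^sup>2"
    and c: "c > 0"
  shows "feasible I \<Delta>' (\<lambda>k m. c * q k m)"
proof -
  have "(\<Sum>n\<in>agents I. (w n m)\<^sup>2 / (c * q k n)) \<le> (\<Delta>' k m)\<^sup>2 / 2" if "k \<in> arms I" "m \<in> agents I" for k m
  proof -
    have "(\<Sum>n\<in>agents I. (w n m)\<^sup>2 / (c * q k n)) = (\<Sum>n\<in>agents I. (w n m)\<^sup>2 / q k n) / c"
      unfolding sum_divide_distrib by (rule sum.cong) (auto simp: mult.commute)
    also have "\<dots> \<le> (\<Delta> k m)\<^sup>2 / 2 / c"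
      using feasible_sum[OF assms(1) that] c by (intro divide_right_mono) auto
    also have "\<dots> \<le> (\<Delta>' k m)\<^sup>2 / 2"
      using assms(2)[OF that] c by (simp add: field_simps)
    finally show ?thesis .
  qed
  then show ?thesis
    unfolding feasible_iff
    using feasible_nonneg[OF assms(1)] feasible_pos[OF assms(1)] c by simp
qed

text \<open>Since the square of 4/3 is below 2, twice the extension of a
  \<open>c_star\<close>-feasible allocation is feasible for \<open>\<Delta>\<close> and competes
  with \<open>q\<close>. The factor is 4/3 (from true to estimated gaps) times 2 (scaling) times 5/4
  (back to true gaps) times 6 (extension).\<close>

lemma oracle_cost_le:
  assumes q: "oracle_sol I \<Delta> q"
    and \<Delta>: "\<And>k m. k \<in> arms I \<Longrightarrow> m \<in> agents I \<Longrightarrow>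
      3 / 4 * true_adj_gap I k m \<le> \<Delta> k m \<and> \<Delta> k m \<le> 5 / 4 * true_adj_gap I k m"
  shows "(\<Sum>k\<in>arms I. \<Sum>m\<in>agents I. q k m * true_adj_gap I k m) \<le> 20 * c_star I"
proof -
  have q0: "q k n \<ge> 0" if "k \<in> arms I" "n \<in> agents I" for k n
    using q that feasible_nonneg[of \<Delta> q k n] by (simp add: oracle_sol_def is_arg_min_linorder)
  have "(\<Sum>k\<in>arms I. \<Sum>m\<in>agents I. q k m * true_adj_gap I k m) / 20 \<le> c_star_cost r"
    if r: "c_star_feasible I r" for r
  proof -
    obtain r' where r': "feasible I (true_adj_gap I) r'"
      "(\<Sum>k\<in>arms I. \<Sum>m\<in>agents I. r' k m * true_adj_gap I k m) \<le> 6 * c_star_cost r"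
      using feasible_extension[OF r] by blast
    have r0: "r' k n \<ge> 0" if "k \<in> arms I" "n \<in> agents I" for k n
      using feasible_nonneg[OF r'(1) that] .
    have f: "feasible I \<Delta> (\<lambda>k m. 2 * r' k m)"
    proof (rule feasible_scale[OF r'(1)])
      fix k m assume km: "k \<in> arms I" "m \<in> agents I"
      have "(3 / 4 * true_adj_gap I k m)\<^sup>2 \<le> (\<Delta> k m)\<^sup>2"
        using \<Delta>[OF km] true_adj_gap_pos[of m k] km by (intro power_mono) auto
      then have "9 * (true_adj_gap I k m)\<^sup>2 \<le> 16 * (\<Delta> k m)\<^sup>2"
        by (simp add: power_mult_distrib power2_eq_square)
      moreover have "(\<Delta> k m)\<^sup>2 \<ge> 0"
        by simp
      ultimately show "(true_adj_gap I k m)\<^sup>2 \<le> 2 * (\<Delta> k m)\<^sup>2"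
        by linarith
    qed simp
    have "(\<Sum>k\<in>arms I. \<Sum>m\<in>agents I. q k m * true_adj_gap I k m) \<le>
        (\<Sum>k\<in>arms I. \<Sum>m\<in>agents I. 4 / 3 * (q k m * \<Delta> k m))"
    proof (intro sum_mono)
      fix k m assume km: "k \<in> arms I" "m \<in> agents I"
      have "q k m * (3 / 4 * true_adj_gap I k m) \<le> q k m * \<Delta> k m"
        using \<Delta>[OF km] q0[OF km] by (intro mult_left_mono) auto
      then show "q k m * true_adj_gap I k m \<le> 4 / 3 * (q k m * \<Delta> k m)"
        by simp
    qed
    also have "\<dots> = 4 / 3 * (\<Sum>k\<in>arms I. \<Sum>m\<in>agents I. q k m * \<Delta> k m)"
      by (simp add: sum_distrib_left)
    also have "\<dots> \<le> 4 / 3 * (\<Sum>k\<in>arms I. \<Sum>m\<in>agents I. 2 * r' k m * \<Delta> k m)"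
      using q f by (auto simp: oracle_sol_def is_arg_min_linorder)
    also have "\<dots> \<le> 4 / 3 * (\<Sum>k\<in>arms I. \<Sum>m\<in>agents I. 2 * r' k m * (5 / 4 * true_adj_gap I k m))"
      using \<Delta> r0 by (intro mult_left_mono sum_mono) auto
    also have "\<dots> = 10 / 3 * (\<Sum>k\<in>arms I. \<Sum>m\<in>agents I. r' k m * true_adj_gap I k m)"
      by (simp add: sum_distrib_left)
    also have "\<dots> \<le> 20 * c_star_cost r"
      using r'(2) by simp
    finally show ?thesis
      by simp
  qed
  then have "(\<Sum>k\<in>arms I. \<Sum>m\<in>agents I. q k m * true_adj_gap I k m) / 20 \<le> c_star I"
    by (rule c_star_ge)
  then show ?thesis
    by simp
qed

end


section \<open>Plays and W-CPE-Reg\<close>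

definition valid_plays :: "bandit \<Rightarrow> plays \<Rightarrow> bool" where
  "valid_plays I p \<longleftrightarrow> (\<forall>m\<in>agents I. \<forall>t\<ge>1. p m t \<in> insert None (Some ` arms I))"

definition path_regret :: "bandit \<Rightarrow> plays \<Rightarrow> nat \<Rightarrow> nat \<Rightarrow> real" where
  "path_regret I p s e = (\<Sum>m\<in>agents I. \<Sum>t\<in>{s<..e}.
     case p m t of None \<Rightarrow> 0 | Some k \<Rightarrow> true_gap I k m)"

text \<open>The event of \<open>concentration\<close> at a single time, but for data collected after
  \<open>s\<close>, so that it also applies to a policy that starts with a reset.\<close>

definition confident ::
  "(nat \<Rightarrow> real \<Rightarrow> real) \<Rightarrow> bandit \<Rightarrow> real \<Rightarrow> rewards \<Rightarrow> plays \<Rightarrow> nat \<Rightarrow> nat \<Rightarrow> bool" where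
  "confident g I \<delta> \<omega> p s t \<longleftrightarrow> (\<forall>k\<in>arms I. \<forall>m\<in>agents I.
     ereal \<bar>emp_mixed I \<omega> p s t k m - mixed_mean I k m\<bar> \<le> width g I \<delta> p s t k m)"

lemma num_plays_split:
  assumes "s \<le> u" "u \<le> e"
  shows "num_plays p s e k m = num_plays p s u k m + num_plays p u e k m"
proof -
  have "play_times p s e k m = play_times p s u k m \<union> play_times p u e k m"
    using assms by (auto simp: play_times_def)
  moreover have "play_times p s u k m \<inter> play_times p u e k m = {}"
    by (auto simp: play_times_def)
  ultimately show ?thesis
    unfolding num_plays_def by (simp add: card_Un_disjoint play_times_def)
qed

lemma num_plays_le: "num_plays p s e k m \<le> e - s"
proof -
  have "card (play_times p s e k m) \<le> card {s<..e}"
    by (rule card_mono) (auto simp: play_times_def)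
  then show ?thesis
    by (simp add: num_plays_def)
qed

lemma phase_bounds:
  assumes "phase I p s e c"
  shows "s \<le> e" and "\<And>k m. k \<in> arms I \<Longrightarrow> m \<in> agents I \<Longrightarrow> num_plays p s e k m = c k m"
  using assms by (auto simp: phase_def)

lemma phase_end_le:
  assumes "phase I p s e c" "nagents I \<ge> 1"
    and "\<And>m. m \<in> agents I \<Longrightarrow> (\<Sum>k\<in>arms I. c k m) \<le> L"
  shows "e \<le> s + L"
proof -
  have "Max ((\<lambda>m. \<Sum>k\<in>arms I. c k m) ` agents I) \<le> L"
    using assms(2,3) by (subst Max_le_iff) auto
  then show ?thesis
    using assms(1) by (simp add: phase_def)
qed

text \<open>If every count is at least \<open>b * q n\<close>, then replacing counts by
  \<open>b * q n\<close> cancels the threshold against \<open>b\<close> and leaves the constraint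
  sum of the allocation. The comparison is asked for at nonzero weights, where feasibility
  guarantees \<open>q n > 0\<close>. All three kinds of phases (initial, guided, W-CPE) obtain their
  widths from this.\<close>

lemma width_le_of_allocation:
  assumes ge: "\<And>n. n \<in> agents I \<Longrightarrow> num_plays p s t k n \<ge> 1"
    and nonneg: "\<And>n. n \<in> agents I \<Longrightarrow> q n \<ge> 0"
    and alloc: "\<And>n. n \<in> agents I \<Longrightarrow> weight I n m \<noteq> 0 \<Longrightarrow>
      q n > 0 \<and> b * q n \<le> real (num_plays p s t k n)"
    and b: "0 \<le> beta g I \<delta> (num_plays p s t k)" "beta g I \<delta> (num_plays p s t k) \<le> b" "b > 0"
    and sum: "(\<Sum>n\<in>agents I. (weight I n m)\<^sup>2 / q n) \<le> D\<^sup>2" and D: "D \<ge> 0"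
  shows "width g I \<delta> p s t k m \<le> ereal D"
proof -
  let ?N = "\<lambda>n. real (num_plays p s t k n)"
  have "beta g I \<delta> (num_plays p s t k) * (\<Sum>n\<in>agents I. (weight I n m)\<^sup>2 / ?N n)
      \<le> b * (\<Sum>n\<in>agents I. (weight I n m)\<^sup>2 / ?N n)"
    using b by (intro mult_right_mono sum_nonneg) auto
  also have "\<dots> = (\<Sum>n\<in>agents I. b * ((weight I n m)\<^sup>2 / ?N n))"
    by (rule sum_distrib_left)
  also have "\<dots> \<le> (\<Sum>n\<in>agents I. (weight I n m)\<^sup>2 / q n)"
  proof (rule sum_mono)
    fix n assume n: "n \<in> agents I"
    show "b * ((weight I n m)\<^sup>2 / ?N n) \<le> (weight I n m)\<^sup>2 / q n"
    proof (cases "weight I n m = 0")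
      case False
      have q: "q n > 0" "b * q n \<le> ?N n" and N: "?N n > 0"
        using alloc[OF n False] ge[OF n] by auto
      have "(weight I n m)\<^sup>2 * (b * q n) \<le> (weight I n m)\<^sup>2 * ?N n"
        using q by (intro mult_left_mono) auto
      then show ?thesis
        using q N by (simp add: field_simps)
    qed simp
  qed
  also have "\<dots> \<le> D\<^sup>2"
    by (rule sum)
  finally have "sqrt (beta g I \<delta> (num_plays p s t k) * (\<Sum>n\<in>agents I. (weight I n m)\<^sup>2 / ?N n)) \<le> D"
    using D by (simp add: real_le_lsqrt)
  moreover have "\<not> (\<exists>n\<in>agents I. num_plays p s t k n = 0)"
    using ge by force
  ultimately show ?thesis
    unfolding width_def by simp
qed

lemma beta_mono:
  assumes "\<And>n. n \<in> agents I \<Longrightarrow> N n \<le> N' n"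
  shows "beta g I \<delta> N \<le> beta g I \<delta> N'"
proof -
  have "ln (4 + ln (real (N n))) \<le> ln (4 + ln (real (N' n)))" if n: "n \<in> agents I" for n
  proof -
    \<comment> \<open>The count 0 is covered by the default value of \<open>ln\<close> at 0.\<close>
    have ln0: "ln (real i) \<ge> 0" for i :: nat
      by (cases i) auto
    have "ln (real (N n)) \<le> ln (real (N' n))"
      using assms[OF n] ln0[of "N' n"] by (cases "N n = 0") auto
    then show ?thesis
      using ln0[of "N n"] by simp
  qed
  then show ?thesis
    unfolding beta_def by (intro mult_left_mono add_left_mono sum_mono) auto
qed

text \<open>The iterated logarithms are nonnegative, so positivity of \<open>g\<close> at one
  argument makes \<open>beta\<close> positive for all counts.\<close>

lemma beta_ge: "2 * g (nagents I) (\<delta> / (real (narms I) * real (nagents I))) \<le> beta g I \<delta> N"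
proof -
  have "ln (4 + ln (real i)) \<ge> 0" for i :: nat
  proof -
    have "ln (real i) \<ge> 0"
      by (cases i) auto
    then show ?thesis
      by simp
  qed
  then show ?thesis
    unfolding beta_def by (simp add: sum_nonneg)
qed

context bandit_model
begin

lemma path_cost_nonneg:
  assumes "valid_plays I p" "m \<in> agents I" "t \<ge> 1"
  shows "0 \<le> (case p m t of None \<Rightarrow> 0 | Some k \<Rightarrow> true_gap I k m)"
    and "(case p m t of None \<Rightarrow> 0 | Some k \<Rightarrow> true_gap I k m) \<le> gap_max I"
proof -
  have *: "p m t = None \<or> (\<exists>k\<in>arms I. p m t = Some k)"
    using assms unfolding valid_plays_def by blast
  then show "0 \<le> (case p m t of None \<Rightarrow> 0 | Some k \<Rightarrow> true_gap I k m)"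
    using true_gap_nonneg by (auto simp del: atLeastAtMost_iff)
  from * show "(case p m t of None \<Rightarrow> 0 | Some k \<Rightarrow> true_gap I k m) \<le> gap_max I"
    using true_gap_le_max[OF assms(2)] gap_max_pos by (auto simp del: atLeastAtMost_iff)
qed

lemma path_regret_nonneg: "valid_plays I p \<Longrightarrow> path_regret I p s e \<ge> 0"
  unfolding path_regret_def by (intro sum_nonneg path_cost_nonneg) auto

lemma path_regret_le:
  assumes "valid_plays I p" "real e \<le> real s + L" "L \<ge> 0"
  shows "path_regret I p s e \<le> real M * gap_max I * L"
proof -
  have "path_regret I p s e \<le> (\<Sum>m\<in>agents I. \<Sum>t\<in>{s<..e}. gap_max I)"
    unfolding path_regret_def using path_cost_nonneg(2)[OF assms(1)] by (intro sum_mono) auto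
  also have "\<dots> = real M * gap_max I * real (e - s)"
    by simp
  also have "\<dots> \<le> real M * gap_max I * L"
    using gap_max_pos assms by (intro mult_left_mono) auto
  finally show ?thesis .
qed

lemma path_regret_split:
  assumes "s \<le> u" "u \<le> e"
  shows "path_regret I p s e = path_regret I p s u + path_regret I p u e"
proof -
  have "{s<..e} = {s<..u} \<union> {u<..e}"
    using assms by auto
  then have "(\<Sum>t\<in>{s<..e}. f t) = (\<Sum>t\<in>{s<..u}. f t) + (\<Sum>t\<in>{u<..e}. f t)" for f :: "nat \<Rightarrow> real"
    by (simp add: sum.union_disjoint)
  then show ?thesis
    by (simp add: path_regret_def sum.distrib)
qed

text \<open>A phase may run past the horizon \<open>e\<close>, so \<open>u\<close> can lie beyond
  it; the rounds after \<open>e\<close> then only enlarge the right-hand side.\<close>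

lemma path_regret_split_le:
  assumes "valid_plays I p" "s \<le> u"
  shows "path_regret I p s e \<le> path_regret I p s u + path_regret I p u e"
proof (cases "u \<le> e")
  case False
  have "path_regret I p s e \<le> path_regret I p s u"
    unfolding path_regret_def using path_cost_nonneg(1)[OF assms(1)] False
    by (intro sum_mono sum_mono2) auto
  then show ?thesis
    using path_regret_nonneg[OF assms(1), of u e] by linarith
next
  case True
  show ?thesis
    using path_regret_split[OF assms(2) True, of p] by linarith
qed

text \<open>Passes from time to play counts, the form in which the guided phase and the oracle cost
  are expressed.\<close>

lemma path_regret_counts:
  assumes "valid_plays I p"
  shows "path_regret I p s e = (\<Sum>m\<in>agents I. \<Sum>k\<in>arms I. real (num_plays p s e k m) * true_gap I k m)"
  unfolding path_regret_def
proof (rule sum.cong[OF refl])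
  fix m assume m: "m \<in> agents I"
  have "(case p m t of None \<Rightarrow> 0 | Some k \<Rightarrow> true_gap I k m) =
      (\<Sum>k\<in>arms I. if p m t = Some k then true_gap I k m else 0)" if "t \<in> {s<..e}" for t
  proof -
    have "t \<ge> 1"
      using that by simp
    then have "p m t \<in> insert None (Some ` arms I)"
      using assms m unfolding valid_plays_def by blast
    then consider "p m t = None" | k where "k \<in> arms I" "p m t = Some k"
      by (metis imageE insertE)
    then show ?thesis
      by cases (simp_all add: sum.delta)
  qed
  then have "(\<Sum>t\<in>{s<..e}. case p m t of None \<Rightarrow> 0 | Some k \<Rightarrow> true_gap I k m) =
      (\<Sum>t\<in>{s<..e}. \<Sum>k\<in>arms I. if p m t = Some k then true_gap I k m else 0)"
    by simp
  also have "\<dots> = (\<Sum>k\<in>arms I. \<Sum>t\<in>{s<..e}. if p m t = Some k then true_gap I k m else 0)"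
    by (rule sum.swap)
  also have "\<dots> = (\<Sum>k\<in>arms I. real (num_plays p s e k m) * true_gap I k m)"
    by (rule sum.cong[OF refl]) (simp add: sum.If_cases num_plays_def play_times_def Int_def)
  finally show "(\<Sum>t\<in>{s<..e}. case p m t of None \<Rightarrow> 0 | Some k \<Rightarrow> true_gap I k m) =
      (\<Sum>k\<in>arms I. real (num_plays p s e k m) * true_gap I k m)" .
qed

lemma path_regret_eq_0:
  assumes "\<And>m t. m \<in> agents I \<Longrightarrow> t \<in> {s<..e} \<Longrightarrow> p m t = Some (best_arm I m)"
  shows "path_regret I p s e = 0"
  unfolding path_regret_def using assms by (intro sum.neutral ballI) (auto intro!: sum.neutral)

end

text \<open>After \<open>R\<close> phases the accuracy \<open>(1/2) ^ R\<close> separates the best arms, and \<open>X\<close>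
  additional plays of an arm by each agent suffice in every phase up to then.\<close>

locale wcpe_run = bandit_model +
  fixes g :: "nat \<Rightarrow> real \<Rightarrow> real" and \<delta> :: real and T :: nat and \<omega> :: rewards
    and p :: plays and s R X :: nat
  assumes valid: "valid_plays I p"
    and conf: "\<And>t. confident g I \<delta> \<omega> p s t"
    and g_pos: "g (nagents I) (\<delta> / (real (narms I) * real (nagents I))) > 0"
    and R: "4 * (1 / 2) ^ R < gap_min I"
    and X: "real (narms I) * real (nagents I) ^ 2 * 4 ^ R * beta g I \<delta> (\<lambda>n. 2 * T) \<le> real X"
    and X_le: "X \<le> T"
begin

lemma beta_pos: "beta g I \<delta> N > 0"
  using beta_ge[of g I \<delta> N] g_pos by simp

lemma confident_real:
  assumes "k \<in> arms I" "m \<in> agents I" "width g I \<delta> p s t k m \<le> ereal W"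
  shows "\<bar>emp_mixed I \<omega> p s t k m - mixed_mean I k m\<bar> \<le> W"
proof -
  have "ereal \<bar>emp_mixed I \<omega> p s t k m - mixed_mean I k m\<bar> \<le> ereal W"
    using conf[of t] assms unfolding confident_def by (meson order_trans)
  then show ?thesis
    by simp
qed

text \<open>The minimizer is compared with the constant allocation for accuracy
  \<open>(1 / 2) ^ R\<close>, which is \<open>real M * 4 ^ R\<close> in each of the K M coordinates.
  Entries are nonnegative, so a single one is at most the minimal sum.\<close>

lemma allocation_bound:
  assumes q: "is_arg_min (\<lambda>q. \<Sum>k\<in>arms I. \<Sum>m\<in>agents I. q k m) (feasible I (\<lambda>k m. sqrt 2 * D k m)) q"
    and D: "\<And>k m. k \<in> arms I \<Longrightarrow> m \<in> agents I \<Longrightarrow> D k m \<ge> (1 / 2) ^ R"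
    and km: "k \<in> arms I" "m \<in> agents I"
  shows "q k m \<le> real K * real M ^ 2 * 4 ^ R"
proof -
  let ?x = "2 * real M / (sqrt 2 * (1 / 2) ^ R)\<^sup>2"
  have x: "?x = real M * 4 ^ R"
    by (simp add: power_mult_distrib power_one_over power2_eq_square flip: power_mult_distrib)
  have "feasible I (\<lambda>k m. sqrt 2 * D k m) (\<lambda>k m. ?x)"
    by (rule feasible_const[OF _ _ refl]) (use D in auto)
  then have le: "(\<Sum>k\<in>arms I. \<Sum>m\<in>agents I. q k m) \<le> (\<Sum>k\<in>arms I. \<Sum>m\<in>agents I. ?x)"
    using q by (auto simp: is_arg_min_linorder)
  have q0: "q k m \<ge> 0" if "k \<in> arms I" "m \<in> agents I" for k m
    using q that by (auto simp: is_arg_min_linorder intro: feasible_nonneg)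
  have "q k m \<le> (\<Sum>m\<in>agents I. q k m)"
    using km q0 by (intro member_le_sum) auto
  also have "\<dots> \<le> (\<Sum>k\<in>arms I. \<Sum>m\<in>agents I. q k m)"
    using km q0 by (intro member_le_sum[where f = "\<lambda>k. \<Sum>m\<in>agents I. q k m"] sum_nonneg) auto
  also note le
  also have "(\<Sum>k\<in>arms I. \<Sum>m\<in>agents I. ?x) = real K * real M ^ 2 * 4 ^ R"
    unfolding x by (simp add: power2_eq_square)
  finally show ?thesis .
qed

text \<open>Giving \<open>X\<close> more plays to every agent satisfies the constraint, hence the
  minimal total is at most \<open>M * X\<close>. The threshold itself grows with the counts, which
  is why it is first replaced by its value at a uniform bound for them.\<close>

lemma extra_plays_bound:
  assumes q: "is_arg_min (\<lambda>q. \<Sum>k\<in>arms I. \<Sum>m\<in>agents I. q k m) (feasible I (\<lambda>k m. sqrt 2 * D k m)) q"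
    and D: "\<And>k m. k \<in> arms I \<Longrightarrow> m \<in> agents I \<Longrightarrow> D k m \<ge> (1 / 2) ^ R"
    and d: "is_arg_min (\<lambda>x. \<Sum>m\<in>agents I. x m)
        (\<lambda>x. \<forall>m\<in>agents I.
           real (num_plays p s e k m + x m) / beta g I \<delta> (\<lambda>n. num_plays p s e k n + x n) \<ge> q k m) d"
    and k: "k \<in> arms I" and e: "e \<le> T" and m: "m \<in> agents I"
  shows "d m \<le> M * X"
proof -
  have "q k m \<le> real (num_plays p s e k m + X) / beta g I \<delta> (\<lambda>n. num_plays p s e k n + X)"
    if m: "m \<in> agents I" for m
  proof -
    let ?b = "beta g I \<delta> (\<lambda>n. num_plays p s e k n + X)"
    let ?Q = "real K * real M ^ 2 * 4 ^ R"
    \<comment> \<open>At most \<open>T\<close> plays so far and at most \<open>T\<close> extra ones: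
      this is the origin of the argument \<open>2 * T\<close> of \<open>beta\<close>.\<close>
    have "num_plays p s e k n + X \<le> 2 * T" for n
      using num_plays_le[of p s e k n] e X_le by simp
    then have b: "?b \<le> beta g I \<delta> (\<lambda>n. 2 * T)"
      by (intro beta_mono)
    have "q k m * ?b \<le> ?Q * ?b"
      using allocation_bound[OF q D k m] beta_pos by (intro mult_right_mono) (auto intro: less_imp_le)
    also have "\<dots> \<le> ?Q * beta g I \<delta> (\<lambda>n. 2 * T)"
      using b by (intro mult_left_mono) auto
    also have "\<dots> \<le> real X"
      by (rule X)
    finally have "q k m * ?b \<le> real (num_plays p s e k m + X)"
      by simp
    then show ?thesis
      using beta_pos by (simp add: pos_le_divide_eq)
  qed
  then have "(\<Sum>m\<in>agents I. d m) \<le> (\<Sum>m\<in>agents I. X)"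
    using d[unfolded is_arg_min_linorder, THEN conjunct2, rule_format, of "\<lambda>_. X"] by blast
  moreover have "d m \<le> (\<Sum>m\<in>agents I. d m)"
    using m by (intro member_le_sum) auto
  ultimately show ?thesis
    by simp
qed

definition "phase_len = K * (M * X)"

text \<open>\<open>r\<close> counts completed phases. Settled agents and eliminated arms keep an
  older value of \<open>D\<close>, so in general only a lower bound holds; the candidates of an
  undecided agent have been halved in every phase, hence the equality. The value
  \<open>R + 1\<close> is possible only when all agents are settled.\<close>

definition loop_invariant :: "nat \<Rightarrow> nat \<Rightarrow> (nat \<Rightarrow> nat set) \<Rightarrow> (nat \<Rightarrow> nat \<Rightarrow> real) \<Rightarrow> bool" where
  "loop_invariant r e B D \<longleftrightarrow> s \<le> e \<and> r \<le> R + 1 \<and>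
     (\<forall>k\<in>arms I. \<forall>m\<in>agents I. num_plays p s e k m \<ge> 1 \<and> D k m \<ge> (1 / 2) ^ r) \<and>
     (\<forall>m\<in>agents I. B m \<subseteq> arms I \<and> best_arm I m \<in> B m \<and>
        (card (B m) \<noteq> 1 \<longrightarrow> r \<le> R \<and> (\<forall>k\<in>B m. D k m = (1 / 2) ^ r)))"

text \<open>The upper end of the interval of the best arm exceeds its true mean, hence the lower end
  of every other interval. If another arm survives, the two intervals overlap, and the true means
  differ by at most two half-widths for each arm, that is \<open>4 * W\<close>.\<close>

lemma elimination:
  assumes m: "m \<in> agents I" and B: "B \<subseteq> arms I" "best_arm I m \<in> B"
    and W: "\<And>k. k \<in> B \<Longrightarrow> width g I \<delta> p s e k m \<le> ereal W"
    and B': "B' = {k \<in> B. ereal (emp_mixed I \<omega> p s e k m) + width g I \<delta> p s e k m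
      \<ge> Max ((\<lambda>j. ereal (emp_mixed I \<omega> p s e j m) - width g I \<delta> p s e j m) ` B)}"
  shows "best_arm I m \<in> B'" and "4 * W < gap_min I \<Longrightarrow> B' = {best_arm I m}"
proof -
  let ?b = "best_arm I m" and ?\<mu> = "\<lambda>k. mixed_mean I k m" and ?\<nu> = "\<lambda>k. emp_mixed I \<omega> p s e k m"
  have "finite B"
    using B(1) finite_subset by blast
  have "\<exists>x. width g I \<delta> p s e k m = ereal x \<and> x \<le> W \<and> \<bar>?\<nu> k - ?\<mu> k\<bar> \<le> x" if k: "k \<in> B" for k
  proof -
    have "width g I \<delta> p s e k m \<noteq> \<infinity>" "width g I \<delta> p s e k m \<noteq> - \<infinity>"
      using W[OF k] by (auto, simp add: width_def split: if_splits)
    then obtain x where x: "width g I \<delta> p s e k m = ereal x"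
      by (cases "width g I \<delta> p s e k m") auto
    moreover have "\<bar>?\<nu> k - ?\<mu> k\<bar> \<le> x"
      using confident_real[of k m e x] x k B m by auto
    ultimately show ?thesis
      using W[OF k] by simp
  qed
  then obtain x where x: "\<And>k. k \<in> B \<Longrightarrow> width g I \<delta> p s e k m = ereal (x k) \<and> x k \<le> W \<and> \<bar>?\<nu> k - ?\<mu> k\<bar> \<le> x k"
    by metis
  have B'_iff: "k \<in> B' \<longleftrightarrow> (\<forall>j\<in>B. ?\<nu> j - x j \<le> ?\<nu> k + x k)" if k: "k \<in> B" for k
  proof -
    have "k \<in> B' \<longleftrightarrow> (\<forall>j\<in>B. ereal (?\<nu> j) - width g I \<delta> p s e j m \<le> ereal (?\<nu> k) + width g I \<delta> p s e k m)"
      using k \<open>finite B\<close> unfolding B' by (subst mem_Collect_eq, subst Max_le_iff) auto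
    then show ?thesis
      using x k by simp
  qed
  have gap: "?\<mu> j \<le> ?\<mu> ?b" if "j \<in> B" for j
    using best_ge[OF K_ge, of j ?\<mu>] that B by (auto simp: best_arm_def)
  show best: "?b \<in> B'"
    unfolding B'_iff[OF B(2)] using x[OF B(2)] x gap by force
  assume W4: "4 * W < gap_min I"
  have "k = ?b" if k: "k \<in> B'" for k
  proof (rule ccontr)
    assume ne: "k \<noteq> ?b"
    have kB: "k \<in> B"
      using k B' by blast
    then have "gap_min I \<le> true_gap I k m"
      using B m ne gap_min_le_true_gap by blast
    then have "gap_min I \<le> ?\<mu> ?b - ?\<mu> k"
      by (simp add: true_gap_def gap_def best_arm_def)
    moreover have "?\<nu> ?b - x ?b \<le> ?\<nu> k + x k"
      using B'_iff[OF kB] k B(2) by blast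
    ultimately show False
      using x[OF kB] x[OF B(2)] W4 by linarith
  qed
  with best show "B' = {?b}"
    by blast
qed

text \<open>The factor \<open>sqrt 2\<close> in the constraint cancels the division by 2, so one
  phase shrinks the width of each candidate to its \<open>D\<close>. Candidates of undecided agents
  then have width at most \<open>(1 / 2) ^ r\<close>, and elimination applies with this
  accuracy.\<close>

lemma loop_step:
  assumes inv: "loop_invariant r e B D" and e: "e \<le> T"
    and step: "\<not> (\<forall>m\<in>agents I. card (B m) = 1)"
      "is_arg_min (\<lambda>q. \<Sum>k\<in>arms I. \<Sum>m\<in>agents I. q k m) (feasible I (\<lambda>k m. sqrt 2 * D k m)) q"
      "\<forall>k\<in>arms I. is_arg_min (\<lambda>x. \<Sum>m\<in>agents I. x m)
        (\<lambda>x. \<forall>m\<in>agents I.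
           real (num_plays p s e k m + x m) / beta g I \<delta> (\<lambda>n. num_plays p s e k n + x n) \<ge> q k m)
        (d k)"
      "phase I p e e' (\<lambda>k m. if k \<in> (\<Union>n\<in>agents I. B n) then d k m else 0)"
      "\<forall>m\<in>agents I. B' m = {k \<in> B m.
        ereal (emp_mixed I \<omega> p s e' k m) + width g I \<delta> p s e' k m
          \<ge> Max ((\<lambda>j. ereal (emp_mixed I \<omega> p s e' j m) - width g I \<delta> p s e' j m) ` B m)}"
      "\<forall>k\<in>arms I. \<forall>m\<in>agents I.
        D' k m = (if k \<in> B' m \<and> card (B' m) > 1 then D k m / 2 else D k m)"
  shows "r \<le> R" "loop_invariant (Suc r) e' B' D'" "e' \<le> e + phase_len"
proof -
  have se: "s \<le> e" and N1: "\<And>k m. k \<in> arms I \<Longrightarrow> m \<in> agents I \<Longrightarrow> num_plays p s e k m \<ge> 1"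
    and Dr: "\<And>k m. k \<in> arms I \<Longrightarrow> m \<in> agents I \<Longrightarrow> D k m \<ge> (1 / 2) ^ r"
    and B: "\<And>m. m \<in> agents I \<Longrightarrow> B m \<subseteq> arms I \<and> best_arm I m \<in> B m"
    and BD: "\<And>m. m \<in> agents I \<Longrightarrow> card (B m) \<noteq> 1 \<Longrightarrow> r \<le> R \<and> (\<forall>k\<in>B m. D k m = (1 / 2) ^ r)"
    using inv unfolding loop_invariant_def by auto
  show rR: "r \<le> R"
    using step(1) BD by blast
  have half: "(1 / 2 :: real) ^ R \<le> (1 / 2) ^ r"
    using rR by (intro power_decreasing) auto
  have DR: "D k m \<ge> (1 / 2) ^ R" if "k \<in> arms I" "m \<in> agents I" for k m
    using Dr[OF that] half by linarith
  have d_le: "d k m \<le> M * X" if "k \<in> arms I" "m \<in> agents I" for k m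
    by (rule extra_plays_bound[OF step(2)]) (use DR step(3) that e in blast)+
  show "e' \<le> e + phase_len"
  proof (rule phase_end_le[OF step(4) M_ge])
    fix m assume m: "m \<in> agents I"
    have "(\<Sum>k\<in>arms I. if k \<in> (\<Union>n\<in>agents I. B n) then d k m else 0) \<le> (\<Sum>k\<in>arms I. M * X)"
      using d_le m by (intro sum_mono) auto
    then show "(\<Sum>k\<in>arms I. if k \<in> (\<Union>n\<in>agents I. B n) then d k m else 0) \<le> phase_len"
      by (simp add: phase_len_def)
  qed
  have ee': "e \<le> e'"
    using phase_bounds(1)[OF step(4)] .
  have N': "num_plays p s e' k m = num_plays p s e k m + (if k \<in> (\<Union>n\<in>agents I. B n) then d k m else 0)"
    if "k \<in> arms I" "m \<in> agents I" for k m
    using phase_bounds(2)[OF step(4) that] num_plays_split[OF se ee', of p k m] by simp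
  \<comment> \<open>A candidate of one agent is played by all agents, since phases run over the
    union of the candidate sets. The requirement on \<open>d\<close> uses \<open>beta\<close> at the
    final counts, so \<open>b\<close> can be that very value.\<close>
  have width: "width g I \<delta> p s e' k m \<le> ereal (D k m)" if m: "m \<in> agents I" and k: "k \<in> B m" for k m
  proof (rule width_le_of_allocation[where q = "q k" and b = "beta g I \<delta> (num_plays p s e' k)"])
    have ka: "k \<in> arms I"
      using B m k by blast
    have f: "feasible I (\<lambda>k m. sqrt 2 * D k m) q"
      using step(2) by (simp add: is_arg_min_def)
    have eq: "num_plays p s e' k n = num_plays p s e k n + d k n" if "n \<in> agents I" for n
      using N'[OF ka that] k m by auto
    then have beq: "beta g I \<delta> (num_plays p s e' k) = beta g I \<delta> (\<lambda>n. num_plays p s e k n + d k n)"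
      unfolding beta_def by simp
    show "num_plays p s e' k n \<ge> 1" if "n \<in> agents I" for n
      using N1[OF ka that] eq[OF that] by simp
    show "q k n \<ge> 0" if "n \<in> agents I" for n
      using feasible_nonneg[OF f ka that] .
    show "0 < q k n \<and> beta g I \<delta> (num_plays p s e' k) * q k n \<le> real (num_plays p s e' k n)"
      if n: "n \<in> agents I" "w n m \<noteq> 0" for n
    proof
      show "0 < q k n"
        using feasible_pos[OF f ka m n] .
      have "q k n \<le> real (num_plays p s e k n + d k n) / beta g I \<delta> (\<lambda>n. num_plays p s e k n + d k n)"
        using step(3) ka n(1) by (auto simp: is_arg_min_def)
      then show "beta g I \<delta> (num_plays p s e' k) * q k n \<le> real (num_plays p s e' k n)"
        unfolding beq eq[OF n(1)] using beta_pos by (simp add: pos_le_divide_eq mult.commute)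
    qed
    show "(\<Sum>n\<in>agents I. (w n m)\<^sup>2 / q k n) \<le> (D k m)\<^sup>2"
      using feasible_sum[OF f ka m] by (simp add: power_mult_distrib)
    show "D k m \<ge> 0"
      using Dr[OF ka m] by (meson order_trans zero_le_power zero_le_divide_1_iff zero_le_numeral)
  qed (use beta_pos in \<open>auto intro: less_imp_le\<close>)
  have B'_sub: "B' m \<subseteq> B m" if "m \<in> agents I" for m
    using step(5) that by blast
  have finB: "finite (B m)" if "m \<in> agents I" for m
    using B[OF that] finite_subset by blast
  have best: "best_arm I m \<in> B' m \<and> (card (B' m) \<noteq> 1 \<longrightarrow> Suc r \<le> R \<and> (\<forall>k\<in>B' m. D' k m = (1 / 2) ^ Suc r))"
    if m: "m \<in> agents I" for m
  proof (cases "card (B m) = 1")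
    case True
    then have Bm: "B m = {best_arm I m}"
      using B[OF m] by (metis card_1_singletonE singletonD)
    \<comment> \<open>Settled agents also update their sets in later phases; survival of the best
      arm keeps such a set from becoming empty.\<close>
    have "best_arm I m \<in> B' m"
      by (rule elimination(1)[OF m _ _ _ step(5)[rule_format, OF m], of "D (best_arm I m) m"])
         (use Bm B[OF m] width[OF m] in auto)
    then have "B' m = {best_arm I m}"
      using B'_sub[OF m] Bm by blast
    then show ?thesis
      by simp
  next
    case False
    have Dm: "D k m = (1 / 2) ^ r" if "k \<in> B m" for k
      using BD[OF m False] that by blast
    have el: "width g I \<delta> p s e' k m \<le> ereal ((1 / 2) ^ r)" if "k \<in> B m" for k
      using width[OF m that] Dm[OF that] by simp
    have best: "best_arm I m \<in> B' m"
      by (rule elimination(1)[OF m _ _ el step(5)[rule_format, OF m]]) (use B[OF m] in auto)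
    moreover have "Suc r \<le> R \<and> (\<forall>k\<in>B' m. D' k m = (1 / 2) ^ Suc r)" if c: "card (B' m) \<noteq> 1"
    proof
      have "card (B' m) \<noteq> 0"
        using best B'_sub[OF m] finB[OF m] by (metis card_0_eq empty_iff finite_subset)
      then have c1: "card (B' m) > 1"
        using c by simp
      show "\<forall>k\<in>B' m. D' k m = (1 / 2) ^ Suc r"
      proof
        fix k assume k: "k \<in> B' m"
        then have "k \<in> B m" "k \<in> arms I"
          using B'_sub[OF m] B[OF m] by auto
        then show "D' k m = (1 / 2) ^ Suc r"
          using step(6) k c1 m Dm[of k] by auto
      qed
      \<comment> \<open>In phase \<open>R\<close> the widths are at most \<open>(1 / 2) ^ R\<close>,
        less than a quarter of the smallest gap, so an agent still undecided is settled by that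
        phase.\<close>
      show "Suc r \<le> R"
      proof (rule ccontr)
        assume "\<not> Suc r \<le> R"
        then have "r = R"
          using rR by simp
        then have "B' m = {best_arm I m}"
          by (intro elimination(2)[OF m _ _ el step(5)[rule_format, OF m]]) (use B[OF m] R in auto)
        with c show False
          by simp
      qed
    qed
    ultimately show ?thesis
      by blast
  qed
  show "loop_invariant (Suc r) e' B' D'"
    unfolding loop_invariant_def
  proof (intro conjI ballI)
    show "s \<le> e'" "Suc r \<le> R + 1"
      using se ee' rR by auto
    show "1 \<le> num_plays p s e' k m" if "k \<in> arms I" "m \<in> agents I" for k m
      using N'[OF that] N1[OF that] by simp
    show "(1 / 2) ^ Suc r \<le> D' k m" if "k \<in> arms I" "m \<in> agents I" for k m
    proof -
      have "0 < (1 / 2 :: real) ^ r"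
        by simp
      moreover have "D' k m = D k m / 2 \<or> D' k m = D k m"
        using step(6) that by presburger
      moreover have "(1 / 2 :: real) ^ Suc r = (1 / 2) ^ r / 2"
        by simp
      ultimately show ?thesis
        using Dr[OF that] by linarith
    qed
    show "B' m \<subseteq> arms I" if "m \<in> agents I" for m
      using B'_sub[OF that] B[OF that] by blast
  qed (use best in blast)+
qed

text \<open>By the invariant at most \<open>R + 1 - r\<close> phases remain, each of at most
  \<open>phase_len\<close> rounds. Once the loop stops, the single candidates are the best arms and
  no further regret arises.\<close>

lemma loop_regret:
  assumes "wcpe_loop g I \<delta> T \<omega> p s e B D" "loop_invariant r e B D"
  shows "path_regret I p e T \<le> real (R + 1 - r) * (real M * gap_max I * real phase_len)"
  using assms
proof (induction arbitrary: r rule: wcpe_loop.induct)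
  case (stop B e D)
  have "the_elem (B m) = best_arm I m" if m: "m \<in> agents I" for m
  proof -
    have "best_arm I m \<in> B m"
      using stop.prems m unfolding loop_invariant_def by blast
    then have "B m = {best_arm I m}"
      using stop.hyps(1) m by (metis card_1_singletonE singletonD)
    then show ?thesis
      by simp
  qed
  then have "path_regret I p e T = 0"
    using stop.hyps(2) by (intro path_regret_eq_0) auto
  then show ?case
    using gap_max_pos by simp
next
  case (horizon e B D)
  then have "path_regret I p e T = 0"
    by (simp add: path_regret_def)
  then show ?case
    using gap_max_pos by simp
next
  case (step B D q e d e' B' D')
  show ?case
  proof (cases "e \<le> T")
    \<comment> \<open>The rules \<open>horizon\<close> and \<open>step\<close> overlap, so a
      derivation may continue with phases that start after \<open>T\<close>; they do not
      contribute.\<close>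
    case False
    then have "path_regret I p e T = 0"
      by (simp add: path_regret_def)
    then show ?thesis
      using gap_max_pos by simp
  next
    case True
    note st = loop_step[OF step.prems True step.hyps(1-6)]
    have ee': "e \<le> e'"
      using phase_bounds(1)[OF step.hyps(4)] .
    have "path_regret I p e T \<le> path_regret I p e e' + path_regret I p e' T"
      by (rule path_regret_split_le[OF valid ee'])
    also have "path_regret I p e e' \<le> real M * gap_max I * real phase_len"
      by (rule path_regret_le[OF valid]) (use st(3) in auto)
    also have "path_regret I p e' T \<le> real (R + 1 - Suc r) * (real M * gap_max I * real phase_len)"
      by (rule step.IH[OF st(2)])
    also have "real M * gap_max I * real phase_len + real (R + 1 - Suc r) * (real M * gap_max I * real phase_len)
        = real (R + 1 - r) * (real M * gap_max I * real phase_len)"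
      using st(1) by (simp add: of_nat_diff algebra_simps)
    finally show ?thesis
      by simp
  qed
qed

lemma wcpe_regret:
  assumes "wcpe_reg g I T \<omega> p s" "\<delta> = 1 / real T"
  shows "path_regret I p s T \<le> real M * gap_max I * (real K + real (R + 1) * (real K * real M * real X))"
proof -
  obtain e where e: "phase I p s e (\<lambda>k m. 1)"
    "wcpe_loop g I \<delta> T \<omega> p s e (\<lambda>m. arms I) (\<lambda>k m. 1)"
    using assms unfolding wcpe_reg_def by blast
  have "loop_invariant 0 e (\<lambda>m. arms I) (\<lambda>k m. 1)"
    unfolding loop_invariant_def using phase_bounds[OF e(1)] best_arm_in_arms
    by (auto simp del: atLeastAtMost_iff)
  from loop_regret[OF e(2) this]
  have "path_regret I p e T \<le> real (R + 1) * (real M * gap_max I * real phase_len)"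
    by simp
  moreover have "path_regret I p s e \<le> real M * gap_max I * real K"
  proof (rule path_regret_le[OF valid])
    have "e \<le> s + K"
      by (rule phase_end_le[OF e(1) M_ge]) simp
    then show "real e \<le> real s + real K"
      by simp
  qed simp
  moreover have "path_regret I p s T \<le> path_regret I p s e + path_regret I p e T"
    by (rule path_regret_split_le[OF valid phase_bounds(1)[OF e(1)]])
  ultimately show ?thesis
    by (simp add: phase_len_def algebra_simps)
qed

end


section \<open>CExp2 on a fixed reward table\<close>

context bandit_model
begin

text \<open>The gap to the best arm is a difference of two means, so its error is at most the sum of
  the two deviations, here a fraction \<open>a\<close> of the gap itself. With \<open>a < 1\<close>
  the order relative to the best arm survives, and the two-sided bound passes to the adjusted
  gaps.\<close>

lemma perturbed_gaps:
  assumes m: "m \<in> agents I" and a: "0 < a" "a < 1"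
    and dev: "\<And>j. j \<in> arms I \<Longrightarrow> \<bar>v j - mixed_mean I j m\<bar> \<le> e j"
    and e: "\<And>j. j \<in> arms I - {best_arm I m} \<Longrightarrow> e j + e (best_arm I m) \<le> a * true_gap I j m"
  shows "best I v = best_arm I m"
    and "k \<in> arms I \<Longrightarrow> (1 - a) * true_adj_gap I k m \<le> adj_gap I v k"
    and "k \<in> arms I \<Longrightarrow> adj_gap I v k \<le> (1 + a) * true_adj_gap I k m"
proof -
  let ?b = "best_arm I m"
  have diff: "(1 - a) * true_gap I j m \<le> v ?b - v j" "v ?b - v j \<le> (1 + a) * true_gap I j m"
    if j: "j \<in> arms I - {?b}" for j
  proof -
    have "j \<in> arms I"
      using j by blast
    then have "\<bar>v j - mixed_mean I j m\<bar> \<le> e j" "\<bar>v ?b - mixed_mean I ?b m\<bar> \<le> e ?b"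
      using dev best_arm_in_arms by blast+
    moreover have "true_gap I j m = mixed_mean I ?b m - mixed_mean I j m"
      by (simp add: true_gap_def gap_def best_arm_def)
    ultimately show "(1 - a) * true_gap I j m \<le> v ?b - v j" "v ?b - v j \<le> (1 + a) * true_gap I j m"
      using e[OF j] by (simp_all add: algebra_simps)
  qed
  show best: "best I v = ?b"
  proof (rule best_eqI[OF K_ge best_arm_in_arms])
    fix j assume j: "j \<in> arms I - {?b}"
    then have "true_gap I j m > 0"
      using true_gap_pos[OF m, of j] by blast
    then have "(1 - a) * true_gap I j m > 0"
      using a by simp
    then show "v j < v ?b"
      using diff(1)[OF j] by linarith
  qed
  have gap_v: "gap I v j = v ?b - v j" for j
    by (simp add: gap_def best)
  have bu: "best I (\<lambda>j. mixed_mean I j m) = ?b"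
    by (simp add: best_arm_def)
  show "(1 - a) * true_adj_gap I k m \<le> adj_gap I v k" if "k \<in> arms I"
    unfolding true_adj_gap_def
    by (rule adj_gap_ge_scaled[OF K_ge]) (use that best bu diff gap_v in \<open>auto simp: true_gap_def\<close>)
  show "adj_gap I v k \<le> (1 + a) * true_adj_gap I k m" if "k \<in> arms I"
    unfolding true_adj_gap_def
    by (rule adj_gap_le_scaled[OF K_ge]) (use that best bu diff gap_v a in \<open>auto simp: true_gap_def\<close>)
qed

text \<open>The hypothesis is the switching condition of CExp2 with the confidence widths \<open>e\<close>.\<close>

lemma narrow_widths_identify_best:
  assumes m: "m \<in> agents I"
    and dev: "\<And>j. j \<in> arms I \<Longrightarrow> \<bar>v j - mixed_mean I j m\<bar> \<le> e j"
    and e: "\<And>j. j \<in> arms I \<Longrightarrow> e j < adj_gap I v j / 2"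
    and k: "is_arg_max v (\<lambda>j. j \<in> arms I) k"
  shows "k = best_arm I m"
proof (rule ccontr)
  let ?b = "best_arm I m"
  assume ne: "k \<noteq> ?b"
  have ka: "k \<in> arms I" and kmax: "\<And>j. j \<in> arms I \<Longrightarrow> v j \<le> v k"
    using k by (auto simp: is_arg_max_linorder)
  have best: "best I v \<in> arms I" "v (best I v) = v k"
    using best_in_arms[OF K_ge, of v] best_ge[OF K_ge ka, of v] kmax[of "best I v"] by auto
  have pos: "adj_gap I v j > 0" if "j \<in> arms I" for j
    using dev[OF that] e[OF that] by linarith
  \<comment> \<open>A tie would make the adjusted gap at \<open>k\<close> zero, contradicting
    positivity.\<close>
  have "k = best I v"
  proof (rule ccontr)
    assume "k \<noteq> best I v"
    then have "adj_gap I v k = 0"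
      using best(2) by (simp add: adj_gap_def gap_def)
    with pos[OF ka] show False
      by simp
  qed
  then have "adj_gap I v ?b = v k - v ?b"
    using ne by (simp add: adj_gap_def gap_def)
  moreover have "adj_gap I v k \<le> adj_gap I v ?b"
    using adj_gap_best_le[OF K_ge best_arm_in_arms, of v m] \<open>k = best I v\<close> by simp
  \<comment> \<open>Both deviations are below half of the adjusted gaps at \<open>k\<close> and
    \<open>?b\<close>, and each of these is at most \<open>v k - v ?b\<close>. So the empirical
    order of the two arms is also the true one.\<close>
  ultimately have "mixed_mean I k m > mixed_mean I ?b m"
    using dev[OF ka] dev[OF best_arm_in_arms, of m] e[OF ka] e[OF best_arm_in_arms, of m] by linarith
  moreover have "mixed_mean I k m \<le> mixed_mean I ?b m"
    unfolding best_arm_def using best_ge[OF K_ge ka, of "\<lambda>j. mixed_mean I j m"] .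
  ultimately show False
    by simp
qed

end

text \<open>A path on which the level 1/T bounds hold for the data since time 0. \<open>Y\<close>
  bounds the guided plays of one arm by one agent, and \<open>horizon\<close> lets both exploration
  phases end by \<open>T\<close>, so that \<open>beta\<close> at the actual counts is at most its
  value at \<open>T\<close>.\<close>

locale cexp2_path = bandit_model +
  fixes g :: "nat \<Rightarrow> real \<Rightarrow> real" and T :: nat and \<omega> :: rewards and p :: plays and Y :: nat
  assumes valid: "valid_plays I p"
    and run: "cexp2 g I T (wcpe_reg g I T) \<omega> p"
    and conf: "\<And>t. confident g I (1 / real T) \<omega> p 0 t"
    and g_pos: "g (nagents I) (1 / real T / (real (narms I) * real (nagents I))) > 0"
    and lnln: "ln (ln (real T)) \<ge> 1"
    and init: "init_plays T \<ge> 1"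
    and Y: "36 * real (narms I) * real (nagents I) ^ 2 * ln (ln (real T)) ^ 4
      * beta g I (1 / real T) (\<lambda>n. T) + 1 \<le> real Y"
    and horizon: "narms I * (init_plays T + Y) \<le> T"
begin

abbreviation "LL \<equiv> ln (ln (real T))"
abbreviation "B \<equiv> beta g I (1 / real T) (\<lambda>n. T)"
abbreviation "Tie \<equiv> K * init_plays T"

definition "clipped_gap k m = min (max (emp_gap I \<omega> p 0 Tie k m) (1 / LL)) LL"

definition "narrow t \<longleftrightarrow> (\<forall>k\<in>arms I. \<forall>m\<in>agents I.
  width g I (1 / real T) p 0 t k m < ereal (emp_gap I \<omega> p 0 t k m / 2))"

definition "committed t \<longleftrightarrow> (\<forall>m\<in>agents I. \<exists>k.
  is_arg_max (\<lambda>j. emp_mixed I \<omega> p 0 t j m) (\<lambda>j. j \<in> arms I) k \<and> (\<forall>u\<in>{t<..T}. p m u = Some k))"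

lemma beta_pos: "beta g I (1 / real T) N > 0"
  using beta_ge[of g I "1 / real T" N] g_pos by simp

lemma clipped_gap_ge: "clipped_gap k m \<ge> 1 / LL"
proof -
  have "1 / LL \<le> 1"
    using lnln by simp
  then have "1 / LL \<le> LL"
    using lnln by linarith
  then show ?thesis
    by (simp add: clipped_gap_def)
qed

text \<open>The fourth power arises as follows: the constant allocation for the smallest clipped gap
  \<open>1 / LL\<close> is of order \<open>LL ^ 2\<close>, its cost gains a factor \<open>LL\<close>
  from the upper clip, and dividing by the smallest price \<open>1 / LL\<close> gives
  another.\<close>

lemma oracle_bound:
  assumes q: "oracle_sol I clipped_gap q" and km: "k \<in> arms I" "m \<in> agents I"
  shows "q k m \<le> 2 * real K * real M ^ 2 * LL ^ 4"
proof -
  let ?x = "2 * real M / (1 / LL)\<^sup>2"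
  have LL: "LL > 0"
    using lnln by simp
  have x: "?x = 2 * real M * LL ^ 2"
    by (simp add: power_one_over field_simps)
  have "feasible I clipped_gap (\<lambda>k m. ?x)"
    by (rule feasible_const[OF _ _ refl]) (use clipped_gap_ge LL in auto)
  then have le: "(\<Sum>k\<in>arms I. \<Sum>m\<in>agents I. q k m * clipped_gap k m)
      \<le> (\<Sum>k\<in>arms I. \<Sum>m\<in>agents I. ?x * clipped_gap k m)"
    using q unfolding oracle_sol_def is_arg_min_linorder by blast
  have clip_pos: "clipped_gap k m \<ge> 0" for k m
    using clipped_gap_ge[of k m] LL by (meson divide_nonneg_nonneg less_imp_le order_trans zero_le_one)
  have q0: "q k m \<ge> 0" if "k \<in> arms I" "m \<in> agents I" for k m
    using q that feasible_nonneg[of clipped_gap q k m] by (simp add: oracle_sol_def is_arg_min_linorder)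
  have q0': "q k m * clipped_gap k m \<ge> 0" if "k \<in> arms I" "m \<in> agents I" for k m
    using q0[OF that] clip_pos by simp
  have "q k m * (1 / LL) \<le> q k m * clipped_gap k m"
    using q0[OF km] clipped_gap_ge by (rule mult_left_mono[rotated])
  also have "\<dots> \<le> (\<Sum>m\<in>agents I. q k m * clipped_gap k m)"
    by (rule member_le_sum[OF km(2)]) (use q0' km in auto)
  also have "\<dots> \<le> (\<Sum>k\<in>arms I. \<Sum>m\<in>agents I. q k m * clipped_gap k m)"
    by (rule member_le_sum[OF km(1)]) (use q0' in \<open>auto intro!: sum_nonneg\<close>)
  also note le
  also have "(\<Sum>k\<in>arms I. \<Sum>m\<in>agents I. ?x * clipped_gap k m) \<le> (\<Sum>k\<in>arms I. \<Sum>m\<in>agents I. ?x * LL)"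
    unfolding x by (intro sum_mono mult_left_mono) (auto simp: clipped_gap_def)
  also have "\<dots> = 2 * real K * real M ^ 2 * LL ^ 3"
    unfolding x by (simp add: power2_eq_square power3_eq_cube)
  finally have "q k m \<le> 2 * real K * real M ^ 2 * LL ^ 3 * LL"
    using LL by (simp add: pos_divide_le_eq)
  also have "\<dots> = 2 * real K * real M ^ 2 * LL ^ 4"
    by (simp add: eval_nat_numeral)
  finally show ?thesis .
qed

text \<open>All agents are given the same work in the initial phase, so its end \<open>Tie\<close>
  is the same on every path. The end \<open>Tge\<close> of the guided phase varies with the rewards
  but stays in a fixed window, which makes a union bound over reset times possible.\<close>

lemma run_cases:
  obtains Tge q where "oracle_sol I clipped_gap q"
    and "Tie \<le> Tge" "Tge \<le> K * (init_plays T + Y)"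
    and "\<And>k m. k \<in> arms I \<Longrightarrow> m \<in> agents I \<Longrightarrow> real (num_plays p 0 Tge k m) \<ge> 18 * q k m * B"
    and "\<And>k m. k \<in> arms I \<Longrightarrow> m \<in> agents I \<Longrightarrow> num_plays p 0 Tge k m \<ge> 1"
    and "\<And>k m. k \<in> arms I \<Longrightarrow> m \<in> agents I \<Longrightarrow>
      real (num_plays p 0 Tge k m) \<le> real (init_plays T) + 1 + 18 * q k m * B"
    and "if narrow Tge then committed Tge else wcpe_reg g I T \<omega> p Tge"
proof -
  let ?\<tau> = "init_plays T"
  obtain Tie' Tge q where ie: "phase I p 0 Tie' (\<lambda>k m. ?\<tau>)"
    and q: "oracle_sol I
          (\<lambda>k m. min (max (emp_gap I \<omega> p 0 Tie' k m) (1 / ln (ln (real T)))) (ln (ln (real T)))) q"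
    and ge: "phase I p Tie' Tge
          (\<lambda>k m. max (init_plays T) (nat \<lceil>18 * q k m * B\<rceil>) - init_plays T)"
    and final: "if narrow Tge then committed Tge else wcpe_reg g I T \<omega> p Tge"
    using run unfolding cexp2_def narrow_def committed_def by blast
  have "(\<lambda>m. \<Sum>k\<in>arms I. ?\<tau>) ` agents I = {Tie}"
    using M_ge by auto
  then have Tie': "Tie' = Tie"
    using ie by (simp add: phase_def)
  have clip: "(\<lambda>k m. min (max (emp_gap I \<omega> p 0 Tie' k m) (1 / LL)) LL) = clipped_gap"
    by (intro ext) (simp add: clipped_gap_def Tie')
  have q': "oracle_sol I clipped_gap q"
    using q unfolding clip .
  have le: "Tie \<le> Tge"
    using phase_bounds(1)[OF ge] Tie' by simp
  have N: "num_plays p 0 Tge k m = max ?\<tau> (nat \<lceil>18 * q k m * B\<rceil>)"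
    if "k \<in> arms I" "m \<in> agents I" for k m
  proof -
    have "num_plays p 0 Tge k m = num_plays p 0 Tie' k m + num_plays p Tie' Tge k m"
      by (rule num_plays_split) (use phase_bounds(1)[OF ge] in auto)
    then show ?thesis
      using phase_bounds(2)[OF ie that] phase_bounds(2)[OF ge that] by simp
  qed
  have q0: "18 * q k m * B \<ge> 0" if "k \<in> arms I" "m \<in> agents I" for k m
    using q' that feasible_nonneg[of clipped_gap q k m] beta_pos[of "\<lambda>n. T"]
    by (simp add: oracle_sol_def is_arg_min_linorder)
  have "Tge \<le> Tie' + K * Y"
  proof (rule phase_end_le[OF ge M_ge])
    fix m assume m: "m \<in> agents I"
    have "max ?\<tau> (nat \<lceil>18 * q k m * B\<rceil>) - ?\<tau> \<le> Y" if k: "k \<in> arms I" for k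
    proof -
      have "18 * q k m * B \<le> 18 * (2 * real K * real M ^ 2 * LL ^ 4) * B"
        using oracle_bound[OF q' k m] beta_pos[of "\<lambda>n. T"] by (intro mult_right_mono mult_left_mono) auto
      also have "\<dots> \<le> real Y"
        using Y by simp
      finally have "nat \<lceil>18 * q k m * B\<rceil> \<le> Y"
        by (simp add: ceiling_le_iff nat_le_iff)
      then show ?thesis
        by linarith
    qed
    then have "(\<Sum>k\<in>arms I. max ?\<tau> (nat \<lceil>18 * q k m * B\<rceil>) - ?\<tau>) \<le> (\<Sum>k\<in>arms I. Y)"
      by (intro sum_mono) blast
    then show "(\<Sum>k\<in>arms I. max ?\<tau> (nat \<lceil>18 * q k m * B\<rceil>) - ?\<tau>) \<le> K * Y"
      by simp
  qed
  then have "Tge \<le> K * (?\<tau> + Y)"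
    by (simp add: Tie' distrib_left)
  moreover have "real (num_plays p 0 Tge k m) \<ge> 18 * q k m * B" "num_plays p 0 Tge k m \<ge> 1"
      "real (num_plays p 0 Tge k m) \<le> real ?\<tau> + 1 + 18 * q k m * B"
    if km: "k \<in> arms I" "m \<in> agents I" for k m
  proof -
    have "real (nat \<lceil>18 * q k m * B\<rceil>) = of_int \<lceil>18 * q k m * B\<rceil>"
      using q0[OF km] by simp
    then have c: "18 * q k m * B \<le> real (nat \<lceil>18 * q k m * B\<rceil>)"
      "real (nat \<lceil>18 * q k m * B\<rceil>) \<le> 18 * q k m * B + 1"
      by linarith+
    show "real (num_plays p 0 Tge k m) \<ge> 18 * q k m * B"
      unfolding N[OF km] of_nat_max using c by (auto simp: max_def)
    show "num_plays p 0 Tge k m \<ge> 1"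
      unfolding N[OF km] using init by simp
    show "real (num_plays p 0 Tge k m) \<le> real ?\<tau> + 1 + 18 * q k m * B"
      unfolding N[OF km] of_nat_max using c q0[OF km] by linarith
  qed
  ultimately show ?thesis
    using that[OF q' le] final by blast
qed

text \<open>Given valid confidence bounds, the switching condition certifies the best arms by
  itself, however inaccurate the estimates at \<open>Tie\<close> were.\<close>

lemma exploitation_regret:
  assumes C: "narrow Tge"
    and ex: "committed Tge"
  shows "path_regret I p Tge T = 0"
proof (rule path_regret_eq_0)
  fix m t assume m: "m \<in> agents I" and t: "t \<in> {Tge<..T}"
  obtain k where k: "is_arg_max (\<lambda>j. emp_mixed I \<omega> p 0 Tge j m) (\<lambda>j. j \<in> arms I) k"
    "\<forall>t\<in>{Tge<..T}. p m t = Some k"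
    using ex m unfolding committed_def by blast
  let ?e = "\<lambda>j. \<bar>emp_mixed I \<omega> p 0 Tge j m - mixed_mean I j m\<bar>"
  have "k = best_arm I m"
  proof (rule narrow_widths_identify_best[OF m _ _ k(1)])
    fix j assume j: "j \<in> arms I"
    show "?e j \<le> ?e j" ..
    have "ereal (?e j) \<le> width g I (1 / real T) p 0 Tge j m"
      using conf[of Tge] j m unfolding confident_def by blast
    also have "\<dots> < ereal (emp_gap I \<omega> p 0 Tge j m / 2)"
      using C j m unfolding narrow_def by blast
    finally show "?e j < adj_gap I (\<lambda>j. emp_mixed I \<omega> p 0 Tge j m) j / 2"
      by (simp add: emp_gap_def)
  qed
  with k(2) t show "p m t = Some (best_arm I m)"
    by blast
qed

text \<open>Accurate estimates make the oracle cost comparable to \<open>c_star\<close> and at the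
  same time force the switching condition, so all regret is incurred by time \<open>Tge\<close>. The
  factor is 360 = 18 * 20.\<close>

lemma regret_if_accurate:
  assumes acc: "\<And>k m. k \<in> arms I \<Longrightarrow> m \<in> agents I \<Longrightarrow>
      \<bar>emp_mixed I \<omega> p 0 Tie k m - mixed_mean I k m\<bar> \<le> gap_min I / 8"
    and clip: "1 / LL \<le> 3 / 4 * gap_min I" "5 / 4 * gap_max I \<le> LL"
  shows "path_regret I p 0 T \<le> real K * real M * (real (init_plays T) + 1) * gap_max I + 360 * B * c_star I"
proof -
  obtain Tge q where q: "oracle_sol I clipped_gap q"
    and Tge: "Tie \<le> Tge" "Tge \<le> K * (init_plays T + Y)"
    and N: "\<And>k m. k \<in> arms I \<Longrightarrow> m \<in> agents I \<Longrightarrow> real (num_plays p 0 Tge k m) \<ge> 18 * q k m * B"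
      "\<And>k m. k \<in> arms I \<Longrightarrow> m \<in> agents I \<Longrightarrow> num_plays p 0 Tge k m \<ge> 1"
      "\<And>k m. k \<in> arms I \<Longrightarrow> m \<in> agents I \<Longrightarrow>
      real (num_plays p 0 Tge k m) \<le> real (init_plays T) + 1 + 18 * q k m * B"
    and final: "if narrow Tge then committed Tge else wcpe_reg g I T \<omega> p Tge"
    by (rule run_cases) (rule that)
  \<comment> \<open>Two deviations of \<open>gap_min I / 8\<close> amount to at most a quarter of
    any suboptimal gap, and by \<open>clip\<close> the truncation leaves such estimates
    unchanged.\<close>
  have gaps: "3 / 4 * true_adj_gap I k m \<le> clipped_gap k m \<and> clipped_gap k m \<le> 5 / 4 * true_adj_gap I k m"
    if km: "k \<in> arms I" "m \<in> agents I" for k m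
  proof -
    let ?v = "\<lambda>j. emp_mixed I \<omega> p 0 Tie j m"
    have e: "gap_min I / 8 + gap_min I / 8 \<le> 1 / 4 * true_gap I j m"
      if "j \<in> arms I - {best_arm I m}" for j
      using gap_min_le_true_gap[OF km(2), of j] that by auto
    have "(1 - 1 / 4) * true_adj_gap I k m \<le> adj_gap I ?v k"
      by (rule perturbed_gaps(2)[OF km(2) _ _ acc[OF _ km(2)] e km(1)]) auto
    moreover have "adj_gap I ?v k \<le> (1 + 1 / 4) * true_adj_gap I k m"
      by (rule perturbed_gaps(3)[OF km(2) _ _ acc[OF _ km(2)] e km(1)]) auto
    moreover have "emp_gap I \<omega> p 0 Tie k m = adj_gap I ?v k"
      by (simp add: emp_gap_def)
    moreover have "gap_min I \<le> true_adj_gap I k m" "true_adj_gap I k m \<le> gap_max I"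
      using gap_min_le gap_max_ge km by blast+
    ultimately show ?thesis
      using clip unfolding clipped_gap_def min_def max_def by auto
  qed
  have f: "feasible I clipped_gap q"
    using q by (simp add: oracle_sol_def is_arg_min_def)
  \<comment> \<open>The factor 18 turns the constraint bound, half the squared clipped gap, into
    1/36 of that square. The width is thus at most 1/6 of the clipped gap, and 5/4 * 1/6 =
    5/24.\<close>
  have width: "width g I (1 / real T) p 0 Tge k m \<le> ereal (5 / 24 * true_adj_gap I k m)"
    if km: "k \<in> arms I" "m \<in> agents I" for k m
  proof (rule width_le_of_allocation[where q = "\<lambda>n. 18 * q k n" and b = B])
    show "num_plays p 0 Tge k n \<ge> 1" if "n \<in> agents I" for n
      using N(2)[OF km(1) that] .
    show "18 * q k n \<ge> 0" if "n \<in> agents I" for n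
      using feasible_nonneg[OF f km(1) that] by simp
    show "0 < 18 * q k n \<and> B * (18 * q k n) \<le> real (num_plays p 0 Tge k n)"
      if "n \<in> agents I" "w n m \<noteq> 0" for n
      using feasible_pos[OF f km that] N(1)[OF km(1) that(1)] by (simp add: mult.commute mult.left_commute)
    show "beta g I (1 / real T) (num_plays p 0 Tge k) \<le> B"
      by (rule beta_mono) (use num_plays_le[of p 0 Tge k] Tge(2) horizon in \<open>meson diff_le_self order_trans\<close>)
    have "(\<Sum>n\<in>agents I. (w n m)\<^sup>2 / (18 * q k n)) = (\<Sum>n\<in>agents I. (w n m)\<^sup>2 / q k n) / 18"
      unfolding sum_divide_distrib by (rule sum.cong) (auto simp: mult.commute)
    also have "\<dots> \<le> (clipped_gap k m)\<^sup>2 / 2 / 18"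
      using feasible_sum[OF f km] by simp
    also have "(clipped_gap k m)\<^sup>2 \<le> (5 / 4 * true_adj_gap I k m)\<^sup>2"
    proof (rule power_mono)
      show "clipped_gap k m \<ge> 0"
        using clipped_gap_ge[of k m] lnln by (meson divide_nonneg_nonneg order_trans zero_le_one)
    qed (use gaps[OF km] in simp)
    finally show "(\<Sum>n\<in>agents I. (w n m)\<^sup>2 / (18 * q k n)) \<le> (5 / 24 * true_adj_gap I k m)\<^sup>2"
      by (simp add: power2_eq_square)
    show "5 / 24 * true_adj_gap I k m \<ge> 0"
      using true_adj_gap_pos[OF km(2,1)] by simp
  qed (use beta_pos in \<open>auto intro: less_imp_le\<close>)
  have C: "narrow Tge"
    unfolding narrow_def
  proof (intro ballI)
    fix k m assume km: "k \<in> arms I" "m \<in> agents I"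
    let ?v = "\<lambda>j. emp_mixed I \<omega> p 0 Tge j m"
    have dev: "\<bar>?v j - mixed_mean I j m\<bar> \<le> 5 / 24 * true_adj_gap I j m" if j: "j \<in> arms I" for j
    proof -
      have "ereal \<bar>?v j - mixed_mean I j m\<bar> \<le> width g I (1 / real T) p 0 Tge j m"
        using conf[of Tge] j km unfolding confident_def by blast
      also note width[OF j km(2)]
      finally show ?thesis
        by simp
    qed
    \<comment> \<open>Two widths cost at most 5/12 of the gap, so the empirical gap keeps 7/12 of
      it; half of that, 7/24, still exceeds the width 5/24.\<close>
    have "5 / 24 * true_adj_gap I j m + 5 / 24 * true_adj_gap I (best_arm I m) m \<le> 5 / 12 * true_gap I j m"
      if j: "j \<in> arms I - {best_arm I m}" for j
      using true_adj_gap_best_arm_le[of j m] true_adj_gap_eq[of j m] j by auto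
    then have "(1 - 5 / 12) * true_adj_gap I k m \<le> adj_gap I ?v k"
      by (intro perturbed_gaps(2)[OF km(2) _ _ dev _ km(1)]) auto
    then have "5 / 24 * true_adj_gap I k m < adj_gap I ?v k / 2"
      using true_adj_gap_pos[OF km(2,1)] by simp
    then have "ereal (5 / 24 * true_adj_gap I k m) < ereal (emp_gap I \<omega> p 0 Tge k m / 2)"
      by (simp add: emp_gap_def)
    with width[OF km] show "width g I (1 / real T) p 0 Tge k m < ereal (emp_gap I \<omega> p 0 Tge k m / 2)"
      by (rule le_less_trans)
  qed
  with final have "path_regret I p Tge T = 0"
    using exploitation_regret[OF C] by simp
  then have "path_regret I p 0 T \<le> path_regret I p 0 Tge"
    using path_regret_split_le[OF valid, of 0 Tge T] by simp
  also have "\<dots> \<le> (\<Sum>m\<in>agents I. \<Sum>k\<in>arms I. (real (init_plays T) + 1) * gap_max I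
      + 18 * B * (q k m * true_adj_gap I k m))"
    unfolding path_regret_counts[OF valid]
  proof (intro sum_mono)
    fix m k assume km: "k \<in> arms I" "m \<in> agents I"
    have "real (num_plays p 0 Tge k m) * true_gap I k m
        \<le> (real (init_plays T) + 1 + 18 * q k m * B) * true_gap I k m"
      using N(3)[OF km] true_gap_nonneg[OF km(1)] by (rule mult_right_mono)
    also have "\<dots> = (real (init_plays T) + 1) * true_gap I k m + (18 * q k m * B) * true_gap I k m"
      by (rule distrib_right)
    also have "\<dots> \<le> (real (init_plays T) + 1) * gap_max I + (18 * q k m * B) * true_adj_gap I k m"
      using feasible_nonneg[OF f km] beta_pos[of "\<lambda>n. T"] true_gap_le_max[OF km(2,1)] true_gap_le_adj[OF km(2,1)]
      by (intro add_mono mult_left_mono) auto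
    finally show "real (num_plays p 0 Tge k m) * true_gap I k m \<le> (real (init_plays T) + 1) * gap_max I
      + 18 * B * (q k m * true_adj_gap I k m)"
      by (simp add: mult_ac)
  qed
  also have "\<dots> = real K * real M * (real (init_plays T) + 1) * gap_max I
      + 18 * B * (\<Sum>k\<in>arms I. \<Sum>m\<in>agents I. q k m * true_adj_gap I k m)"
    by (subst (2) sum.swap) (simp add: sum.distrib sum_distrib_left)
  also have "18 * B * (\<Sum>k\<in>arms I. \<Sum>m\<in>agents I. q k m * true_adj_gap I k m) \<le> 18 * B * (20 * c_star I)"
    using oracle_cost_le[OF q gaps] beta_pos[of "\<lambda>n. T"] by (intro mult_left_mono) auto
  finally show ?thesis
    by simp
qed

text \<open>Whatever the estimates, clipping caps both exploration phases at
  \<open>K * (init_plays T + Y)\<close> rounds. Afterwards exploitation is free of regret, and the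
  alternative is W-CPE-Reg on fresh data. Confidence after a reset is assumed on the whole window
  because \<open>Tge\<close> is known only to lie in it.\<close>

lemma regret_if_inaccurate:
  assumes conf_reset: "\<And>s t. s \<in> {Tie..K * (init_plays T + Y)} \<Longrightarrow> confident g I (1 / real T) \<omega> p s t"
    and R: "4 * (1 / 2) ^ R < gap_min I"
    and X: "real (narms I) * real (nagents I) ^ 2 * 4 ^ R * beta g I (1 / real T) (\<lambda>n. 2 * T) \<le> real X"
    and X_le: "X \<le> T"
  shows "path_regret I p 0 T \<le> real M * gap_max I *
    (real K * (real (init_plays T) + real Y) + real K + real (R + 1) * (real K * real M * real X))"
proof -
  obtain Tge q where q: "oracle_sol I clipped_gap q"
    and Tge: "Tie \<le> Tge" "Tge \<le> K * (init_plays T + Y)"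
    and final: "if narrow Tge then committed Tge else wcpe_reg g I T \<omega> p Tge"
    by (rule run_cases) (rule that)
  have "path_regret I p Tge T \<le> real M * gap_max I * (real K + real (R + 1) * (real K * real M * real X))"
  proof (cases "narrow Tge")
    case True
    then show ?thesis
      using exploitation_regret[OF True] final gap_max_pos by simp
  next
    case False
    interpret wcpe_run \<sigma> I g "1 / real T" T \<omega> p Tge R X
      by unfold_locales (use valid conf_reset Tge g_pos R X X_le in auto)
    show ?thesis
      using wcpe_regret False final by (simp del: of_nat_add)
  qed
  moreover have "path_regret I p 0 Tge \<le> real M * gap_max I * real (K * (init_plays T + Y))"
    by (rule path_regret_le[OF valid]) (use of_nat_mono[OF Tge(2), where 'a = real] in auto)
  moreover have "path_regret I p 0 T \<le> path_regret I p 0 Tge + path_regret I p Tge T"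
    by (rule path_regret_split_le[OF valid]) simp
  ultimately show ?thesis
    by (simp add: algebra_simps)
qed

end


section \<open>Restarted policies and concentration\<close>

text \<open>The device for conditioning on the rewards up to a fixed time: an independent second
  table replaces everything after \<open>s\<close>.\<close>

definition glue :: "bandit \<Rightarrow> nat \<Rightarrow> rewards \<Rightarrow> rewards \<Rightarrow> rewards" where
  "glue I s \<omega> \<omega>' = (\<lambda>(k, m, t)\<in>arms I \<times> agents I \<times> {1..}.
     if t \<le> s then \<omega> (k, m, t) else \<omega>' (k, m, t - s))"

text \<open>With the first table held fixed, the behaviour after \<open>s\<close> becomes a policy
  on the second table that starts at time 0.\<close>

definition shift_policy :: "bandit \<Rightarrow> nat \<Rightarrow> (rewards \<Rightarrow> plays) \<Rightarrow> rewards \<Rightarrow> rewards \<Rightarrow> plays" where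
  "shift_policy I s \<pi> \<omega> \<omega>' = (\<lambda>m t. \<pi> (glue I s \<omega> \<omega>') m (s + t))"

lemma play_times_shift:
  "play_times p s (s + t) k m = (\<lambda>u. s + u) ` play_times (\<lambda>m t. p m (s + t)) 0 t k m"
proof -
  have "u \<in> (\<lambda>u. s + u) ` play_times (\<lambda>m t. p m (s + t)) 0 t k m"
    if "u \<in> play_times p s (s + t) k m" for u
    using that by (intro image_eqI[of _ _ "u - s"]) (auto simp: play_times_def)
  then show ?thesis
    by (auto simp: play_times_def)
qed

lemma num_plays_shift:
  "num_plays p s (s + t) k m = num_plays (\<lambda>m t. p m (s + t)) 0 t k m"
  unfolding num_plays_def play_times_shift by (rule card_image) simp

lemma emp_mean_shift:
  assumes "\<And>u. u \<ge> 1 \<Longrightarrow> \<omega> (k, m, s + u) = \<omega>' (k, m, u)"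
  shows "emp_mean \<omega> p s (s + t) k m = emp_mean \<omega>' (\<lambda>m t. p m (s + t)) 0 t k m"
proof -
  have "(\<Sum>u\<in>play_times p s (s + t) k m. \<omega> (k, m, u)) =
      (\<Sum>u\<in>play_times (\<lambda>m t. p m (s + t)) 0 t k m. \<omega> (k, m, s + u))"
    unfolding play_times_shift by (subst sum.reindex) auto
  also have "\<dots> = (\<Sum>u\<in>play_times (\<lambda>m t. p m (s + t)) 0 t k m. \<omega>' (k, m, u))"
    by (rule sum.cong) (auto simp: play_times_def assms)
  finally show ?thesis
    by (simp add: emp_mean_def num_plays_shift)
qed

lemma confident_shift:
  assumes "\<And>k m u. k \<in> arms I \<Longrightarrow> m \<in> agents I \<Longrightarrow> u \<ge> 1 \<Longrightarrow> \<omega> (k, m, s + u) = \<omega>' (k, m, u)"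
  shows "confident g I \<delta> \<omega> p s (s + t) \<longleftrightarrow> confident g I \<delta> \<omega>' (\<lambda>m t. p m (s + t)) 0 t"
proof -
  have "emp_mixed I \<omega> p s (s + t) k m = emp_mixed I \<omega>' (\<lambda>m t. p m (s + t)) 0 t k m"
    if "k \<in> arms I" for k m
    unfolding emp_mixed_def using assms[OF that]
    by (intro sum.cong[OF refl] arg_cong2[of _ _ _ _ "(*)"] emp_mean_shift) auto
  moreover have "width g I \<delta> p s (s + t) k m = width g I \<delta> (\<lambda>m t. p m (s + t)) 0 t k m" for k m
  proof -
    have "num_plays p s (s + t) k = num_plays (\<lambda>m t. p m (s + t)) 0 t k"
      by (intro ext num_plays_shift)
    then show ?thesis
      by (simp add: width_def)
  qed
  ultimately show ?thesis
    by (simp add: confident_def)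
qed

lemma emp_mixed_cong:
  assumes "\<And>u m. m \<in> agents I \<Longrightarrow> s < u \<Longrightarrow> u \<le> t \<Longrightarrow> p m u = p' m u"
    and "\<And>u k m. s < u \<Longrightarrow> u \<le> t \<Longrightarrow> \<omega> (k, m, u) = \<omega>' (k, m, u)"
  shows "emp_mixed I \<omega> p s t k m = emp_mixed I \<omega>' p' s t k m"
  unfolding emp_mixed_def
proof (rule sum.cong[OF refl])
  fix n assume n: "n \<in> agents I"
  have "play_times p s t k n = play_times p' s t k n"
    using assms(1)[OF n] by (auto simp: play_times_def)
  moreover have "(\<Sum>u\<in>play_times p' s t k n. \<omega> (k, n, u)) = (\<Sum>u\<in>play_times p' s t k n. \<omega>' (k, n, u))"
    by (rule sum.cong) (auto simp: play_times_def assms(2))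
  ultimately show "weight I n m * emp_mean \<omega> p s t k n = weight I n m * emp_mean \<omega>' p' s t k n"
    by (simp add: emp_mean_def num_plays_def)
qed

text \<open>\<open>policy\<close> speaks of earlier plays and observed rewards. By strong induction
  on the time the earlier plays themselves coincide, so agreement of the tables before
  \<open>t\<close> is enough.\<close>

lemma policy_prefix:
  assumes \<pi>: "policy I \<pi>" and \<omega>: "\<omega> \<in> space (reward_space I)" "\<omega>' \<in> space (reward_space I)"
    and eq: "\<And>k m u. u < t \<Longrightarrow> \<omega> (k, m, u) = \<omega>' (k, m, u)"
    and t: "t \<ge> 1" and m: "m \<in> agents I"
  shows "\<pi> \<omega> m t = \<pi> \<omega>' m t"
  using t m eq
proof (induction t arbitrary: m rule: less_induct)
  case (less t)
  have "\<forall>u\<in>{1..<t}. \<forall>m\<in>agents I. \<pi> \<omega> m u = \<pi> \<omega>' m u \<and>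
      (\<forall>k. \<pi> \<omega> m u = Some k \<longrightarrow> \<omega> (k, m, u) = \<omega>' (k, m, u))"
    using less.IH less.prems(3) by force
  then show ?case
    using \<pi> \<omega> less.prems(1,2) unfolding policy_def by blast
qed

section \<open>The reward space and resampling after a fixed time\<close>

context bandit_model
begin

abbreviation "idx \<equiv> arms I \<times> agents I \<times> {1::nat..}"
abbreviation "\<P> \<equiv> reward_space I"

lemma prob_space_law: "i \<in> idx \<Longrightarrow> prob_space (case i of (k, m, t) \<Rightarrow> law I k m)"
  using bandit by (auto simp: bandit_instance_def subgaussian_def)

lemma sets_law: "k \<in> arms I \<Longrightarrow> m \<in> agents I \<Longrightarrow> sets (law I k m) = sets borel"
  using bandit unfolding bandit_instance_def subgaussian_def by blast

lemma space_law: "k \<in> arms I \<Longrightarrow> m \<in> agents I \<Longrightarrow> space (law I k m) = UNIV"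
  using sets_eq_imp_space_eq[OF sets_law] by simp

lemma prob_space_R: "prob_space \<P>"
  unfolding reward_space_def by (rule prob_space_PiM) (rule prob_space_law)

lemma space_R: "space \<P> = extensional idx"
  unfolding reward_space_def space_PiM using space_law by (auto simp: PiE_def)

lemma measurable_law:
  "k \<in> arms I \<Longrightarrow> m \<in> agents I \<Longrightarrow> measurable N (law I k m) = borel_measurable N"
  by (rule measurable_cong_sets[OF refl sets_law])

lemma reward_measurable:
  assumes "k \<in> arms I" "m \<in> agents I" "t \<ge> 1"
  shows "(\<lambda>\<omega>. \<omega> (k, m, t)) \<in> borel_measurable \<P>"
proof -
  have "(\<lambda>\<omega>. \<omega> (k, m, t)) \<in> \<P> \<rightarrow>\<^sub>M (case (k, m, t) of (k, m, t) \<Rightarrow> law I k m)"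
    unfolding reward_space_def by (rule measurable_component_singleton) (use assms in auto)
  then show ?thesis
    using measurable_law[OF assms(1,2), of \<P>] by simp
qed

lemma glue_in_space [simp]: "glue I s \<omega> \<omega>' \<in> space \<P>"
  by (simp add: space_R glue_def)

lemma glue_measurable: "(\<lambda>(\<omega>, \<omega>'). glue I s \<omega> \<omega>') \<in> \<P> \<Otimes>\<^sub>M \<P> \<rightarrow>\<^sub>M \<P>"
proof -
  have "(\<lambda>x. \<lambda>i\<in>idx. case i of (k, m, t) \<Rightarrow> if t \<le> s then fst x (k, m, t) else snd x (k, m, t - s))
      \<in> \<P> \<Otimes>\<^sub>M \<P> \<rightarrow>\<^sub>M PiM idx (\<lambda>(k, m, t). law I k m)"
  proof (rule measurable_restrict)
    fix i assume i: "i \<in> idx"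
    then obtain k m t where kmt: "i = (k, m, t)" "k \<in> arms I" "m \<in> agents I" "t \<ge> 1"
      by auto
    have "(\<lambda>x. if t \<le> s then fst x (k, m, t) else snd x (k, m, t - s)) \<in> borel_measurable (\<P> \<Otimes>\<^sub>M \<P>)"
    proof (cases "t \<le> s")
      case True
      then show ?thesis
        using measurable_compose[OF measurable_fst reward_measurable[OF kmt(2-4)]] by simp
    next
      case False
      then have "t - s \<ge> 1"
        by simp
      from measurable_compose[OF measurable_snd reward_measurable[OF kmt(2,3) this]] False
      show ?thesis
        by simp
    qed
    then show "(\<lambda>x. case i of (k, m, t) \<Rightarrow> if t \<le> s then fst x (k, m, t) else snd x (k, m, t - s))
        \<in> \<P> \<Otimes>\<^sub>M \<P> \<rightarrow>\<^sub>M (case i of (k, m, t) \<Rightarrow> law I k m)"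
      using measurable_law[OF kmt(2,3), of "\<P> \<Otimes>\<^sub>M \<P>"] kmt(1) by simp
  qed
  moreover have "(\<lambda>x. \<lambda>i\<in>idx. case i of (k, m, t) \<Rightarrow> if t \<le> s then fst x (k, m, t) else snd x (k, m, t - s))
      = (\<lambda>(\<omega>, \<omega>'). glue I s \<omega> \<omega>')"
    by (auto simp: fun_eq_iff glue_def restrict_def)
  ultimately show ?thesis
    by (simp only: reward_space_def)
qed

text \<open>Both measures agree on cylinders. The coordinates of a finite index set \<open>J\<close>
  split into \<open>J1\<close>, with times up to \<open>s\<close>, and the shifted image of
  \<open>J2\<close>; independence of the two tables factors the cylinder accordingly.\<close>

lemma distr_glue: "distr (\<P> \<Otimes>\<^sub>M \<P>) \<P> (\<lambda>(\<omega>, \<omega>'). glue I s \<omega> \<omega>') = \<P>"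
proof -
  let ?L = "\<lambda>(k, m, t). law I k m"
  let ?f = "\<lambda>(\<omega>, \<omega>'). glue I s \<omega> \<omega>'"
  interpret R: prob_space \<P>
    by (rule prob_space_R)
  interpret RR: pair_prob_space \<P> \<P> ..
  have "\<P> = distr (\<P> \<Otimes>\<^sub>M \<P>) \<P> ?f"
    unfolding reward_space_def
  proof (rule measure_eqI_PiM_infinite[OF refl])
    show "sets (distr (PiM idx ?L \<Otimes>\<^sub>M PiM idx ?L) (PiM idx ?L) ?f) = sets (PiM idx ?L)"
      by simp
    show "finite_measure (PiM idx ?L)"
      using R.finite_measure_axioms by (simp add: reward_space_def)
  next
    fix A J assume J: "finite J" "J \<subseteq> idx" and A: "\<And>i. i \<in> J \<Longrightarrow> A i \<in> sets (?L i)"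
    let ?X = "prod_emb idx ?L J (Pi\<^sub>E J A)"
    define J1 where "J1 = {(k, m, t) \<in> J. t \<le> s}"
    define J2 where "J2 = {(k, m, t). (k, m, t + s) \<in> J \<and> t \<ge> 1}"
    define up where "up = (\<lambda>(k::nat, m::nat, t::nat). (k, m, t + s))"
    have J1: "J1 \<subseteq> J" "J1 \<subseteq> idx" "finite J1"
      using J by (auto simp: J1_def intro: rev_finite_subset)
    have up_inj: "inj up"
      by (auto simp: up_def inj_on_def)
    have J2_im: "up ` J2 = J - J1"
    proof -
      have "i \<in> up ` J2" if i': "i \<in> J - J1" for i
      proof -
        obtain k m t where i: "i = (k, m, t)" "t > s"
          using i' by (cases i) (auto simp: J1_def)
        then show ?thesis
          using i' by (intro image_eqI[of _ _ "(k, m, t - s)"]) (auto simp: up_def J2_def)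
      qed
      then show ?thesis
        by (auto simp: up_def J2_def J1_def)
    qed
    have J2: "J2 \<subseteq> idx"
      using J by (auto simp: J2_def)
    have "finite (up ` J2)"
      using J J2_im by simp
    then have finJ2: "finite J2"
      using finite_imageD[of up J2] up_inj by (meson inj_on_subset subset_UNIV)
    \<comment> \<open>Identical distribution over time: moving the time index leaves the law
      unchanged.\<close>
    have L_up: "?L (up i) = ?L i" for i
      by (auto simp: up_def split: prod.split)
    have A2: "A (up i) \<in> sets (?L i)" if "i \<in> J2" for i
      using A[of "up i"] that J2_im L_up[of i] by auto
    let ?E = "prod_emb idx ?L J1 (Pi\<^sub>E J1 A)"
    let ?F = "prod_emb idx ?L J2 (\<Pi>\<^sub>E i\<in>J2. A (up i))"
    have emb: "prod_emb idx ?L N (Pi\<^sub>E N C) = {\<omega> \<in> space \<P>. \<forall>i\<in>N. \<omega> i \<in> C i}"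
      if "N \<subseteq> idx" for N C
      unfolding prod_emb_def reward_space_def space_PiM by (auto simp only: restrict_PiE_iff vimage_eq Int_iff mem_Collect_eq)
    have "?f -` ?X \<inter> space (\<P> \<Otimes>\<^sub>M \<P>) = ?E \<times> ?F"
    proof -
      have split: "(\<forall>i\<in>J. glue I s \<omega> \<omega>' i \<in> A i) \<longleftrightarrow> (\<forall>i\<in>J1. \<omega> i \<in> A i) \<and> (\<forall>i\<in>J2. \<omega>' i \<in> A (up i))"
        for \<omega> \<omega>'
      proof -
        have "J = J1 \<union> up ` J2"
          using J2_im J1 by blast
        moreover have "glue I s \<omega> \<omega>' i = \<omega> i" if "i \<in> J1" for i
          using that J1 by (auto simp: glue_def J1_def)
        moreover have "glue I s \<omega> \<omega>' (up i) = \<omega>' i" if "i \<in> J2" for i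
          using that J2 by (auto simp: glue_def up_def J2_def)
        ultimately show ?thesis
          by (auto simp: ball_Un)
      qed
      show ?thesis
        unfolding emb[OF J(2)] emb[OF J1(2)] emb[OF J2] space_pair_measure
      proof (rule set_eqI)
        fix x :: "rewards \<times> rewards"
        obtain a b where x: "x = (a, b)"
          by (cases x)
        show "x \<in> ?f -` {\<omega> \<in> space \<P>. \<forall>i\<in>J. \<omega> i \<in> A i} \<inter> space \<P> \<times> space \<P> \<longleftrightarrow>
            x \<in> {\<omega> \<in> space \<P>. \<forall>i\<in>J1. \<omega> i \<in> A i} \<times> {\<omega> \<in> space \<P>. \<forall>i\<in>J2. \<omega> i \<in> A (up i)}"
          unfolding x using split[of a b] by simp blast
      qed
    qed
    then have "emeasure (distr (\<P> \<Otimes>\<^sub>M \<P>) \<P> ?f) ?X = emeasure (\<P> \<Otimes>\<^sub>M \<P>) (?E \<times> ?F)"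
      by (subst emeasure_distr[OF glue_measurable])
         (use J A in \<open>auto simp: reward_space_def intro!: sets_PiM_I\<close>)
    also have "\<dots> = emeasure \<P> ?E * emeasure \<P> ?F"
      by (rule R.emeasure_pair_measure_Times)
         (use J1 J2 finJ2 A A2 in \<open>auto simp: reward_space_def intro!: sets_PiM_I\<close>)
    also have "emeasure \<P> ?E = (\<Prod>i\<in>J1. emeasure (?L i) (A i))"
      unfolding reward_space_def
      by (rule emeasure_PiM_emb) (use J1 A prob_space_law in auto)
    also have "emeasure \<P> ?F = (\<Prod>i\<in>J2. emeasure (?L i) (A (up i)))"
      unfolding reward_space_def
      by (rule emeasure_PiM_emb) (use J2 finJ2 A2 prob_space_law in auto)
    also have "\<dots> = (\<Prod>i\<in>up ` J2. emeasure (?L i) (A i))"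
      by (subst prod.reindex) (use up_inj L_up in \<open>auto intro: inj_on_subset\<close>)
    also have "(\<Prod>i\<in>J1. emeasure (?L i) (A i)) * (\<Prod>i\<in>up ` J2. emeasure (?L i) (A i))
        = (\<Prod>i\<in>J. emeasure (?L i) (A i))"
      unfolding J2_im using J J1 by (subst mult.commute, subst prod.subset_diff[symmetric]) auto
    also have "\<dots> = emeasure (PiM idx ?L) ?X"
      by (rule emeasure_PiM_emb[symmetric]) (use J A prob_space_law in auto)
    finally show "emeasure (PiM idx ?L) ?X =
        emeasure (distr (PiM idx ?L \<Otimes>\<^sub>M PiM idx ?L) (PiM idx ?L) ?f) ?X"
      by (simp add: reward_space_def)
  qed
  then show ?thesis ..
qed

lemma policy_valid:
  assumes "policy I \<pi>" "\<omega> \<in> space \<P>"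
  shows "valid_plays I (\<pi> \<omega>)"
  unfolding valid_plays_def
proof (intro ballI allI impI)
  fix m t assume "m \<in> agents I" "(t::nat) \<ge> 1"
  then have "(\<lambda>\<omega>. \<pi> \<omega> m t) \<in> \<P> \<rightarrow>\<^sub>M count_space (insert None (Some ` arms I))"
    using assms(1) by (simp add: policy_def)
  from measurable_space[OF this assms(2)] show "\<pi> \<omega> m t \<in> insert None (Some ` arms I)"
    by simp
qed

text \<open>Up to \<open>s\<close> the two glued tables coincide, so the plays agree by the prefix
  property; after \<open>s\<close> their agreement is the hypothesis on the shifted policy. The
  original policy then decides equally at \<open>s + t\<close>.\<close>

lemma shift_policy_is_policy:
  assumes \<pi>: "policy I \<pi>" and \<omega>: "\<omega> \<in> space \<P>"
  shows "policy I (shift_policy I s \<pi> \<omega>)"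
  unfolding policy_def
proof (intro conjI ballI allI impI)
  fix m t assume m: "m \<in> agents I" and t: "(t::nat) \<ge> 1"
  have "(\<lambda>\<omega>'. glue I s \<omega> \<omega>') \<in> \<P> \<rightarrow>\<^sub>M \<P>"
    using measurable_compose[OF measurable_Pair1'[OF \<omega>] glue_measurable] by simp
  moreover have "(\<lambda>\<omega>. \<pi> \<omega> m (s + t)) \<in> \<P> \<rightarrow>\<^sub>M count_space (insert None (Some ` arms I))"
    using \<pi> m t by (simp add: policy_def)
  ultimately show "(\<lambda>\<omega>'. shift_policy I s \<pi> \<omega> \<omega>' m t) \<in> \<P> \<rightarrow>\<^sub>M count_space (insert None (Some ` arms I))"
    unfolding shift_policy_def by (rule measurable_compose)
next
  fix \<omega>1 \<omega>2 t m
  assume \<omega>12: "\<omega>1 \<in> space \<P>" "\<omega>2 \<in> space \<P>" and t: "(t::nat) \<ge> 1" and m: "m \<in> agents I"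
    and eq: "\<forall>u\<in>{1..<t}. \<forall>m\<in>agents I. shift_policy I s \<pi> \<omega> \<omega>1 m u = shift_policy I s \<pi> \<omega> \<omega>2 m u \<and>
           (\<forall>k. shift_policy I s \<pi> \<omega> \<omega>1 m u = Some k \<longrightarrow> \<omega>1 (k, m, u) = \<omega>2 (k, m, u))"
  let ?s1 = "glue I s \<omega> \<omega>1" and ?s2 = "glue I s \<omega> \<omega>2"
  have "\<pi> ?s1 n u = \<pi> ?s2 n u \<and> (\<forall>k. \<pi> ?s1 n u = Some k \<longrightarrow> ?s1 (k, n, u) = ?s2 (k, n, u))"
    if u: "u \<in> {1..<s + t}" and n: "n \<in> agents I" for u n
  proof (cases "u \<le> s")
    case True
    have same: "?s1 (k, n, v) = ?s2 (k, n, v)" if "v \<le> s" for k n v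
      using that by (simp add: glue_def restrict_def)
    have "\<pi> ?s1 n u = \<pi> ?s2 n u"
      by (rule policy_prefix[OF \<pi>]) (use same True u n in auto)
    with same True show ?thesis
      by simp
  next
    case False
    then have v: "u - s \<in> {1..<t}" "s + (u - s) = u"
      using u by auto
    have "\<pi> ?s1 n u = \<pi> ?s2 n u \<and> (\<forall>k. \<pi> ?s1 n u = Some k \<longrightarrow> \<omega>1 (k, n, u - s) = \<omega>2 (k, n, u - s))"
      using eq[rule_format, OF v(1) n] v(2) by (simp add: shift_policy_def)
    then show ?thesis
      using False by (auto simp: glue_def restrict_def)
  qed
  then show "shift_policy I s \<pi> \<omega> \<omega>1 m t = shift_policy I s \<pi> \<omega> \<omega>2 m t"
    using \<pi> t m glue_in_space[of s \<omega> \<omega>1] glue_in_space[of s \<omega> \<omega>2]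
    unfolding policy_def shift_policy_def by (meson trans_le_add2)
qed

section \<open>Measurability of counts, estimates and confidence events\<close>

lemma play_measurable:
  assumes "policy I \<pi>" "m \<in> agents I" "t \<ge> 1"
  shows "Measurable.pred \<P> (\<lambda>\<omega>. \<pi> \<omega> m t = Some k)"
proof -
  have "(\<lambda>\<omega>. \<pi> \<omega> m t) \<in> \<P> \<rightarrow>\<^sub>M count_space (insert None (Some ` arms I))"
    using assms by (simp add: policy_def)
  from measurable_compose[OF this, of "\<lambda>x. x = Some k" "count_space UNIV"] show ?thesis
    by simp
qed

text \<open>The set of play times is random, so the count is rewritten as a sum of indicators over
  the fixed window.\<close>

lemma num_plays_measurable:
  assumes "policy I \<pi>" "m \<in> agents I"
  shows "(\<lambda>\<omega>. real (num_plays (\<pi> \<omega>) s t k m)) \<in> borel_measurable \<P>"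
proof -
  have "real (num_plays (\<pi> \<omega>) s t k m) = (\<Sum>u\<in>{s<..t}. if \<pi> \<omega> m u = Some k then 1 else 0)" for \<omega>
    by (simp add: sum.If_cases num_plays_def play_times_def Int_def)
  moreover have "(\<lambda>\<omega>. \<Sum>u\<in>{s<..t}. if \<pi> \<omega> m u = Some k then 1 else 0 :: real) \<in> borel_measurable \<P>"
    by (intro borel_measurable_sum measurable_If play_measurable[unfolded pred_def] assms) auto
  ultimately show ?thesis
    by simp
qed

lemma emp_mixed_measurable:
  assumes "policy I \<pi>" "k \<in> arms I"
  shows "(\<lambda>\<omega>. emp_mixed I \<omega> (\<pi> \<omega>) s t k m) \<in> borel_measurable \<P>"
proof -
  have "(\<lambda>\<omega>. emp_mean \<omega> (\<pi> \<omega>) s t k n) \<in> borel_measurable \<P>" if n: "n \<in> agents I" for n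
  proof -
    have "(\<Sum>u\<in>play_times (\<pi> \<omega>) s t k n. \<omega> (k, n, u)) =
        (\<Sum>u\<in>{s<..t}. if \<pi> \<omega> n u = Some k then \<omega> (k, n, u) else 0)" for \<omega>
      by (simp add: sum.If_cases play_times_def Int_def)
    moreover have "(\<lambda>\<omega>. \<Sum>u\<in>{s<..t}. if \<pi> \<omega> n u = Some k then \<omega> (k, n, u) else 0) \<in> borel_measurable \<P>"
      by (intro borel_measurable_sum measurable_If play_measurable[unfolded pred_def] reward_measurable assms n) auto
    ultimately show ?thesis
      unfolding emp_mean_def using num_plays_measurable[OF assms(1) n] by simp
  qed
  then show ?thesis
    unfolding emp_mixed_def by (intro borel_measurable_sum borel_measurable_times) auto
qed

lemma width_measurable:
  assumes "policy I \<pi>"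
  shows "(\<lambda>\<omega>. width g I \<delta> (\<pi> \<omega>) s t k m) \<in> borel_measurable \<P>"
proof -
  have "Measurable.pred \<P> (\<lambda>\<omega>. real (num_plays (\<pi> \<omega>) s t k n) = 0)" if "n \<in> agents I" for n
    unfolding pred_def
    by (intro borel_measurable_eq borel_measurable_const num_plays_measurable[OF assms that])
  then have "Measurable.pred \<P> (\<lambda>\<omega>. num_plays (\<pi> \<omega>) s t k n = 0)" if "n \<in> agents I" for n
    using that by simp
  then have "Measurable.pred \<P> (\<lambda>\<omega>. \<exists>n\<in>agents I. num_plays (\<pi> \<omega>) s t k n = 0)"
    by (rule pred_intros_finite(4)[OF finite_atLeastAtMost])
  moreover have "(\<lambda>\<omega>. beta g I \<delta> (num_plays (\<pi> \<omega>) s t k)) \<in> borel_measurable \<P>"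
    unfolding beta_def
    by (intro borel_measurable_times borel_measurable_add borel_measurable_sum borel_measurable_const
        borel_measurable_ln num_plays_measurable[OF assms])
  moreover have "(\<lambda>\<omega>. \<Sum>n\<in>agents I. (w n m)\<^sup>2 / real (num_plays (\<pi> \<omega>) s t k n)) \<in> borel_measurable \<P>"
    by (intro borel_measurable_sum borel_measurable_divide borel_measurable_const
        num_plays_measurable[OF assms])
  ultimately show ?thesis
    unfolding width_def by measurable
qed

lemma confident_measurable:
  assumes "policy I \<pi>"
  shows "Measurable.pred \<P> (\<lambda>\<omega>. confident g I \<delta> \<omega> (\<pi> \<omega>) s t)"
  unfolding confident_def
proof (intro pred_intros_finite(3))
  fix k m assume km: "k \<in> arms I" "m \<in> agents I"
  have "(\<lambda>\<omega>. ereal \<bar>emp_mixed I \<omega> (\<pi> \<omega>) s t k m - mixed_mean I k m\<bar>) \<in> borel_measurable \<P>"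
    by (intro borel_measurable_ereal borel_measurable_abs borel_measurable_diff borel_measurable_const
        emp_mixed_measurable[OF assms km(1)])
  then show "Measurable.pred \<P> (\<lambda>\<omega>. ereal \<bar>emp_mixed I \<omega> (\<pi> \<omega>) s t k m - mixed_mean I k m\<bar>
      \<le> width g I \<delta> (\<pi> \<omega>) s t k m)"
    unfolding pred_def by (rule borel_measurable_le) (rule width_measurable[OF assms])
qed auto

lemma unconfident_prob:
  assumes "concentration g I" "policy I \<pi>" "0 < \<delta>" "\<delta> < 1"
  shows "measure \<P> {\<omega> \<in> space \<P>. \<exists>t. \<not> confident g I \<delta> \<omega> (\<pi> \<omega>) 0 t} \<le> \<delta>"
    and "{\<omega> \<in> space \<P>. \<exists>t. \<not> confident g I \<delta> \<omega> (\<pi> \<omega>) s t} \<in> sets \<P>"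
proof -
  interpret R: prob_space \<P>
    by (rule prob_space_R)
  let ?G = "{\<omega> \<in> space \<P>. \<forall>t. confident g I \<delta> \<omega> (\<pi> \<omega>) 0 t}"
  note [measurable] = confident_measurable[OF assms(2)]
  show "{\<omega> \<in> space \<P>. \<exists>t. \<not> confident g I \<delta> \<omega> (\<pi> \<omega>) s t} \<in> sets \<P>"
    by measurable
  have "?G \<in> sets \<P>"
    by measurable
  moreover have "measure \<P> ?G \<ge> 1 - \<delta>"
    using assms unfolding concentration_def confident_def by blast
  moreover have "{\<omega> \<in> space \<P>. \<exists>t. \<not> confident g I \<delta> \<omega> (\<pi> \<omega>) 0 t} = space \<P> - ?G"
    by blast
  ultimately show "measure \<P> {\<omega> \<in> space \<P>. \<exists>t. \<not> confident g I \<delta> \<omega> (\<pi> \<omega>) 0 t} \<le> \<delta>"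
    by (simp add: R.prob_compl)
qed

text \<open>The data collected after a reset at a fixed time \<open>s\<close> are, given the rewards up to \<open>s\<close>,
  the data of a policy started from scratch, to which the concentration inequality applies.\<close>

lemma unconfident_after_reset:
  assumes conc: "concentration g I" and \<pi>: "policy I \<pi>" and \<delta>: "0 < \<delta>" "\<delta> < 1"
    and A: "A \<in> sets \<P>"
    and past: "\<And>\<omega> \<omega>'. \<omega> \<in> space \<P> \<Longrightarrow> \<omega>' \<in> space \<P> \<Longrightarrow>
      (\<And>k m u. u \<le> s \<Longrightarrow> \<omega> (k, m, u) = \<omega>' (k, m, u)) \<Longrightarrow> \<omega> \<in> A \<Longrightarrow> \<omega>' \<in> A"
  shows "measure \<P> (A \<inter> {\<omega> \<in> space \<P>. \<exists>t. \<not> confident g I \<delta> \<omega> (\<pi> \<omega>) s t}) \<le> \<delta> * measure \<P> A"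
proof -
  interpret R: prob_space \<P>
    by (rule prob_space_R)
  let ?B = "{\<omega> \<in> space \<P>. \<exists>t. \<not> confident g I \<delta> \<omega> (\<pi> \<omega>) s t}"
  let ?f = "\<lambda>(\<omega>, \<omega>'). glue I s \<omega> \<omega>'"
  have B: "?B \<in> sets \<P>"
    by (rule unconfident_prob(2)[OF conc \<pi> \<delta>])
  have AB: "A \<inter> ?B \<in> sets \<P>"
    using A B by blast
  \<comment> \<open>For a first table outside \<open>A\<close> the slice is empty; for one in
    \<open>A\<close> it lies in the failure event of the shifted policy, of probability at most
    \<delta>. Integrating over the first table gives the product.\<close>
  have slice: "emeasure \<P> (Pair \<omega> -` (?f -` (A \<inter> ?B) \<inter> space (\<P> \<Otimes>\<^sub>M \<P>))) \<le> ennreal \<delta> * indicator A \<omega>"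
    if \<omega>: "\<omega> \<in> space \<P>" for \<omega>
  proof -
    let ?S = "Pair \<omega> -` (?f -` (A \<inter> ?B) \<inter> space (\<P> \<Otimes>\<^sub>M \<P>))"
    let ?U = "{\<omega>' \<in> space \<P>. \<exists>t. \<not> confident g I \<delta> \<omega>' (shift_policy I s \<pi> \<omega> \<omega>') 0 t}"
    note pol = shift_policy_is_policy[OF \<pi> \<omega>, of s]
    have "\<omega> \<in> A \<and> \<omega>' \<in> ?U" if mem: "\<omega>' \<in> ?S" for \<omega>'
    proof
      have \<omega>': "\<omega>' \<in> space \<P>" and sA: "glue I s \<omega> \<omega>' \<in> A"
        using mem \<omega> by (auto simp: space_pair_measure)
      \<comment> \<open>This includes indices outside \<open>idx\<close>, where both tables are
        \<open>undefined\<close>.\<close>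
      have eq: "glue I s \<omega> \<omega>' (k, m, u) = \<omega> (k, m, u)" if "u \<le> s" for k m u
        using that \<omega> by (auto simp: glue_def restrict_def space_R extensional_def)
      show "\<omega> \<in> A"
        by (rule past[OF glue_in_space \<omega> eq sA])
      obtain t where t: "\<not> confident g I \<delta> (glue I s \<omega> \<omega>') (\<pi> (glue I s \<omega> \<omega>')) s t"
        using mem by auto
      \<comment> \<open>Before the reset there are no data, all widths are infinite, and no failure
        can occur.\<close>
      have "s \<le> t"
      proof (rule ccontr)
        assume "\<not> s \<le> t"
        then have "num_plays p s t k n = 0" for p k n
          by (simp add: num_plays_def play_times_def)
        moreover have "1 \<in> agents I"
          using M_ge by simp
        ultimately have "width g I \<delta> p s t k m = \<infinity>" for p k m
          unfolding width_def by auto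
        with t show False
          by (simp add: confident_def)
      qed
      then obtain v where v: "t = s + v"
        using le_Suc_ex by blast
      have "confident g I \<delta> (glue I s \<omega> \<omega>') (\<pi> (glue I s \<omega> \<omega>')) s (s + v) \<longleftrightarrow>
          confident g I \<delta> \<omega>' (shift_policy I s \<pi> \<omega> \<omega>') 0 v"
        unfolding shift_policy_def by (rule confident_shift) (auto simp: glue_def)
      with t v \<omega>' show "\<omega>' \<in> ?U"
        by auto
    qed
    then have sub: "?S \<subseteq> (if \<omega> \<in> A then ?U else {})"
      by auto
    have "emeasure \<P> ?S \<le> emeasure \<P> (if \<omega> \<in> A then ?U else {})"
      using sub unconfident_prob(2)[OF conc pol \<delta>, of 0] by (intro emeasure_mono) auto
    also have "\<dots> \<le> ennreal \<delta> * indicator A \<omega>"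
      using unconfident_prob(1)[OF conc pol \<delta>] \<delta>
      by (auto simp: R.emeasure_eq_measure ennreal_le_iff)
    finally show ?thesis .
  qed
  have "emeasure \<P> (A \<inter> ?B) = emeasure (distr (\<P> \<Otimes>\<^sub>M \<P>) \<P> ?f) (A \<inter> ?B)"
    by (simp only: distr_glue)
  also have "\<dots> = emeasure (\<P> \<Otimes>\<^sub>M \<P>) (?f -` (A \<inter> ?B) \<inter> space (\<P> \<Otimes>\<^sub>M \<P>))"
    by (rule emeasure_distr[OF glue_measurable AB])
  also have "\<dots> = (\<integral>\<^sup>+\<omega>. emeasure \<P> (Pair \<omega> -` (?f -` (A \<inter> ?B) \<inter> space (\<P> \<Otimes>\<^sub>M \<P>))) \<partial>\<P>)"
    by (rule R.emeasure_pair_measure_alt) (rule measurable_sets[OF glue_measurable AB])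
  also have "\<dots> \<le> (\<integral>\<^sup>+\<omega>. ennreal \<delta> * indicator A \<omega> \<partial>\<P>)"
    by (rule nn_integral_mono) (rule slice)
  also have "\<dots> = ennreal \<delta> * emeasure \<P> A"
    by (rule nn_integral_cmult_indicator[OF A])
  finally have "ennreal (measure \<P> (A \<inter> ?B)) \<le> ennreal (\<delta> * measure \<P> A)"
    using \<delta> by (simp add: R.emeasure_eq_measure ennreal_mult)
  then show ?thesis
    using \<delta> by (simp add: ennreal_le_iff)
qed

end


section \<open>The regret bound\<close>

context bandit_model
begin

lemma cexp2_initial_plays:
  assumes "cexp2 g I T alt \<omega> p" and "k \<in> arms I" "m \<in> agents I"
  shows "num_plays p 0 (K * init_plays T) k m = init_plays T"
proof -
  obtain e where e: "phase I p 0 e (\<lambda>k m. init_plays T)"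
    using assms(1) unfolding cexp2_def by blast
  have "(\<lambda>m. \<Sum>k\<in>arms I. init_plays T) ` agents I = {K * init_plays T}"
    using M_ge by auto
  then have "e = K * init_plays T"
    using e by (simp add: phase_def)
  with phase_bounds(2)[OF e assms(2,3)] show ?thesis
    by simp
qed

lemma regret_eq: "regret I \<pi> T = (\<integral>\<omega>. path_regret I (\<pi> \<omega>) 0 T \<partial>\<P>)"
proof -
  have "{1..T} = {0<..T}"
    by auto
  then show ?thesis
    unfolding regret_def path_regret_def by simp
qed

text \<open>The regret is dominated on each path by multiples of indicators and then integrated:
  \<open>V1\<close> for accurate estimates, \<open>V2\<close> for inaccurate ones with valid
  confidence bounds, and the trivial bound \<open>V * real T\<close> for failures. The latter is
  paid with probability at most 1/T for data since time 0, and \<epsilon>/T for each reset time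
  jointly with inaccuracy.\<close>

lemma regret_bound:
  fixes T R X Y :: nat and \<epsilon> :: real
  defines "\<tau> \<equiv> init_plays T" and "LL \<equiv> ln (ln (real T))"
  assumes conc: "concentration g I" and run: "cexp2_run g I T (wcpe_reg g I T) \<pi>"
    and T: "T \<ge> 2"
    and g_pos: "g M (1 / real T / (real K * real M)) > 0" "g M (\<epsilon> / (real K * real M)) > 0"
    and LL_bounds: "LL \<ge> 1" "1 / LL \<le> 3 / 4 * gap_min I" "5 / 4 * gap_max I \<le> LL"
    and \<tau>: "\<tau> \<ge> 1"
    and Y: "36 * real K * real M ^ 2 * LL ^ 4 * beta g I (1 / real T) (\<lambda>n. T) + 1 \<le> real Y"
      "K * (\<tau> + Y) \<le> T"
    and R: "4 * (1 / 2) ^ R < gap_min I"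
    and X: "real K * real M ^ 2 * 4 ^ R * beta g I (1 / real T) (\<lambda>n. 2 * T) \<le> real X" "X \<le> T"
    and \<epsilon>: "0 < \<epsilon>" "\<epsilon> < 1" "beta g I \<epsilon> (\<lambda>n. \<tau>) * (64 * real M / (gap_min I)\<^sup>2) \<le> real \<tau>"
  defines "V \<equiv> real M * gap_max I"
  shows "regret I \<pi> T \<le> real K * real M * (real \<tau> + 1) * gap_max I
      + 360 * beta g I (1 / real T) (\<lambda>n. T) * c_star I + V
      + \<epsilon> * (V * (real K * (real \<tau> + real Y) + real K + real (R + 1) * (real K * real M * real X))
        + V * (real K * (real \<tau> + real Y) + 1))"
proof -
  interpret P: prob_space \<P>
    by (rule prob_space_R)
  have \<pi>: "policy I \<pi>" and cexp: "\<And>\<omega>. \<omega> \<in> space \<P> \<Longrightarrow> cexp2 g I T (wcpe_reg g I T) \<omega> (\<pi> \<omega>)"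
    using run by (auto simp: cexp2_run_def)
  have \<delta>: "0 < 1 / real T" "1 / real T < 1"
    using T by auto
  define Tie where "Tie = K * \<tau>"
  define S where "S = {Tie..K * (\<tau> + Y)}"
  define V1 where "V1 = real K * real M * (real \<tau> + 1) * gap_max I
      + 360 * beta g I (1 / real T) (\<lambda>n. T) * c_star I"
  define V2 where "V2 = V * (real K * (real \<tau> + real Y) + real K + real (R + 1) * (real K * real M * real X))"
  define E where "E = {\<omega> \<in> space \<P>. \<exists>t. \<not> confident g I (1 / real T) \<omega> (\<pi> \<omega>) 0 t}"
  define Bad where "Bad = (\<lambda>s. {\<omega> \<in> space \<P>. \<exists>t. \<not> confident g I (1 / real T) \<omega> (\<pi> \<omega>) s t})"
  define A where "A = {\<omega> \<in> space \<P>. \<exists>k\<in>arms I. \<exists>m\<in>agents I.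
    gap_min I / 8 < \<bar>emp_mixed I \<omega> (\<pi> \<omega>) 0 Tie k m - mixed_mean I k m\<bar>}"
  have V0: "V \<ge> 0"
    using gap_max_pos by (simp add: V_def)
  have E: "E \<in> sets \<P>" "measure \<P> E \<le> 1 / real T"
    unfolding E_def by (rule unconfident_prob[OF conc \<pi> \<delta>])+
  have Bad: "Bad s \<in> sets \<P>" for s
    unfolding Bad_def by (rule unconfident_prob(2)[OF conc \<pi> \<delta>])
  have A: "A \<in> sets \<P>"
  proof -
    have "Measurable.pred \<P> (\<lambda>\<omega>. gap_min I / 8 < \<bar>emp_mixed I \<omega> (\<pi> \<omega>) 0 Tie k m - mixed_mean I k m\<bar>)"
      if "k \<in> arms I" for k m
      unfolding pred_def
      by (intro borel_measurable_less borel_measurable_const borel_measurable_abs borel_measurable_diff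
          emp_mixed_measurable[OF \<pi> that])
    then have "Measurable.pred \<P> (\<lambda>\<omega>. \<exists>k\<in>arms I. \<exists>m\<in>agents I.
        gap_min I / 8 < \<bar>emp_mixed I \<omega> (\<pi> \<omega>) 0 Tie k m - mixed_mean I k m\<bar>)"
      by (intro pred_intros_finite(4) finite_atLeastAtMost)
    then show ?thesis
      unfolding A_def pred_def .
  qed
  have A_prob: "measure \<P> A \<le> \<epsilon>"
  proof -
    \<comment> \<open>The constant allocation for accuracy \<open>gap_min I / 8\<close>: M divided
      by \<open>?x\<close> is the square of that accuracy. The level \<epsilon> belongs to the
      analysis alone; the algorithm works with 1/T.\<close>
    let ?x = "64 * real M / (gap_min I)\<^sup>2"
    have x: "?x > 0"
      using M_ge gap_min_pos by simp
    have "A \<subseteq> {\<omega> \<in> space \<P>. \<exists>t. \<not> confident g I \<epsilon> \<omega> (\<pi> \<omega>) 0 t}"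
    proof
      fix \<omega> assume "\<omega> \<in> A"
      then obtain k m where \<omega>: "\<omega> \<in> space \<P>" and km: "k \<in> arms I" "m \<in> agents I"
        and dev: "gap_min I / 8 < \<bar>emp_mixed I \<omega> (\<pi> \<omega>) 0 Tie k m - mixed_mean I k m\<bar>"
        unfolding A_def by blast
      have N: "num_plays (\<pi> \<omega>) 0 Tie k n = \<tau>" if "n \<in> agents I" for n
        unfolding Tie_def \<tau>_def by (rule cexp2_initial_plays[OF cexp[OF \<omega>] km(1) that])
      have beq: "beta g I \<epsilon> (num_plays (\<pi> \<omega>) 0 Tie k) = beta g I \<epsilon> (\<lambda>n. \<tau>)"
        unfolding beta_def using N by simp
      have b: "beta g I \<epsilon> (\<lambda>n. \<tau>) > 0"
        using beta_ge[of g I \<epsilon> "\<lambda>n. \<tau>"] g_pos(2) by simp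
      have "width g I \<epsilon> (\<pi> \<omega>) 0 Tie k m \<le> ereal (gap_min I / 8)"
      proof (rule width_le_of_allocation[where q = "\<lambda>n. ?x" and b = "beta g I \<epsilon> (\<lambda>n. \<tau>)"])
        have "(\<Sum>n\<in>agents I. (w n m)\<^sup>2 / ?x) \<le> (\<Sum>n\<in>agents I. 1 / ?x)"
          using x weight_square_le km(2) by (intro sum_mono divide_right_mono) auto
        also have "\<dots> = (gap_min I / 8)\<^sup>2"
          using M_ge by (simp add: power_divide)
        finally show "(\<Sum>n\<in>agents I. (w n m)\<^sup>2 / ?x) \<le> (gap_min I / 8)\<^sup>2" .
      qed (use N \<tau> x \<epsilon> b beq gap_min_pos in auto)
      moreover have "ereal (gap_min I / 8) < ereal \<bar>emp_mixed I \<omega> (\<pi> \<omega>) 0 Tie k m - mixed_mean I k m\<bar>"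
        using dev by simp
      ultimately have "\<not> confident g I \<epsilon> \<omega> (\<pi> \<omega>) 0 Tie"
        unfolding confident_def using km by (meson leD order_le_less_trans)
      with \<omega> show "\<omega> \<in> {\<omega> \<in> space \<P>. \<exists>t. \<not> confident g I \<epsilon> \<omega> (\<pi> \<omega>) 0 t}"
        by blast
    qed
    then have "measure \<P> A \<le> measure \<P> {\<omega> \<in> space \<P>. \<exists>t. \<not> confident g I \<epsilon> \<omega> (\<pi> \<omega>) 0 t}"
      by (rule P.finite_measure_mono) (rule unconfident_prob(2)[OF conc \<pi> \<epsilon>(1,2)])
    also have "\<dots> \<le> \<epsilon>"
      by (rule unconfident_prob(1)[OF conc \<pi> \<epsilon>(1,2)])
    finally show ?thesis .
  qed
  have ABad: "measure \<P> (A \<inter> Bad s) \<le> 1 / real T * \<epsilon>" if s: "s \<in> S" for s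
  proof -
    have "measure \<P> (A \<inter> Bad s) \<le> 1 / real T * measure \<P> A"
      unfolding Bad_def
    proof (rule unconfident_after_reset[OF conc \<pi> \<delta> A])
      fix \<omega> \<omega>' assume \<omega>: "\<omega> \<in> space \<P>" "\<omega>' \<in> space \<P>" and "\<omega> \<in> A"
        and eq: "\<And>k m u. u \<le> s \<Longrightarrow> \<omega> (k, m, u) = \<omega>' (k, m, u)"
      \<comment> \<open>Inaccuracy is decided by the data up to \<open>Tie\<close>, which precedes
        every reset time in \<open>S\<close>; so it depends only on rewards that resampling after
        \<open>s\<close> preserves.\<close>
      have le: "Tie \<le> s"
        using s by (simp add: S_def)
      have "emp_mixed I \<omega> (\<pi> \<omega>) 0 Tie k m = emp_mixed I \<omega>' (\<pi> \<omega>') 0 Tie k m" for k m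
        by (rule emp_mixed_cong) (use le eq in \<open>auto intro!: policy_prefix[OF \<pi> \<omega>]\<close>)
      with \<open>\<omega> \<in> A\<close> \<omega>(2) show "\<omega>' \<in> A"
        by (simp add: A_def)
    qed
    also have "\<dots> \<le> 1 / real T * \<epsilon>"
      using A_prob by (intro mult_left_mono) auto
    finally show ?thesis .
  qed
  \<comment> \<open>The sum over \<open>S\<close> is the union bound over the reset time, which
    varies with the rewards.\<close>
  let ?F = "\<lambda>\<omega>. V1 + (V * real T) * indicator E \<omega> + V2 * indicator A \<omega>
    + (V * real T) * (\<Sum>s\<in>S. indicator (A \<inter> Bad s) \<omega>)"
  have V1: "V1 \<ge> 0"
    using gap_max_pos c_star_pos beta_ge[of g I "1 / real T" "\<lambda>n. T"] g_pos(1) by (simp add: V1_def)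
  have V2: "V2 \<ge> 0"
    using V0 by (simp add: V2_def)
  have le_F: "path_regret I (\<pi> \<omega>) 0 T \<le> ?F \<omega>" if \<omega>: "\<omega> \<in> space \<P>" for \<omega>
  proof -
    have VT: "path_regret I (\<pi> \<omega>) 0 T \<le> V * real T"
      unfolding V_def by (rule path_regret_le[OF policy_valid[OF \<pi> \<omega>]]) auto
    have nn: "V * real T * (\<Sum>s\<in>S. indicator (A \<inter> Bad s) \<omega>) \<ge> 0"
      using V0 by (intro mult_nonneg_nonneg sum_nonneg) auto
    show ?thesis
    proof (cases "\<omega> \<in> E")
      case True
      have "V2 * indicator A \<omega> \<ge> 0"
        using V2 by simp
      then show ?thesis
        using True VT V1 nn by simp
    next
      case False
      interpret cexp2_path \<sigma> I g T \<omega> "\<pi> \<omega>" Y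
        by unfold_locales
          (use policy_valid[OF \<pi> \<omega>] cexp[OF \<omega>] False \<omega> g_pos LL_bounds \<tau> Y in \<open>auto simp: E_def \<tau>_def LL_def\<close>)
      show ?thesis
      proof (cases "\<omega> \<in> A")
        case False
        have "path_regret I (\<pi> \<omega>) 0 T \<le> V1"
          unfolding V1_def \<tau>_def
          by (rule regret_if_accurate)
             (use False \<omega> LL_bounds in \<open>auto simp: A_def Tie_def \<tau>_def LL_def not_less\<close>)
        then show ?thesis
          using False \<open>\<omega> \<notin> E\<close> by simp
      next
        case True
        show ?thesis
        proof (cases "\<exists>s\<in>S. \<omega> \<in> Bad s")
          case True
          then obtain s where s: "s \<in> S" "\<omega> \<in> Bad s"
            by blast
          have "1 = (indicator (A \<inter> Bad s) \<omega> :: real)"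
            using s \<open>\<omega> \<in> A\<close> by simp
          also have "\<dots> \<le> (\<Sum>s\<in>S. indicator (A \<inter> Bad s) \<omega>)"
            by (rule member_le_sum[OF s(1)]) (auto simp: S_def)
          finally have "V * real T * 1 \<le> V * real T * (\<Sum>s\<in>S. indicator (A \<inter> Bad s) \<omega>)"
            using V0 by (intro mult_left_mono) auto
          then show ?thesis
            using VT V1 V2 \<open>\<omega> \<in> A\<close> \<open>\<omega> \<notin> E\<close> by simp
        next
          case False
          have "path_regret I (\<pi> \<omega>) 0 T \<le> V2"
            unfolding V2_def V_def \<tau>_def
            by (rule regret_if_inaccurate[OF _ R X])
               (use False \<omega> in \<open>auto simp: S_def Tie_def \<tau>_def Bad_def\<close>)
          then show ?thesis
            using V1 nn \<open>\<omega> \<in> A\<close> \<open>\<omega> \<notin> E\<close> by simp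
        qed
      qed
    qed
  qed
  have F_int: "integrable \<P> ?F"
    using A Bad E by (intro Bochner_Integration.integrable_add integrable_mult_right
      Bochner_Integration.integrable_sum P.integrable_const integrable_real_indicator)
      (auto simp: P.emeasure_eq_measure)
  have "regret I \<pi> T \<le> (\<integral>\<omega>. ?F \<omega> \<partial>\<P>)"
    unfolding regret_eq
  \<comment> \<open>The rule asks for integrability of the dominating function; were the regret not
    integrable, its integral would be 0, which the sign of \<open>?F\<close> covers.\<close>
  proof (rule integral_mono_AE')
    show "AE \<omega> in \<P>. path_regret I (\<pi> \<omega>) 0 T \<le> ?F \<omega>"
      using le_F by (rule AE_I2)
    show "AE \<omega> in \<P>. 0 \<le> ?F \<omega>"
      by (rule AE_I2) (rule order_trans[OF path_regret_nonneg[OF policy_valid[OF \<pi>]] le_F])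
  qed (rule F_int)
  also have "(\<integral>\<omega>. ?F \<omega> \<partial>\<P>) = V1 + V * real T * measure \<P> E + V2 * measure \<P> A
      + V * real T * (\<Sum>s\<in>S. measure \<P> (A \<inter> Bad s))"
  proof -
    have fin: "emeasure \<P> B < \<infinity>" for B
      by (simp add: P.emeasure_eq_measure)
    have "(\<integral>\<omega>. (\<Sum>s\<in>S. indicator (A \<inter> Bad s) \<omega>) \<partial>\<P>) = (\<Sum>s\<in>S. measure \<P> (A \<inter> Bad s))"
      by (subst Bochner_Integration.integral_sum)
         (use A Bad fin in \<open>auto intro!: integrable_real_indicator simp: Int_absorb2 sets.sets_into_space\<close>)
    moreover have "integrable \<P> (\<lambda>\<omega>. \<Sum>s\<in>S. indicator (A \<inter> Bad s) \<omega> :: real)"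
      using A Bad fin by (intro Bochner_Integration.integrable_sum integrable_real_indicator) auto
    moreover have "integrable \<P> (indicator A :: _ \<Rightarrow> real)" "integrable \<P> (indicator E :: _ \<Rightarrow> real)"
      using A E fin by (auto intro!: integrable_real_indicator)
    ultimately show ?thesis
      using A E by (simp add: P.prob_space Int_absorb2 sets.sets_into_space)
  qed
  also have "\<dots> \<le> V1 + V + V2 * \<epsilon> + V * (real K * (real \<tau> + real Y) + 1) * \<epsilon>"
  proof (intro add_mono order_refl)
    have "V * real T * measure \<P> E \<le> V * real T * (1 / real T)"
      using E V0 by (intro mult_left_mono) auto
    then show "V * real T * measure \<P> E \<le> V"
      using T by simp
    show "V2 * measure \<P> A \<le> V2 * \<epsilon>"
      using A_prob V2 by (rule mult_left_mono)
    have "(\<Sum>s\<in>S. measure \<P> (A \<inter> Bad s)) \<le> (\<Sum>s\<in>S. 1 / real T * \<epsilon>)"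
      by (rule sum_mono) (rule ABad)
    also have "\<dots> = real (card S) * (1 / real T * \<epsilon>)"
      by simp
    also have "\<dots> \<le> (real K * (real \<tau> + real Y) + 1) * (1 / real T * \<epsilon>)"
    proof (rule mult_right_mono)
      have "card S \<le> K * (\<tau> + Y) + 1"
        by (simp add: S_def)
      then have "real (card S) \<le> real (K * (\<tau> + Y) + 1)"
        by (rule of_nat_mono)
      then show "real (card S) \<le> real K * (real \<tau> + real Y) + 1"
        by simp
    qed (use \<epsilon> in simp)
    finally have "V * real T * (\<Sum>s\<in>S. measure \<P> (A \<inter> Bad s))
        \<le> V * real T * ((real K * (real \<tau> + real Y) + 1) * (1 / real T * \<epsilon>))"
      using V0 by (intro mult_left_mono) auto
    then show "V * real T * (\<Sum>s\<in>S. measure \<P> (A \<inter> Bad s)) \<le> V * (real K * (real \<tau> + real Y) + 1) * \<epsilon>"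
      using T by simp
  qed
  finally show ?thesis
    by (simp add: V1_def V2_def algebra_simps)
qed

end

text \<open>The ratio in the asymptotics is eventually below 3/2, and the iterated logarithm adds at
  most a third of log (1/\<delta>): 3/2 * 4/3 = 2.\<close>

lemma threshold_bounds:
  assumes "threshold_family g" "M \<ge> 1"
  shows "\<forall>\<^sub>F \<delta> in at_right 0. 0 < g M \<delta> \<and> g M \<delta> \<le> 2 * ln (1 / \<delta>)"
proof -
  let ?h = "\<lambda>\<delta>::real. ln (1 / \<delta>) + real M * ln (ln (1 / \<delta>))"
  have "g M \<sim>[at_right 0] ?h"
    using assms by (auto simp: threshold_family_def)
  then have lim: "((\<lambda>\<delta>. if g M \<delta> = 0 \<and> ?h \<delta> = 0 then 1 else g M \<delta> / ?h \<delta>) \<longlongrightarrow> 1) (at_right 0)"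
    by (simp add: asymp_equiv_def)
  have "\<forall>\<^sub>F \<delta> in at_right 0. (if g M \<delta> = 0 \<and> ?h \<delta> = 0 then 1 else g M \<delta> / ?h \<delta>) > 0"
    by (rule order_tendstoD(1)[OF lim]) simp
  moreover have "\<forall>\<^sub>F \<delta> in at_right 0. (if g M \<delta> = 0 \<and> ?h \<delta> = 0 then 1 else g M \<delta> / ?h \<delta>) < 3 / 2"
    by (rule order_tendstoD(2)[OF lim]) simp
  moreover have "\<forall>\<^sub>F \<delta> in at_right 0. ?h \<delta> > 0"
    by real_asymp
  moreover have "\<forall>\<^sub>F \<delta> in at_right 0. ?h \<delta> \<le> 4 / 3 * ln (1 / \<delta>)"
    by real_asymp
  ultimately show ?thesis
  proof eventually_elim
    case (elim \<delta>)
    then have "g M \<delta> / ?h \<delta> > 0" "g M \<delta> / ?h \<delta> < 3 / 2"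
      by auto
    then have "g M \<delta> > 0" "g M \<delta> < 3 / 2 * ?h \<delta>"
      using elim(3) by (auto simp: zero_less_divide_iff pos_divide_less_eq)
    with elim(4) show ?case
      by auto
  qed
qed

context bandit_model
begin

lemma beta_const:
  "beta g I \<delta> (\<lambda>n. N) = 2 * g M (\<delta> / (real K * real M)) + 4 * real M * ln (4 + ln (real N))"
  by (simp add: beta_def)

text \<open>\<open>R\<close> is fixed by the instance; with \<open>X\<close>, \<open>Y\<close> and
  \<open>\<epsilon>\<close> chosen as functions of T, the hypotheses of the integrated bound become
  finitely many asymptotic inequalities between T and its iterated logarithms.\<close>

lemma eventually_regret_bound:
  assumes g: "threshold_family g" and conc: "concentration g I"
  shows "\<forall>\<^sub>F T in sequentially. \<forall>\<pi>. cexp2_run g I T (wcpe_reg g I T) \<pi> \<longrightarrow>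
    regret I \<pi> T \<le> 2000 * (c_star I * ln (real T))"
proof -
  define k where "k = real K * real M"
  define a where "a = 64 * real M / (gap_min I)\<^sup>2"
  \<comment> \<open>At level \<open>\<epsilon> T\<close> the threshold is at most 5 c sqrt (log T),
    so with this \<open>c\<close> its product with \<open>a\<close> is at most sqrt (log T), which
    the initial plays reach.\<close>
  define c where "c = 1 / (5 * a)"
  define \<epsilon> where "\<epsilon> = (\<lambda>T::nat. exp (- (c * sqrt (ln (real T)))))"
  obtain R where R: "4 * (1 / 2) ^ R < gap_min I"
  proof -
    obtain n where "(1 / 2 :: real) ^ n < gap_min I / 4"
      using real_arch_pow_inv[of "gap_min I / 4" "1 / 2"] gap_min_pos by auto
    then show ?thesis
      by (intro that[of n]) simp
  qed
  \<comment> \<open>Here 180 = 36 * 5, and the factors 5 in \<open>A\<close> and \<open>B\<close>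
    come from bounding \<open>beta\<close> by 5 log T in the requirements on \<open>Y\<close> and
    \<open>X\<close>.\<close>
  define A where "A = 180 * real K * real M ^ 2"
  define B where "B = 5 * real K * real M ^ 2 * 4 ^ R"
  define Y where "Y = (\<lambda>T::nat. nat \<lceil>A * ln (ln (real T)) ^ 4 * ln (real T) + 1\<rceil>)"
  define X where "X = (\<lambda>T::nat. nat \<lceil>B * ln (real T)\<rceil>)"
  define V where "V = real M * gap_max I"
  define r where "r = real (R + 1) * (real K * real M)"
  have K0: "real K > 0" and M0: "real M > 0"
    using K_ge M_ge by auto
  have k: "k > 0" and a: "a > 0" and c: "c > 0" and A: "A > 0" and B: "B > 0" and V: "V > 0"
    and r: "r > 0" and cs: "c_star I > 0" and gm: "gap_min I > 0" and gx: "gap_max I > 0"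
    using K0 M0 gap_min_pos gap_max_pos c_star_pos
    by (auto simp: k_def a_def c_def A_def B_def V_def r_def)
  have lim1: "filterlim (\<lambda>T::nat. 1 / real T / k) (at_right 0) sequentially"
    using k by real_asymp
  have lim2: "filterlim (\<lambda>T::nat. exp (- (c * sqrt (ln (real T)))) / k) (at_right 0) sequentially"
    using k c by real_asymp
  note ev1 = eventually_compose_filterlim[OF threshold_bounds[OF g M_ge] lim1]
  note ev2 = eventually_compose_filterlim[OF threshold_bounds[OF g M_ge] lim2]
  have e1: "\<forall>\<^sub>F T::nat in sequentially. T \<ge> 2"
    by (rule eventually_ge_at_top)
  have e2: "\<forall>\<^sub>F T::nat in sequentially. ln (ln (real T)) \<ge> 1"
    by real_asymp
  have e3: "\<forall>\<^sub>F T::nat in sequentially. 1 / ln (ln (real T)) \<le> 3 / 4 * gap_min I"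
    using gm by real_asymp
  have e4: "\<forall>\<^sub>F T::nat in sequentially. 5 / 4 * gap_max I \<le> ln (ln (real T))"
    using gx by real_asymp
  have e5: "\<forall>\<^sub>F T::nat in sequentially. sqrt (ln (real T)) > 0"
    by real_asymp
  \<comment> \<open>\<open>beta\<close> contains \<open>2 * g\<close>, and \<open>g\<close> is at
    most 2 log (1/\<delta>), whence the coefficient 4. The fifth log T absorbs \<open>k\<close> and
    the iterated logarithms.\<close>
  have e6: "\<forall>\<^sub>F T::nat in sequentially.
      4 * ln (1 / (1 / real T / k)) + 4 * real M * ln (4 + ln (2 * real T)) \<le> 5 * ln (real T)"
    using k M0 by real_asymp
  have e6': "\<forall>\<^sub>F T::nat in sequentially. ln (4 + ln (real T)) \<le> ln (4 + ln (2 * real T))"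
    by real_asymp
  have e7: "\<forall>\<^sub>F T::nat in sequentially. real K * (sqrt (ln (real T)) + 1 +
      (A * ln (ln (real T)) ^ 4 * ln (real T) + 2)) \<le> real T"
    using K0 A by real_asymp
  have e8: "\<forall>\<^sub>F T::nat in sequentially. B * ln (real T) + 1 \<le> real T"
    using B by real_asymp
  have e9: "\<forall>\<^sub>F T::nat in sequentially. exp (- (c * sqrt (ln (real T)))) < 1"
    using c by real_asymp
  have e10: "\<forall>\<^sub>F T::nat in sequentially. 4 * ln (1 / (exp (- (c * sqrt (ln (real T)))) / k))
      + 4 * real M * ln (4 + ln (sqrt (ln (real T)) + 1)) \<le> 5 * c * sqrt (ln (real T))"
    using c k M0 by real_asymp
  \<comment> \<open>The exponential factor beats the polylogarithmic bracket and sqrt (log T) is of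
    lower order. Positivity of \<open>c_star I\<close> makes the right-hand side grow like log
    T.\<close>
  have e11: "\<forall>\<^sub>F T::nat in sequentially. k * (sqrt (ln (real T)) + 2) * gap_max I + V
      + exp (- (c * sqrt (ln (real T)))) *
        (V * (real K * (sqrt (ln (real T)) + 1 + (A * ln (ln (real T)) ^ 4 * ln (real T) + 2)) + real K
           + r * (B * ln (real T) + 1))
        + V * (real K * (sqrt (ln (real T)) + 1 + (A * ln (ln (real T)) ^ 4 * ln (real T) + 2)) + 1))
      \<le> 200 * (c_star I * ln (real T))"
    using k c A B V r cs gx K0 by real_asymp
  show ?thesis
    using ev1 ev2 e1 e2 e3 e4 e5 e6 e6' e7 e8 e9 e10 e11
  proof eventually_elim
    case (elim T)
    let ?L = "ln (real T)" and ?LL = "ln (ln (real T))" and ?\<tau> = "init_plays T"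
    let ?B = "beta g I (1 / real T) (\<lambda>n. T)"
    have \<tau>: "sqrt ?L \<le> real ?\<tau>" "real ?\<tau> \<le> sqrt ?L + 1"
      using elim(7) unfolding init_plays_def by linarith+
    have Lpos: "?L > 0"
      using elim(3) by simp
    have \<tau>1: "?\<tau> \<ge> 1"
      using \<tau>(1) elim(7) by linarith
    have B2: "beta g I (1 / real T) (\<lambda>n. 2 * T) \<le> 5 * ?L"
      using elim(1,8) unfolding beta_const k_def[symmetric] by simp
    have B1: "?B \<le> 5 * ?L"
      by (rule order_trans[OF beta_mono B2]) simp
    have Yr: "A * ?LL ^ 4 * ?L + 1 \<le> real (Y T)" "real (Y T) \<le> A * ?LL ^ 4 * ?L + 2"
    proof -
      have "A * ?LL ^ 4 * ?L \<ge> 0"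
        using A Lpos by simp
      then show "A * ?LL ^ 4 * ?L + 1 \<le> real (Y T)" "real (Y T) \<le> A * ?LL ^ 4 * ?L + 2"
        unfolding Y_def by linarith+
    qed
    have Xr: "B * ?L \<le> real (X T)" "real (X T) \<le> B * ?L + 1"
    proof -
      have "B * ?L \<ge> 0"
        using B Lpos by simp
      then show "B * ?L \<le> real (X T)" "real (X T) \<le> B * ?L + 1"
        unfolding X_def by linarith+
    qed
    have Kle: "real K * (real ?\<tau> + real (Y T)) \<le> real K * (sqrt ?L + 1 + (A * ?LL ^ 4 * ?L + 2))"
      using \<tau>(2) Yr(2) by (intro mult_left_mono) auto
    show ?case
    proof (intro allI impI)
      fix \<pi> assume run: "cexp2_run g I T (wcpe_reg g I T) \<pi>"
      have "regret I \<pi> T \<le> real K * real M * (real ?\<tau> + 1) * gap_max I + 360 * ?B * c_star I + real M * gap_max I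
        + \<epsilon> T * (real M * gap_max I * (real K * (real ?\<tau> + real (Y T)) + real K
            + real (R + 1) * (real K * real M * real (X T)))
          + real M * gap_max I * (real K * (real ?\<tau> + real (Y T)) + 1))"
      proof (rule regret_bound[OF conc run elim(3) _ _ elim(4,5,6) \<tau>1 _ _ R])
        show "0 < g M (1 / real T / (real K * real M))" "0 < g M (\<epsilon> T / (real K * real M))"
          using elim(1,2) by (auto simp: k_def \<epsilon>_def)
        have "36 * real K * real M ^ 2 * ?LL ^ 4 * ?B \<le> 36 * real K * real M ^ 2 * ?LL ^ 4 * (5 * ?L)"
          using B1 by (intro mult_left_mono) auto
        also have "\<dots> = A * ?LL ^ 4 * ?L"
          by (simp add: A_def)
        finally show "36 * real K * real M ^ 2 * ?LL ^ 4 * ?B + 1 \<le> real (Y T)"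
          using Yr(1) by linarith
        have "real (K * (?\<tau> + Y T)) \<le> real T"
          using Kle elim(10) by simp
        then show "K * (?\<tau> + Y T) \<le> T"
          by (simp only: of_nat_le_iff)
        have "real K * real M ^ 2 * 4 ^ R * beta g I (1 / real T) (\<lambda>n. 2 * T)
            \<le> real K * real M ^ 2 * 4 ^ R * (5 * ?L)"
          using B2 by (intro mult_left_mono) auto
        also have "\<dots> = B * ?L"
          by (simp add: B_def)
        finally show "real K * real M ^ 2 * 4 ^ R * beta g I (1 / real T) (\<lambda>n. 2 * T) \<le> real (X T)"
          using Xr(1) by linarith
        have "real (X T) \<le> real T"
          using Xr(2) elim(11) by linarith
        then show "X T \<le> T"
          by simp
        show "0 < \<epsilon> T" "\<epsilon> T < 1"
          using elim(12) by (auto simp: \<epsilon>_def)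
        have "beta g I (\<epsilon> T) (\<lambda>n. ?\<tau>) \<le> 4 * ln (1 / (\<epsilon> T / k)) + 4 * real M * ln (4 + ln (real ?\<tau>))"
          using elim(2) unfolding beta_const k_def[symmetric] by (simp add: \<epsilon>_def)
        also have "\<dots> \<le> 4 * ln (1 / (\<epsilon> T / k)) + 4 * real M * ln (4 + ln (sqrt ?L + 1))"
        proof -
          have "ln (real ?\<tau>) \<ge> 0" "ln (real ?\<tau>) \<le> ln (sqrt ?L + 1)"
            using \<tau>1 \<tau>(2) by auto
          then show ?thesis
            using M0 by (intro add_left_mono mult_left_mono) auto
        qed
        also have "\<dots> \<le> 5 * c * sqrt ?L"
          using elim(13) by (simp add: \<epsilon>_def)
        finally have "beta g I (\<epsilon> T) (\<lambda>n. ?\<tau>) * a \<le> 5 * c * sqrt ?L * a"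
          using a by (intro mult_right_mono) auto
        also have "\<dots> = sqrt ?L"
          using a by (simp add: c_def)
        finally show "beta g I (\<epsilon> T) (\<lambda>n. ?\<tau>) * (64 * real M / (gap_min I)\<^sup>2) \<le> real ?\<tau>"
          using \<tau>(1) by (simp add: a_def)
      qed
      also have "\<dots> = 360 * ?B * c_star I + (k * (real ?\<tau> + 1) * gap_max I + V
          + \<epsilon> T * (V * (real K * (real ?\<tau> + real (Y T)) + real K + r * real (X T))
            + V * (real K * (real ?\<tau> + real (Y T)) + 1)))"
        by (simp add: k_def V_def r_def algebra_simps)
      also have "\<dots> \<le> 360 * (5 * ?L) * c_star I + (k * (sqrt ?L + 2) * gap_max I + V
          + \<epsilon> T * (V * (real K * (sqrt ?L + 1 + (A * ?LL ^ 4 * ?L + 2)) + real K + r * (B * ?L + 1))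
            + V * (real K * (sqrt ?L + 1 + (A * ?LL ^ 4 * ?L + 2)) + 1)))"
      proof -
        have h1: "360 * ?B * c_star I \<le> 360 * (5 * ?L) * c_star I"
          using B1 cs by (intro mult_right_mono mult_left_mono) auto
        have h2: "k * (real ?\<tau> + 1) * gap_max I \<le> k * (sqrt ?L + 2) * gap_max I"
          using \<tau>(2) k gx by (intro mult_right_mono mult_left_mono) auto
        have h3: "V * (real K * (real ?\<tau> + real (Y T)) + 1)
            \<le> V * (real K * (sqrt ?L + 1 + (A * ?LL ^ 4 * ?L + 2)) + 1)"
          using V by (intro mult_left_mono add_right_mono Kle) auto
        have rX: "r * real (X T) \<le> r * (B * ?L + 1)"
          using Xr(2) r by (intro mult_left_mono) auto
        have h4: "V * (real K * (real ?\<tau> + real (Y T)) + real K + r * real (X T))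
            \<le> V * (real K * (sqrt ?L + 1 + (A * ?LL ^ 4 * ?L + 2)) + real K + r * (B * ?L + 1))"
          using V by (intro mult_left_mono[OF add_mono[OF add_right_mono[OF Kle] rX]]) auto
        have "\<epsilon> T \<ge> 0"
          by (simp add: \<epsilon>_def)
        from mult_left_mono[OF add_mono[OF h4 h3] this] show ?thesis
          by (rule add_mono[OF h1 add_mono[OF add_right_mono[OF h2]]])
      qed
      also have "\<dots> \<le> 360 * (5 * ?L) * c_star I + 200 * (c_star I * ?L)"
        using elim(14) by (simp only: \<epsilon>_def add_le_cancel_left)
      also have "\<dots> = 2000 * (c_star I * ?L)"
        by simp
      finally show "regret I \<pi> T \<le> 2000 * (c_star I * ?L)" .
    qed
  qed
qed

end

theorem theorem5:
  shows "\<exists>C::real. C > 0 \<and>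
    (\<forall>(g :: nat \<Rightarrow> real \<Rightarrow> real) (\<sigma> :: real) (I :: bandit).
       threshold_family g \<and> bandit_instance \<sigma> I \<and> concentration g I \<longrightarrow>
       (\<exists>T0::nat. \<forall>T\<ge>T0. \<forall>\<pi>. cexp2_run g I T (wcpe_reg g I T) \<pi> \<longrightarrow>
          regret I \<pi> T \<le>
            C * (c_star I * ln (real T) + (gap_max I)\<^sup>2 / gap_min I * (ln (ln (real T))) ^ 4)))"
proof (intro exI[of _ "2000 :: real"] conjI allI impI)
  fix g \<sigma> I
  assume asm: "threshold_family g \<and> bandit_instance \<sigma> I \<and> concentration g I"
  then interpret bandit_model \<sigma> I
    by unfold_locales simp
  obtain T0 where T0: "\<And>T \<pi>. T \<ge> T0 \<Longrightarrow> cexp2_run g I T (wcpe_reg g I T) \<pi> \<Longrightarrow>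
      regret I \<pi> T \<le> 2000 * (c_star I * ln (real T))"
    using eventually_regret_bound asm unfolding eventually_sequentially by blast
  have "(gap_max I)\<^sup>2 / gap_min I * (ln (ln (real T))) ^ 4 \<ge> 0" for T :: nat
    using gap_min_pos by simp
  then have "regret I \<pi> T \<le> 2000 * (c_star I * ln (real T)
      + (gap_max I)\<^sup>2 / gap_min I * (ln (ln (real T))) ^ 4)"
    if "T \<ge> T0" "cexp2_run g I T (wcpe_reg g I T) \<pi>" for T \<pi>
    using T0[OF that] by (smt (verit))
  then show "\<exists>T0::nat. \<forall>T\<ge>T0. \<forall>\<pi>. cexp2_run g I T (wcpe_reg g I T) \<pi> \<longrightarrow>
      regret I \<pi> T \<le> 2000 * (c_star I * ln (real T)
        + (gap_max I)\<^sup>2 / gap_min I * (ln (ln (real T))) ^ 4)"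
    by blast
qed simp

end
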